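(* Let $d\ge 1$. A finite graph $\Gamma$ with $d+2$ or more vertices is generically globally rigid in $\mathbb{E}^d$ if and only if $k_{\mathrm{sh}}(\Gamma,d)=d+1$.
   Context: A graph $\Gamma$ has a finite vertex set $\mathcal V$ of size $v$ and an edge set $\mathcal E$ of two-element subsets of $\mathcal V$. A framework $\rho$ of $\Gamma$ in $\mathbb{E}^d$ is a map $\mathcal V\to\mathbb{E}^d$; $C^d(\Gamma)\cong\mathbb{R}^{vd}$ is the space of all of them. $\rho$ is globally rigid if every framework $\sigma\in C^d(\Gamma)$ with the same edge lengths as $\rho$ is congruent to $\rho$ (differs from it by a rigid motion, possibly with reflection, of $\mathbb{E}^d$). $\rho$ is generic if its $vd$ coordinates satisfy no non-trivial polynomial equation with rational coefficients. It is known that either all generic frameworks in $C^d(\Gamma)$ are globally rigid or none are; $\Gamma$ is generically globally rigid in $\mathbb{E}^d$ in the former case. An equilibrium stress matrix of $\rho$ is a real symmetric matrix $\Omega$ indexed by $\mathcal V\times\mathcal V$ with $\Omega(u,w)=0$ whenever $u\ne w$ and $\{u,w\}\notin\mathcal E$, with $\sum_{w}\Omega(u,w)=0$ for all $u$, and with $\sum_{w}\Omega(u,w)\rho(w)=0$ for all $u$. $S(\rho)$ is the vector space of equilibrium stress matrices of $\rho$. The shared stress kernel of $\rho$ is $K(\rho)=\bigcap_{\Omega\in S(\rho)}\ker\Omega\subset\mathbb{R}^{\mathcal V}$. The shared stress nullity $k_{\mathrm{sh}}(\Gamma,d)$ is $\dim K(\rho)$ for a generic framework $\rho\in C^d(\Gamma)$;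 it is independent of the choice of generic $\rho$. *)

theory Defs
  imports "HOL-Analysis.Analysis" "HOL-Library.Poly_Mapping"
begin

text \<open>
  The vertex set is the finite type \<open>'v\<close> and Euclidean \<open>d\<close>-space is \<open>real ^ 'd\<close>, so
  \<open>v = CARD('v)\<close> and \<open>d = CARD('d) \<ge> 1\<close>. A graph is given by its edge set. The type
  \<open>('d, 'v) framework\<close> is the space \<open>C^d(\<Gamma>)\<close>; the coordinate \<open>i\<close> of vertex \<open>u\<close> is \<open>\<rho> $ u $ i\<close>.
\<close>

definition graph_edges :: "'v set set \<Rightarrow> bool" where
  "graph_edges E \<longleftrightarrow> (\<forall>e\<in>E. card e = 2)"

type_synonym ('d, 'v) framework = "real ^ 'd ^ 'v"

definition same_edge_lengths ::
    "'v::finite set set \<Rightarrow> ('d::finite, 'v) framework \<Rightarrow> ('d, 'v) framework \<Rightarrow> bool" where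
  "same_edge_lengths E \<rho> \<sigma> \<longleftrightarrow>
     (\<forall>u w. {u, w} \<in> E \<longrightarrow> dist (\<sigma> $ u) (\<sigma> $ w) = dist (\<rho> $ u) (\<rho> $ w))"

definition congruent_frameworks ::
    "('d::finite, 'v::finite) framework \<Rightarrow> ('d, 'v) framework \<Rightarrow> bool" where
  "congruent_frameworks \<rho> \<sigma> \<longleftrightarrow>
     (\<exists>g t. orthogonal_transformation g \<and> (\<forall>u. \<sigma> $ u = g (\<rho> $ u) + t))"

definition globally_rigid ::
    "'v::finite set set \<Rightarrow> ('d::finite, 'v) framework \<Rightarrow> bool" where
  "globally_rigid E \<rho> \<longleftrightarrow> (\<forall>\<sigma>. same_edge_lengths E \<rho> \<sigma> \<longrightarrow> congruent_frameworks \<rho> \<sigma>)"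

text \<open>
  A rational polynomial in the indeterminates \<open>'x\<close> is a finitely supported family of
  coefficients, indexed by monomials, which are finitely supported families of exponents.
\<close>

definition eval_rat_poly :: "(('x \<Rightarrow>\<^sub>0 nat) \<Rightarrow>\<^sub>0 rat) \<Rightarrow> ('x \<Rightarrow> real) \<Rightarrow> real" where
  "eval_rat_poly p a =
     (\<Sum>m\<in>Poly_Mapping.keys p. of_rat (Poly_Mapping.lookup p m) *
        (\<Prod>x\<in>Poly_Mapping.keys m. a x ^ Poly_Mapping.lookup m x))"

definition generic_framework :: "('d::finite, 'v::finite) framework \<Rightarrow> bool" where
  "generic_framework \<rho> \<longleftrightarrow>
     (\<forall>p :: (('v \<times> 'd) \<Rightarrow>\<^sub>0 nat) \<Rightarrow>\<^sub>0 rat.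
        p \<noteq> 0 \<longrightarrow> eval_rat_poly p (\<lambda>(u, i). \<rho> $ u $ i) \<noteq> 0)"

definition generically_globally_rigid :: "'d::finite itself \<Rightarrow> 'v::finite set set \<Rightarrow> bool" where
  "generically_globally_rigid _ E \<longleftrightarrow>
     (\<forall>\<rho> :: ('d, 'v) framework. generic_framework \<rho> \<longrightarrow> globally_rigid E \<rho>)"

definition equilibrium_stress_matrices ::
    "'v::finite set set \<Rightarrow> ('d::finite, 'v) framework \<Rightarrow> (real ^ 'v ^ 'v) set" where
  "equilibrium_stress_matrices E \<rho> =
     {\<Omega>. transpose \<Omega> = \<Omega> \<and>
          (\<forall>u w. u \<noteq> w \<and> {u, w} \<notin> E \<longrightarrow> \<Omega> $ u $ w = 0) \<and>
          (\<forall>u. (\<Sum>w\<in>UNIV. \<Omega> $ u $ w) = 0) \<and>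
          (\<forall>u. (\<Sum>w\<in>UNIV. (\<Omega> $ u $ w) *\<^sub>R (\<rho> $ w)) = 0)}"

definition shared_stress_kernel ::
    "'v::finite set set \<Rightarrow> ('d::finite, 'v) framework \<Rightarrow> (real ^ 'v) set" where
  "shared_stress_kernel E \<rho> = (\<Inter>\<Omega>\<in>equilibrium_stress_matrices E \<rho>. {x. \<Omega> *v x = 0})"

text \<open>
  The dimension of the shared stress kernel is the same for all generic frameworks, so the
  choice of a generic framework is immaterial.
\<close>

definition shared_stress_nullity :: "'d::finite itself \<Rightarrow> 'v::finite set set \<Rightarrow> nat" where
  "shared_stress_nullity _ E =
     dim (shared_stress_kernel E (SOME \<rho> :: ('d, 'v) framework. generic_framework \<rho>))"

end

theory Submission
  imports Defs "HOL-Computational_Algebra.Polynomial"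
begin

text \<open>The tool is derivations \<open>D\<close> of the field of reals: they extend from subrings, so \<open>D \<rho>\<close> can be
  prescribed arbitrarily for a generic framework \<open>\<rho>\<close>, and every algebraic relation involving \<open>\<rho>\<close> can
  be differentiated.

  Sufficiency. If \<open>\<sigma>\<close> has the edge lengths of the generic framework \<open>\<rho>\<close>, differentiating the equality of
  lengths shows that stresses of \<open>\<sigma>\<close> are stresses of \<open>\<rho>\<close>, hence, by semicontinuity of the dimension, that
  both have the same stresses. If the shared kernel contains only affine images of \<open>\<rho>\<close>, then \<open>\<sigma>\<close> is an
  affine image of \<open>\<rho>\<close>, and it is congruent to \<open>\<rho>\<close> because the edge directions of \<open>\<rho>\<close> lie on no conic
  at infinity.

  Necessity. Restrict the squared length map to the frameworks with coordinates in the shared kernel \<open>K\<close>.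
  Differentiating \<open>\<Omega> \<rho> = 0\<close> and \<open>\<Omega> y = 0\<close> shows that its differential at \<open>\<rho>\<close> maps onto the linear
  span of its image. If \<open>dim K > d + 1\<close>, consider a generic line in the direction of increasing total
  squared length. Its preimage is a curve that avoids the frameworks with nontrivial
  stabilizer, since these have codimension at least two. On the curve the total squared length has a
  minimum, but only countably many critical points, so there are two distinct frameworks close to the
  minimum with the same lengths, and they are not congruent. Frameworks with the same lengths as a regular
  framework persist under perturbation, which yields a generic framework that is not globally rigid.\<close>

section \<open>Derivations of the field of reals\<close>

text \<open>The squared length map is constant on congruence classes, so a fold of it proves nothing
  by itself. Triangular positions of the vertices \<open>h 0, ..., h n\<close> remove the continuous
  part of the group, but reflections of the axes survive, and the two points on either side of a
  fold could be mirror images. At a mirror fold all free entries of one axis vanish. If the kernel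
  has dimension \<open>d + 1\<close>, the last axis has just one free entry, which may well vanish
  somewhere on a curve; with a larger kernel it has at least two, and these do not vanish together
  on a generic curve. Derivations take the place of Sard's theorem: regularity means that
  derivatives can be prescribed, and the critical values form a countable set because no derivation
  that is constant on the parameters moves them. The fold sits at a minimum, which needs a proper
  map. The total squared length bounds the positions only if the graph is connected, so
  connectedness is extracted from rigidity by translating one side of an empty cut.\<close>

definition derivation :: "(real \<Rightarrow> real) \<Rightarrow> bool" where
  "derivation D \<longleftrightarrow> (\<forall>a b. D (a + b) = D a + D b) \<and> (\<forall>a b. D (a * b) = a * D b + b * D a)"

text \<open>A pair \<open>(a, b)\<close> stands for the dual number \<open>a + b \<epsilon>\<close>; a derivation on a subring of the
  reals is a subring of the dual numbers that is the graph of a function.\<close>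

definition dual_ring :: "(real \<times> real) set \<Rightarrow> bool" where
  "dual_ring G \<longleftrightarrow> (1, 0) \<in> G \<and> (\<forall>a b. (a, b) \<in> G \<longrightarrow> (- a, - b) \<in> G) \<and>
     (\<forall>a b c d. (a, b) \<in> G \<longrightarrow> (c, d) \<in> G \<longrightarrow> (a + c, b + d) \<in> G) \<and>
     (\<forall>a b c d. (a, b) \<in> G \<longrightarrow> (c, d) \<in> G \<longrightarrow> (a * c, a * d + c * b) \<in> G)"

definition partial_derivation :: "(real \<times> real) set \<Rightarrow> bool" where
  "partial_derivation G \<longleftrightarrow> dual_ring G \<and> (\<forall>b. (0, b) \<in> G \<longrightarrow> b = 0)"

definition dual_polys :: "(real \<times> real) set \<Rightarrow> (real poly \<times> real poly) set" where
  "dual_polys G = {(P, Q). \<forall>n. (coeff P n, coeff Q n) \<in> G}"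

lemma dual_ringD:
  assumes "dual_ring G"
  shows "(1, 0) \<in> G" "(0, 0) \<in> G" "(a, b) \<in> G \<Longrightarrow> (- a, - b) \<in> G"
    "(a, b) \<in> G \<Longrightarrow> (c, d) \<in> G \<Longrightarrow> (a + c, b + d) \<in> G"
    "(a, b) \<in> G \<Longrightarrow> (c, d) \<in> G \<Longrightarrow> (a - c, b - d) \<in> G"
    "(a, b) \<in> G \<Longrightarrow> (c, d) \<in> G \<Longrightarrow> (a * c, a * d + c * b) \<in> G"
proof -
  note R = assms[unfolded dual_ring_def]
  show 1: "(1, 0) \<in> G" using R by blast
  have "(- 1, - 0) \<in> G" using R 1 by blast
  then have "(1 + - 1, 0 + - 0 :: real) \<in> G" using R 1 by blast
  then show "(0, 0) \<in> G" by simp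
  show "(a, b) \<in> G \<Longrightarrow> (- a, - b) \<in> G" using R by blast
  show "(a, b) \<in> G \<Longrightarrow> (c, d) \<in> G \<Longrightarrow> (a + c, b + d) \<in> G" using R by blast
  show "(a, b) \<in> G \<Longrightarrow> (c, d) \<in> G \<Longrightarrow> (a * c, a * d + c * b) \<in> G" using R by blast
  assume "(a, b) \<in> G" "(c, d) \<in> G"
  then have "(a + - c, b + - d) \<in> G" using R by blast
  then show "(a - c, b - d) \<in> G" by simp
qed

lemma dual_ring_sum:
  assumes "dual_ring G" "\<And>i. i \<in> I \<Longrightarrow> (f i, g i) \<in> G"
  shows "(sum f I, sum g I) \<in> G"
  using assms(2) by (induction I rule: infinite_finite_induct) (auto intro: dual_ringD[OF assms(1)])

lemma dual_ring_of_nat: "dual_ring G \<Longrightarrow> (of_nat n, 0) \<in> G"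
proof (induction n)
  case (Suc n)
  then show ?case using dual_ringD(4)[of G 1 0 "of_nat n" 0] dual_ringD(1)[of G] by simp
qed (simp add: dual_ringD)

lemma dual_polys_const: "dual_ring G \<Longrightarrow> (a, b) \<in> G \<Longrightarrow> ([:a:], [:b:]) \<in> dual_polys G"
  by (auto simp: dual_polys_def coeff_pCons dual_ringD(2) split: nat.split)

lemma dual_polys_X: "dual_ring G \<Longrightarrow> ([:0, 1:], 0) \<in> dual_polys G"
  by (auto simp: dual_polys_def coeff_pCons dual_ringD split: nat.split)

lemma dual_polys_monom: "dual_ring G \<Longrightarrow> (a, b) \<in> G \<Longrightarrow> (monom a n, monom b n) \<in> dual_polys G"
  by (auto simp: dual_polys_def dual_ringD(2))

lemma dual_polys_add:
  "dual_ring G \<Longrightarrow> (P, P') \<in> dual_polys G \<Longrightarrow> (Q, Q') \<in> dual_polys G \<Longrightarrow> (P + Q, P' + Q') \<in> dual_polys G"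
  by (auto simp: dual_polys_def dual_ringD)

lemma dual_polys_diff:
  "dual_ring G \<Longrightarrow> (P, P') \<in> dual_polys G \<Longrightarrow> (Q, Q') \<in> dual_polys G \<Longrightarrow> (P - Q, P' - Q') \<in> dual_polys G"
  by (auto simp: dual_polys_def dual_ringD)

lemma dual_polys_minus:
  "dual_ring G \<Longrightarrow> (P, P') \<in> dual_polys G \<Longrightarrow> (- P, - P') \<in> dual_polys G"
  by (auto simp: dual_polys_def dual_ringD)

lemma dual_polys_mult:
  assumes G: "dual_ring G" and "(P, P') \<in> dual_polys G" "(Q, Q') \<in> dual_polys G"
  shows "(P * Q, P * Q' + Q * P') \<in> dual_polys G"
proof -
  have "(coeff (P * Q) n, coeff (P * Q' + Q * P') n) \<in> G" for n
  proof -
    have "coeff (Q * P') n = (\<Sum>i\<le>n. coeff P' i * coeff Q (n - i))"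
      by (subst mult.commute) (simp add: coeff_mult)
    then have "coeff (P * Q' + Q * P') n
        = (\<Sum>i\<le>n. coeff P i * coeff Q' (n - i) + coeff Q (n - i) * coeff P' i)"
      by (simp add: coeff_mult sum.distrib mult.commute)
    moreover have "(\<Sum>i\<le>n. coeff P i * coeff Q (n - i),
        \<Sum>i\<le>n. coeff P i * coeff Q' (n - i) + coeff Q (n - i) * coeff P' i) \<in> G"
      using assms by (intro dual_ring_sum[OF G] dual_ringD(6)[OF G]) (auto simp: dual_polys_def)
    ultimately show ?thesis by (simp add: coeff_mult)
  qed
  then show ?thesis by (simp add: dual_polys_def)
qed

lemma dual_polys_pderiv:
  assumes G: "dual_ring G" and "(P, P') \<in> dual_polys G"
  shows "(pderiv P, pderiv P') \<in> dual_polys G"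
proof -
  have "(coeff (pderiv P) n, coeff (pderiv P') n) \<in> G" for n
  proof -
    have "(coeff P (Suc n), coeff P' (Suc n)) \<in> G" using assms by (auto simp: dual_polys_def)
    from dual_ringD(6)[OF G dual_ring_of_nat[OF G, of "Suc n"] this]
    show ?thesis by (simp add: coeff_pderiv)
  qed
  then show ?thesis by (simp add: dual_polys_def)
qed

text \<open>With \<open>(P, Q)\<close> read as the polynomial \<open>P + Q \<epsilon>\<close> over
  the dual numbers, this is the \<open>\<epsilon>\<close>-part of its value at
  \<open>a + c \<epsilon>\<close>; the real part is \<open>poly P a\<close>.\<close>

definition dual_eval :: "real \<Rightarrow> real \<Rightarrow> real poly \<times> real poly \<Rightarrow> real" where
  "dual_eval a c = (\<lambda>(P, Q). poly Q a + poly (pderiv P) a * c)"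

lemma dual_eval_mult:
  "dual_eval a c (P * Q, P * Q' + Q * P') = poly P a * dual_eval a c (Q, Q') + poly Q a * dual_eval a c (P, P')"
  by (simp add: dual_eval_def pderiv_mult algebra_simps)

text \<open>Pseudo-division by \<open>P0\<close>, which has least degree among the nonzero
  polynomials that vanish at \<open>a\<close>. Multiplying by the leading coefficient avoids
  division in the ring, and the \<open>\<epsilon>\<close>-parts follow by the product rule, so the
  single condition on \<open>c\<close> at \<open>P0\<close> propagates to every polynomial that
  vanishes at \<open>a\<close>.\<close>

lemma dual_eval_vanishes:
  assumes G: "partial_derivation G" and PQ0: "(P0, Q0) \<in> dual_polys G" "P0 \<noteq> 0" "poly P0 a = 0"
    and minimal: "\<And>P Q. (P, Q) \<in> dual_polys G \<Longrightarrow> poly P a = 0 \<Longrightarrow> degree P < degree P0 \<Longrightarrow> P = 0"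
    and c: "dual_eval a c (P0, Q0) = 0"
  shows "(P, Q) \<in> dual_polys G \<Longrightarrow> poly P a = 0 \<Longrightarrow> dual_eval a c (P, Q) = 0"
proof (induction "degree P" arbitrary: P Q rule: less_induct)
  case less
  have GR: "dual_ring G" and fn: "\<And>b. (0, b) \<in> G \<Longrightarrow> b = 0" using G by (auto simp: partial_derivation_def)
  have zero: "Q = 0" if "(0, Q) \<in> dual_polys G" for Q
    using that fn by (auto simp: dual_polys_def poly_eq_iff)
  show ?case
  proof (cases "P = 0 \<or> degree P < degree P0")
    case True
    then have "P = 0" using minimal less by blast
    moreover from this have "Q = 0" using zero less by blast
    ultimately show ?thesis by (simp add: dual_eval_def)
  next
    case False
    define m where "m = degree P - degree P0"
    define l l' k k' where "l = lead_coeff P0" and "l' = coeff Q0 (degree P0)"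
      and "k = lead_coeff P" and "k' = coeff Q (degree P)"
    have l: "(l, l') \<in> G" and k: "(k, k') \<in> G"
      using PQ0 less by (auto simp: dual_polys_def l_def l'_def k_def k'_def)
    \<comment> \<open>The leading terms cancel in \<open>R\<close>; \<open>R'\<close> is the
      \<open>\<epsilon>\<close>-part of the same combination formed with dual numbers.\<close>
    define R where "R = [:l:] * P - monom k m * P0"
    define R' where "R' = ([:l:] * Q + P * [:l':]) - (monom k m * Q0 + P0 * monom k' m)"
    have RG: "(R, R') \<in> dual_polys G" unfolding R_def R'_def
      by (intro dual_polys_diff dual_polys_mult dual_polys_const dual_polys_monom GR l k PQ0 less)
    have Ra: "poly R a = 0" using less PQ0 by (simp add: R_def)
    have "l \<noteq> 0" "k \<noteq> 0" using PQ0 False by (auto simp: l_def k_def)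
    have lt: "R = 0 \<or> degree R < degree P"
    proof -
      have d1: "degree ([:l:] * P) = degree P" using \<open>l \<noteq> 0\<close> by simp
      have "degree (monom k m * P0) = m + degree P0"
        using degree_mult_eq[of "monom k m" P0] \<open>k \<noteq> 0\<close> PQ0(2) by (simp add: degree_monom_eq)
      then have d2: "degree (monom k m * P0) = degree P" using False by (simp add: m_def)
      have "coeff (monom k m * P0) (degree P) = lead_coeff (monom k m * P0)" using d2 by simp
      also have "\<dots> = k * l" unfolding lead_coeff_mult lead_coeff_monom l_def ..
      finally have "coeff R (degree P) = 0" by (simp add: R_def k_def)
      moreover have "degree R \<le> degree P" unfolding R_def by (rule degree_diff_le) (simp_all only: d1 d2 order_refl)
      ultimately show ?thesis
        by (metis leading_coeff_0_iff le_neq_implies_less)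
    qed
    have "dual_eval a c (R, R') = 0"
    proof (cases "R = 0")
      case True
      moreover from this have "R' = 0" using zero RG by blast
      ultimately show ?thesis by (simp add: dual_eval_def)
    next
      case False
      then show ?thesis using less.hyps[OF _ RG Ra] lt by blast
    qed
    moreover have "dual_eval a c (R, R') =
        dual_eval a c ([:l:] * P, [:l:] * Q + P * [:l':])
        - dual_eval a c (monom k m * P0, monom k m * Q0 + P0 * monom k' m)"
      by (simp add: R_def R'_def dual_eval_def pderiv_diff algebra_simps)
    moreover have "\<dots> = l * dual_eval a c (P, Q)"
      unfolding dual_eval_mult using less PQ0 c by simp
    ultimately show ?thesis using \<open>l \<noteq> 0\<close> by simp
  qed
qed

text \<open>The enlarged ring consists of the values at \<open>a + c \<epsilon>\<close> of the
  polynomials over \<open>G\<close>. It is the graph of a function as soon as every polynomial whose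
  real part vanishes at \<open>a\<close> also has \<open>\<epsilon>\<close>-part zero there. If
  \<open>a\<close> is transcendental over the ring, any \<open>c\<close> will do and
  \<open>0\<close> is taken; otherwise an algebraic relation of least degree dictates
  \<open>c\<close>.\<close>

lemma partial_derivation_extend_point:
  assumes G: "partial_derivation G"
  obtains H c where "partial_derivation H" "G \<subseteq> H" "(a, c) \<in> H"
proof -
  have GR: "dual_ring G" and fn: "\<And>b. (0, b) \<in> G \<Longrightarrow> b = 0" using G by (auto simp: partial_derivation_def)
  have "\<exists>c. \<forall>P Q. (P, Q) \<in> dual_polys G \<longrightarrow> poly P a = 0 \<longrightarrow> dual_eval a c (P, Q) = 0"
  proof (cases "\<forall>P Q. (P, Q) \<in> dual_polys G \<longrightarrow> poly P a = 0 \<longrightarrow> P = 0")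
    case True
    have "dual_eval a 0 (P, Q) = 0" if "(P, Q) \<in> dual_polys G" "poly P a = 0" for P Q
    proof -
      have "P = 0" using True that by blast
      then have "Q = 0" using that fn by (auto simp: dual_polys_def poly_eq_iff)
      then show ?thesis using \<open>P = 0\<close> by (simp add: dual_eval_def)
    qed
    then show ?thesis by blast
  next
    case False
    define S where "S = {(P, Q). (P, Q) \<in> dual_polys G \<and> poly P a = 0 \<and> P \<noteq> 0}"
    from False have "\<exists>x. x \<in> S" by (auto simp: S_def)
    then obtain x0 where "x0 \<in> S" and mn: "\<And>y. y \<in> S \<Longrightarrow> degree (fst x0) \<le> degree (fst y)"
      using ex_has_least_nat[of "\<lambda>x. x \<in> S" _ "\<lambda>x. degree (fst x)"] by metis
    then obtain P0 Q0 where x0: "x0 = (P0, Q0)" "(P0, Q0) \<in> dual_polys G" "poly P0 a = 0" "P0 \<noteq> 0"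
      by (cases x0) (auto simp: S_def)
    have minimal: "P = 0" if "(P, Q) \<in> dual_polys G" "poly P a = 0" "degree P < degree P0" for P Q
      using mn[of "(P, Q)"] that x0 by (auto simp: S_def)
    \<comment> \<open>Separability in characteristic zero: \<open>pderiv P0\<close> is again a
      polynomial over the ring, of smaller degree, so by minimality it cannot vanish at
      \<open>a\<close>.\<close>
    have ne: "poly (pderiv P0) a \<noteq> 0"
    proof
      assume 0: "poly (pderiv P0) a = 0"
      have "degree P0 \<noteq> 0" using x0 by (metis degree_eq_zeroE mult_zero_right pCons_0_0 poly_pCons poly_0 add.right_neutral)
      then have "pderiv P0 = 0"
        using minimal[OF dual_polys_pderiv[OF GR x0(2)] 0] by (simp add: degree_pderiv)
      then show False using \<open>degree P0 \<noteq> 0\<close> by (simp add: pderiv_eq_0_iff)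
    qed
    define c where "c = - poly Q0 a / poly (pderiv P0) a"
    have "dual_eval a c (P0, Q0) = 0" using ne by (simp add: dual_eval_def c_def)
    from dual_eval_vanishes[OF G x0(2,4,3) _ this] minimal show ?thesis by meson
  qed
  then obtain c where c: "\<And>P Q. (P, Q) \<in> dual_polys G \<Longrightarrow> poly P a = 0 \<Longrightarrow> dual_eval a c (P, Q) = 0"
    by blast
  define H where "H = {(poly P a, dual_eval a c (P, Q)) | P Q. (P, Q) \<in> dual_polys G}"
  have HI: "(poly P a, dual_eval a c (P, Q)) \<in> H" if "(P, Q) \<in> dual_polys G" for P Q
    using that by (auto simp: H_def)
  have "(1, 0) \<in> H"
    using HI[OF dual_polys_const[OF GR dual_ringD(1)[OF GR]]] by (simp add: dual_eval_def pderiv_pCons)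
  moreover have "(- x, - y) \<in> H" if "(x, y) \<in> H" for x y
    using that HI[OF dual_polys_minus[OF GR]] by (force simp: H_def dual_eval_def pderiv_minus)
  moreover have "(x + x', y + y') \<in> H" if xy: "(x, y) \<in> H" "(x', y') \<in> H" for x y x' y'
  proof -
    obtain P Q P' Q' where "(P, Q) \<in> dual_polys G" "(P', Q') \<in> dual_polys G"
      "x = poly P a" "y = dual_eval a c (P, Q)" "x' = poly P' a" "y' = dual_eval a c (P', Q')"
      using xy by (auto simp: H_def)
    then show ?thesis using HI[OF dual_polys_add[OF GR, of P Q P' Q']]
      by (simp add: dual_eval_def pderiv_add algebra_simps)
  qed
  moreover have "(x * x', x * y' + x' * y) \<in> H" if xy: "(x, y) \<in> H" "(x', y') \<in> H" for x y x' y'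
  proof -
    obtain P Q P' Q' where "(P, Q) \<in> dual_polys G" "(P', Q') \<in> dual_polys G"
      "x = poly P a" "y = dual_eval a c (P, Q)" "x' = poly P' a" "y' = dual_eval a c (P', Q')"
      using xy by (auto simp: H_def)
    then show ?thesis using HI[OF dual_polys_mult[OF GR, of P Q P' Q']]
      by (simp add: dual_eval_mult)
  qed
  moreover have "y = 0" if "(0, y) \<in> H" for y
    using that c by (fastforce simp: H_def)
  ultimately have "partial_derivation H" by (auto simp: partial_derivation_def dual_ring_def)
  moreover have "G \<subseteq> H"
  proof
    fix p assume "p \<in> G"
    then show "p \<in> H" using HI[OF dual_polys_const[OF GR, of "fst p" "snd p"]]
      by (simp add: dual_eval_def pderiv_pCons)
  qed
  moreover have "(a, c) \<in> H"
    using HI[OF dual_polys_X[OF GR]] by (simp add: dual_eval_def pderiv_pCons)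
  ultimately show ?thesis using that by blast
qed

lemma partial_derivation_Union_chain:
  assumes C: "\<C> \<noteq> {}" "\<And>G. G \<in> \<C> \<Longrightarrow> partial_derivation G"
    and chain: "\<And>G H. G \<in> \<C> \<Longrightarrow> H \<in> \<C> \<Longrightarrow> G \<subseteq> H \<or> H \<subseteq> G"
  shows "partial_derivation (\<Union>\<C>)"
proof -
  have two: "\<exists>G\<in>\<C>. p \<in> G \<and> q \<in> G" if "p \<in> \<Union>\<C>" "q \<in> \<Union>\<C>" for p q
    using that chain by blast
  have ring: "dual_ring G" if "G \<in> \<C>" for G using C that by (simp add: partial_derivation_def)
  show ?thesis unfolding partial_derivation_def dual_ring_def
  proof (intro conjI allI impI)
    show "(1, 0) \<in> \<Union>\<C>" using C ring dual_ringD(1) by blast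
    show "(- a, - b) \<in> \<Union>\<C>" if "(a, b) \<in> \<Union>\<C>" for a b using that ring dual_ringD(3) by blast
    show "(a + c, b + d) \<in> \<Union>\<C>" if "(a, b) \<in> \<Union>\<C>" "(c, d) \<in> \<Union>\<C>" for a b c d
      using two[OF that] ring dual_ringD(4) by blast
    show "(a * c, a * d + c * b) \<in> \<Union>\<C>" if "(a, b) \<in> \<Union>\<C>" "(c, d) \<in> \<Union>\<C>" for a b c d
      using two[OF that] ring dual_ringD(6) by blast
    show "b = 0" if "(0, b) \<in> \<Union>\<C>" for b using that C by (auto simp: partial_derivation_def)
  qed
qed

text \<open>Zorn's lemma: a maximal partial derivation is defined everywhere, since a missing point
  could still be added. Fractions need no separate treatment, as \<open>1 / b\<close> is a root of
  \<open>b X - 1\<close> and counts as an algebraic element.\<close>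

theorem partial_derivation_extends:
  assumes G: "partial_derivation G"
  obtains D where "derivation D" "\<And>a b. (a, b) \<in> G \<Longrightarrow> D a = b"
proof -
  let ?A = "{H. partial_derivation H \<and> G \<subseteq> H}"
  have "\<exists>M\<in>?A. \<forall>X\<in>?A. M \<subseteq> X \<longrightarrow> X = M"
  proof (rule subset_Zorn_nonempty)
    show "?A \<noteq> {}" using G by blast
    fix \<C> assume "\<C> \<noteq> {}" and ch: "subset.chain ?A \<C>"
    have C: "\<C> \<subseteq> ?A" "\<forall>X\<in>\<C>. \<forall>Y\<in>\<C>. X \<subseteq> Y \<or> Y \<subseteq> X"
      using iffD1[OF subset_chain_def ch] by (rule conjunct1, rule conjunct2)
    have CA: "partial_derivation X \<and> G \<subseteq> X" if "X \<in> \<C>" for X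
      using subsetD[OF C(1) that] by (simp only: mem_Collect_eq)
    have "partial_derivation (\<Union>\<C>)"
    proof (rule partial_derivation_Union_chain[OF \<open>\<C> \<noteq> {}\<close>])
      show "partial_derivation X" if "X \<in> \<C>" for X using CA[OF that] ..
      show "X \<subseteq> Y \<or> Y \<subseteq> X" if "X \<in> \<C>" "Y \<in> \<C>" for X Y 
        using bspec[OF bspec[OF C(2) that(1)] that(2)] .
    qed
    moreover obtain X where "X \<in> \<C>" using \<open>\<C> \<noteq> {}\<close> by blast
    then have "G \<subseteq> \<Union>\<C>" using CA[of X] by (meson Union_upper subset_trans)
    ultimately show "\<Union>\<C> \<in> ?A" by simp
  qed
  then obtain M where M: "partial_derivation M" "G \<subseteq> M"
    and mx: "\<And>X. partial_derivation X \<Longrightarrow> G \<subseteq> X \<Longrightarrow> M \<subseteq> X \<Longrightarrow> X = M"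
    unfolding Bex_def Ball_def mem_Collect_eq by metis
  have MR: "dual_ring M" using M by (simp add: partial_derivation_def)
  have tot: "\<exists>c. (a, c) \<in> M" for a
  proof -
    obtain H c where "partial_derivation H" "M \<subseteq> H" "(a, c) \<in> H"
      using partial_derivation_extend_point[OF M(1)] by blast
    then show ?thesis using mx[of H] M by blast
  qed
  have uniq: "b = c" if "(a, b) \<in> M" "(a, c) \<in> M" for a b c
  proof -
    have "(0, b - c) \<in> M" using dual_ringD(5)[OF MR that] by simp
    then show ?thesis using M by (auto simp: partial_derivation_def)
  qed
  define D where "D a = (SOME c. (a, c) \<in> M)" for a
  have D: "(a, D a) \<in> M" for a unfolding D_def using tot by (rule someI_ex)
  have Deq: "D a = b" if "(a, b) \<in> M" for a b using uniq D that by blast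
  have "derivation D" unfolding derivation_def
    by (intro conjI allI Deq dual_ringD[OF MR] D)
  then show ?thesis using that Deq M by blast
qed

context
  fixes D assumes D: "derivation D"
begin

lemma derivation_add: "D (a + b) = D a + D b" and derivation_mult: "D (a * b) = a * D b + b * D a"
  using D by (auto simp: derivation_def)

lemma derivation_0: "D 0 = 0" using derivation_add[of 0 0] by simp
lemma derivation_1: "D 1 = 0" using derivation_mult[of 1 1] by simp
lemma derivation_minus: "D (- a) = - D a" using derivation_add[of a "- a"] derivation_0 by simp
lemma derivation_diff: "D (a - b) = D a - D b" using derivation_add[of a "- b"] derivation_minus by simp

lemma derivation_sum: "D (sum f I) = (\<Sum>i\<in>I. D (f i))"
  by (induction I rule: infinite_finite_induct) (auto simp: derivation_0 derivation_add)

lemma derivation_of_nat: "D (of_nat n) = 0"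
  by (induction n) (auto simp: derivation_0 derivation_1 derivation_add)

lemma derivation_of_int: "D (of_int n) = 0"
  by (cases n) (auto simp: derivation_of_nat derivation_minus derivation_diff derivation_1)

lemma derivation_of_rat: "D (of_rat q) = 0"
proof (cases q)
  case (Fract a b)
  have "of_int a = (of_int b :: real) * of_rat q" using Fract by (simp add: of_rat_rat)
  then have "0 = of_int b * D (of_rat q)"
    using derivation_of_int[of a] by (simp add: derivation_mult derivation_of_int)
  then show ?thesis using Fract by simp
qed

text \<open>Differentiating \<open>P(a) = 0\<close> gives \<open>P'(a) D a = 0\<close>; if
  \<open>P'(a)\<close> vanishes too, the argument is repeated with \<open>P'\<close>, whose degree
  is smaller.\<close>

lemma derivation_algebraic:
  assumes "P \<noteq> 0" "\<And>n. D (coeff P n) = 0" "poly P a = 0"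
  shows "D a = 0"
  using assms
proof (induction "degree P" arbitrary: P rule: less_induct)
  case less
  have "D (poly P a) = poly (pderiv P) a * D a" if "\<And>n. D (coeff P n) = 0" for P
    using that
  proof (induction P rule: pCons_induct)
    case (pCons b P)
    have "D b = 0" "\<And>n. D (coeff P n) = 0"
      using pCons.prems[of 0] pCons.prems[of "Suc n" for n] by auto
    then show ?case using pCons.IH by (simp add: derivation_add derivation_mult pderiv_pCons algebra_simps)
  qed (simp add: derivation_0)
  then have "poly (pderiv P) a * D a = 0" using less derivation_0 by metis
  moreover have "D a = 0" if "poly (pderiv P) a = 0"
  proof -
    have "degree P \<noteq> 0" using less.prems by (metis degree_eq_zeroE mult_zero_right pCons_0_0 poly_pCons poly_0 add.right_neutral)
    show ?thesis
    proof (rule less.hyps[OF _ _ _ that])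
      show "degree (pderiv P) < degree P" using \<open>degree P \<noteq> 0\<close> by (simp add: degree_pderiv)
      show "pderiv P \<noteq> 0" using \<open>degree P \<noteq> 0\<close> by (simp add: pderiv_eq_0_iff)
      show "D (coeff (pderiv P) n) = 0" for n
        using less.prems(2)[of "Suc n"] derivation_of_nat[of "Suc n"]
        by (simp add: coeff_pderiv derivation_mult del: of_nat_Suc)
    qed
  qed
  ultimately show ?case by auto
qed

end

lemma derivation_lincomb:
  "derivation D1 \<Longrightarrow> derivation D2 \<Longrightarrow> derivation (\<lambda>a. D1 a + c * D2 a)"
  by (auto simp: derivation_def algebra_simps)


section \<open>Polynomial expressions, transcendental numbers and countability\<close>

datatype 'x pexp = PConst rat | PVar 'x | PAdd "'x pexp" "'x pexp" | PMult "'x pexp" "'x pexp"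

text \<open>Over countably many variables there are countably many expressions, hence the rings they
  generate and the exceptional sets they cut out can be avoided by cardinality.\<close>

instance pexp :: (countable) countable by countable_datatype

fun peval :: "('x \<Rightarrow> real) \<Rightarrow> 'x pexp \<Rightarrow> real" where
  "peval x (PConst c) = of_rat c"
| "peval x (PVar i) = x i"
| "peval x (PAdd e f) = peval x e + peval x f"
| "peval x (PMult e f) = peval x e * peval x f"

fun pdiff :: "('x \<Rightarrow> real) \<Rightarrow> ('x \<Rightarrow> real) \<Rightarrow> 'x pexp \<Rightarrow> real" where
  "pdiff x y (PConst c) = 0"
| "pdiff x y (PVar i) = y i"
| "pdiff x y (PAdd e f) = pdiff x y e + pdiff x y f"
| "pdiff x y (PMult e f) = peval x e * pdiff x y f + peval x f * pdiff x y e"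

text \<open>On the ring of values \<open>P(a)\<close>, with coefficients of \<open>P\<close>
  generated by the \<open>x i\<close>, sending \<open>P(a)\<close> to \<open>P'(a)\<close> is well
  defined because \<open>a\<close> satisfies no relation; this partial derivation is then extended
  to the reals.\<close>

lemma derivation_of_transcendental:
  fixes x :: "'x \<Rightarrow> real"
  assumes "\<And>P. P \<noteq> 0 \<Longrightarrow> (\<And>n. coeff P n \<in> range (peval x)) \<Longrightarrow> poly P a \<noteq> 0"
  obtains D where "derivation D" "\<And>i. D (x i) = 0" "D a = 1"
proof -
  let ?S = "range (peval x)"
  have "peval x (PConst 0) \<in> ?S" "peval x (PConst 1) \<in> ?S" by (rule rangeI)+
  then have S01: "0 \<in> ?S" "1 \<in> ?S" by simp_all
  have Sadd: "u + v \<in> ?S" if uv: "u \<in> ?S" "v \<in> ?S" for u v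
  proof -
    obtain e f where "u = peval x e" "v = peval x f" using uv by blast
    then have "u + v = peval x (PAdd e f)" by simp
    then show ?thesis by (rule range_eqI)
  qed
  have Smult: "u * v \<in> ?S" if uv: "u \<in> ?S" "v \<in> ?S" for u v
  proof -
    obtain e f where "u = peval x e" "v = peval x f" using uv by blast
    then have "u * v = peval x (PMult e f)" by simp
    then show ?thesis by (rule range_eqI)
  qed
  have Sminus: "- u \<in> ?S" if "u \<in> ?S" for u
    using Smult[OF rangeI[of "peval x" "PConst (- 1)"] that] by simp
  have Ssum: "sum f I \<in> ?S" if "\<And>i. i \<in> I \<Longrightarrow> f i \<in> ?S" for f :: "nat \<Rightarrow> real" and I
    using that by (induction I rule: infinite_finite_induct) (auto intro: Sadd simp: S01)
  define R where "R = {P :: real poly. \<forall>n. coeff P n \<in> ?S}"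
  have R: "1 \<in> R" "- P \<in> R" "P + Q \<in> R" "P * Q \<in> R" if "P \<in> R" "Q \<in> R" for P Q
    using that by (auto simp: R_def coeff_mult intro!: Sadd Sminus Ssum Smult S01 simp: coeff_1)
  have R0: "0 \<in> R" using S01 by (simp add: R_def)
  define G where "G = {(poly P a, poly (pderiv P) a) | P. P \<in> R}"
  have GI: "P \<in> R \<Longrightarrow> (poly P a, poly (pderiv P) a) \<in> G" for P by (auto simp: G_def)
  have "partial_derivation G" unfolding partial_derivation_def dual_ring_def
  proof (intro conjI allI impI)
    show "(1, 0) \<in> G" using GI[OF R(1)[OF R0 R0]] by (simp add: pderiv_1)
    show "(- u, - v) \<in> G" if "(u, v) \<in> G" for u v
      using that GI[OF R(2)[OF _ R0]] by (force simp: G_def pderiv_minus)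
    fix u v u' v' assume uv: "(u, v) \<in> G" "(u', v') \<in> G"
    then obtain P P' where P: "P \<in> R" "P' \<in> R" "u = poly P a" "v = poly (pderiv P) a"
       "u' = poly P' a" "v' = poly (pderiv P') a" by (auto simp: G_def)
    show "(u + u', v + v') \<in> G" using P GI[OF R(3)[OF P(1,2)]] by (simp add: pderiv_add)
    show "(u * u', u * v' + u' * v) \<in> G" using P GI[OF R(4)[OF P(1,2)]] by (simp add: pderiv_mult)
  next
    fix v assume "(0, v) \<in> G"
    then obtain P where P: "P \<in> R" "poly P a = 0" "v = poly (pderiv P) a" by (auto simp: G_def)
    then have "P = 0" using assms[of P] by (auto simp: R_def)
    then show "v = 0" using P by simp
  qed
  then obtain D where D: "derivation D" "\<And>u v. (u, v) \<in> G \<Longrightarrow> D u = v"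
    using partial_derivation_extends by blast
  have "[:x i:] \<in> R" for i
    using S01 rangeI[of "peval x" "PVar i"] by (auto simp: R_def coeff_pCons split: nat.split)
  then have "(x i, 0) \<in> G" for i
    using GI[of "[:x i:]"] by (simp add: pderiv_pCons)
  then have "D (x i) = 0" for i by (rule D(2))
  moreover have "[:0, 1:] \<in> R"
    using S01 by (auto simp: R_def coeff_pCons split: nat.split)
  then have "(a, 1) \<in> G"
    using GI[of "[:0, 1:]"] by (simp add: pderiv_pCons)
  then have "D a = 1" by (rule D(2))
  ultimately show ?thesis using that D by blast
qed

text \<open>A number that is no root of a nonzero polynomial over the countable ring generated by
  \<open>A\<close> is moved by some derivation that kills \<open>A\<close>. The set therefore lies
  among countably many roots.\<close>

lemma countable_derivation_closure:
  assumes "countable A"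
  shows "countable {a. \<forall>D. derivation D \<longrightarrow> (\<forall>s\<in>A. D s = 0) \<longrightarrow> D a = 0}"
proof -
  \<comment> \<open>An enumeration of \<open>A\<close>; the inserted \<open>0\<close> covers an
    empty \<open>A\<close>.\<close>
  define x where "x = from_nat_into (insert 0 A)"
  have x: "range x = insert 0 A" unfolding x_def using assms by (intro range_from_nat_into) auto
  let ?S = "range (peval x)"
  have cS: "countable ?S" by simp
  let ?PP = "{P :: real poly. \<forall>n. coeff P n \<in> ?S}"
  have "?PP \<subseteq> Poly ` lists ?S"
  proof
    fix P :: "real poly" assume P: "P \<in> ?PP"
    have "set (coeffs P) \<subseteq> ?S" using P by (auto simp: coeffs_def)
    then have "coeffs P \<in> lists ?S" by (simp add: lists_eq_set)
    then show "P \<in> Poly ` lists ?S" by (metis Poly_coeffs imageI)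
  qed
  then have "countable ?PP" by (rule countable_subset) (intro countable_image countable_lists cS)
  then have cP: "countable (?PP - {0})" by (rule countable_Diff)
  have cr: "countable {a. poly P a = 0}" if "P \<in> ?PP - {0}" for P
    using that by (intro countable_finite poly_roots_finite) simp
  have "countable (\<Union>P\<in>?PP - {0}. {a. poly P a = 0})"
    by (rule countable_UN[OF cP cr])
  moreover have "\<exists>P\<in>?PP - {0}. poly P a = 0"
    if a: "\<forall>D. derivation D \<longrightarrow> (\<forall>s\<in>A. D s = 0) \<longrightarrow> D a = 0" for a
  proof (rule ccontr)
    assume "\<not> ?thesis"
    then have "poly P a \<noteq> 0" if "P \<noteq> 0" "\<And>n. coeff P n \<in> ?S" for P using that by blast
    from derivation_of_transcendental[OF this]
    obtain D where D: "derivation D" "\<And>i. D (x i) = 0" "D a = 1" by blast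
    have "D s = 0" if "s \<in> A" for s
    proof -
      have "s \<in> range x" using that x by simp
      then show ?thesis using D(2) by auto
    qed
    then show False using a D by auto
  qed
  hence "{a. \<forall>D. derivation D \<longrightarrow> (\<forall>s\<in>A. D s = 0) \<longrightarrow> D a = 0} \<subseteq> (\<Union>P\<in>?PP - {0}. {a. poly P a = 0})"
    by (intro subsetI) (simp only: mem_Collect_eq UN_iff)
  ultimately show ?thesis by (rule countable_subset[rotated])
qed

text \<open>The coordinates are chosen one after another, each outside the countable closure of
  \<open>A\<close> and the earlier ones. The derivation \<open>D0\<close> obtained in this way moves
  the new coordinate and none of the earlier ones, so a multiple of it corrects a derivation that
  already has the required values on those. The set \<open>A\<close> holds parameters that have to
  stay constant.\<close>

lemma exists_generic_near:
  fixes y :: "'i \<Rightarrow> real"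
  assumes "finite I" "countable A" "\<epsilon> > 0"
  shows "\<exists>z. (\<forall>k\<in>I. \<bar>z k - y k\<bar> < \<epsilon>) \<and>
    (\<forall>v. \<exists>D. derivation D \<and> (\<forall>a\<in>A. D a = 0) \<and> (\<forall>k\<in>I. D (z k) = v k))"
  using assms(1)
proof induction
  case empty
  have "derivation (\<lambda>_. 0)" by (simp add: derivation_def)
  then show ?case by (intro exI[of _ undefined]) auto
next
  case (insert i I)
  then obtain z where z: "\<And>k. k \<in> I \<Longrightarrow> \<bar>z k - y k\<bar> < \<epsilon>"
    and zD: "\<And>v. \<exists>D. derivation D \<and> (\<forall>a\<in>A. D a = 0) \<and> (\<forall>k\<in>I. D (z k) = v k)" by blast
  define C where "C = {a. \<forall>D. derivation D \<longrightarrow> (\<forall>s\<in>A \<union> z ` I. D s = 0) \<longrightarrow> D a = 0}"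
  have cC: "countable C" unfolding C_def
    using assms(2) countable_finite[OF finite_imageI[OF insert(1)]]
    by (intro countable_derivation_closure) simp
  have "\<not> {y i - \<epsilon><..<y i + \<epsilon>} \<subseteq> C"
  proof
    assume "{y i - \<epsilon><..<y i + \<epsilon>} \<subseteq> C"
    from countable_subset[OF this cC] show False
      using \<open>\<epsilon> > 0\<close> uncountable_open_interval[of "y i - \<epsilon>" "y i + \<epsilon>"] by linarith
  qed
  then obtain b where b: "b \<in> {y i - \<epsilon><..<y i + \<epsilon>}" "b \<notin> C" by blast
  from b(2) obtain D0 where D0: "derivation D0" "\<forall>s\<in>A \<union> z ` I. D0 s = 0" "D0 b \<noteq> 0"
    unfolding C_def mem_Collect_eq by blast
  show ?case
  proof (intro exI[of _ "z(i := b)"] conjI allI)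
    show "\<forall>k\<in>insert i I. \<bar>(z(i := b)) k - y k\<bar> < \<epsilon>" using z b by auto
    fix v
    obtain D1 where D1: "derivation D1" "\<forall>a\<in>A. D1 a = 0" "\<forall>k\<in>I. D1 (z k) = v k" using zD by blast
    define D where "D = (\<lambda>a. D1 a + ((v i - D1 b) / D0 b) * D0 a)"
    show "\<exists>D. derivation D \<and> (\<forall>a\<in>A. D a = 0) \<and> (\<forall>k\<in>insert i I. D ((z(i := b)) k) = v k)"
    proof (intro exI conjI)
      show "derivation D" unfolding D_def by (rule derivation_lincomb[OF D1(1) D0(1)])
    qed (use D0 D1 insert(2) in \<open>auto simp: D_def\<close>)
  qed
qed

section \<open>Generic frameworks\<close>

definition monomial_fn :: "('x \<Rightarrow>\<^sub>0 nat) \<Rightarrow> ('x \<Rightarrow> real) \<Rightarrow> real" where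
  "monomial_fn m a = (\<Prod>x\<in>Poly_Mapping.keys m. a x ^ Poly_Mapping.lookup m x)"

lemma monomial_fn_UNIV:
  "monomial_fn m a = (\<Prod>x\<in>UNIV. a x ^ Poly_Mapping.lookup m x)" for a :: "'x::finite \<Rightarrow> real"
  unfolding monomial_fn_def
  by (rule prod.mono_neutral_left) (auto simp: in_keys_iff)

lemma monomial_fn_add: "monomial_fn (m + n) a = monomial_fn m a * monomial_fn n a" for a :: "'x::finite \<Rightarrow> real"
  by (simp add: monomial_fn_UNIV lookup_add power_add prod.distrib)

lemma eval_rat_poly_superset:
  assumes "finite S" "Poly_Mapping.keys p \<subseteq> S"
  shows "eval_rat_poly p a = (\<Sum>m\<in>S. of_rat (Poly_Mapping.lookup p m) * monomial_fn m a)"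
  unfolding eval_rat_poly_def monomial_fn_def
  using assms by (intro sum.mono_neutral_left) (auto simp: in_keys_iff)

lemma eval_rat_poly_add: "eval_rat_poly (p + q) a = eval_rat_poly p a + eval_rat_poly q a"
proof -
  let ?S = "Poly_Mapping.keys p \<union> Poly_Mapping.keys q"
  have "eval_rat_poly (p + q) a = (\<Sum>m\<in>?S. of_rat (Poly_Mapping.lookup (p + q) m) * monomial_fn m a)"
    by (intro eval_rat_poly_superset) (auto dest: Poly_Mapping.keys_add[THEN subsetD])
  moreover have "eval_rat_poly p a = (\<Sum>m\<in>?S. of_rat (Poly_Mapping.lookup p m) * monomial_fn m a)"
    "eval_rat_poly q a = (\<Sum>m\<in>?S. of_rat (Poly_Mapping.lookup q m) * monomial_fn m a)"
    by (intro eval_rat_poly_superset; simp)+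
  ultimately show ?thesis by (simp add: lookup_add of_rat_add distrib_right sum.distrib)
qed

lemma eval_rat_poly_0: "eval_rat_poly 0 a = 0"
  by (simp add: eval_rat_poly_def)

lemma eval_rat_poly_single: "eval_rat_poly (Poly_Mapping.single m c) a = of_rat c * monomial_fn m a"
  by (subst eval_rat_poly_superset[of "{m}"]) auto

lemma eval_rat_poly_sum: "eval_rat_poly (sum p I) a = (\<Sum>i\<in>I. eval_rat_poly (p i) a)"
  by (induction I rule: infinite_finite_induct) (simp_all add: eval_rat_poly_0 eval_rat_poly_add)

lemma eval_rat_poly_mult:
  fixes p q :: "('x::finite \<Rightarrow>\<^sub>0 nat) \<Rightarrow>\<^sub>0 rat"
  shows "\<exists>r. \<forall>a. eval_rat_poly r a = eval_rat_poly p a * eval_rat_poly q a"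
proof -
  define r where "r = (\<Sum>m\<in>Poly_Mapping.keys p. \<Sum>n\<in>Poly_Mapping.keys q.
    Poly_Mapping.single (m + n) (Poly_Mapping.lookup p m * Poly_Mapping.lookup q n))"
  have "eval_rat_poly r a = eval_rat_poly p a * eval_rat_poly q a" for a
  proof -
    have "eval_rat_poly r a = (\<Sum>m\<in>Poly_Mapping.keys p. \<Sum>n\<in>Poly_Mapping.keys q.
        of_rat (Poly_Mapping.lookup p m * Poly_Mapping.lookup q n) * monomial_fn (m + n) a)"
      by (simp add: r_def eval_rat_poly_sum eval_rat_poly_single)
    also have "\<dots> = eval_rat_poly p a * eval_rat_poly q a"
      by (simp add: eval_rat_poly_superset[OF finite_keys order_refl] sum_product
          monomial_fn_add of_rat_mult mult_ac)
    finally show ?thesis .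
  qed
  then show ?thesis by blast
qed

lemma peval_eq_eval_rat_poly:
  fixes e :: "'x::finite pexp"
  shows "\<exists>p. \<forall>a. peval a e = eval_rat_poly p a"
proof (induction e)
  case (PConst c)
  show ?case by (intro exI[of _ "Poly_Mapping.single 0 c"]) (simp add: eval_rat_poly_single monomial_fn_UNIV)
next
  case (PVar i)
  have "monomial_fn (Poly_Mapping.single i 1) a = a i" for a by (simp add: monomial_fn_def)
  then show ?case
    by (intro exI[of _ "Poly_Mapping.single (Poly_Mapping.single i 1) 1"]) (simp add: eval_rat_poly_single)
next
  case (PAdd e f)
  then obtain p q where "\<And>a. peval a e = eval_rat_poly p a" "\<And>a. peval a f = eval_rat_poly q a" by blast
  then show ?case by (intro exI[of _ "p + q"]) (simp add: eval_rat_poly_add)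
next
  case (PMult e f)
  then obtain p q where "\<And>a. peval a e = eval_rat_poly p a" "\<And>a. peval a f = eval_rat_poly q a" by blast
  moreover obtain r where "\<And>a. eval_rat_poly r a = eval_rat_poly p a * eval_rat_poly q a"
    using eval_rat_poly_mult by blast
  ultimately show ?case by (intro exI[of _ r]) simp
qed

lemma pexp_sum:
  assumes "finite I" "\<And>i. i \<in> I \<Longrightarrow> \<exists>e. \<forall>a. peval a e = f i a"
  shows "\<exists>e. \<forall>a. peval a e = (\<Sum>i\<in>I. f i a)"
  using assms
proof induction
  case empty
  then show ?case by (intro exI[of _ "PConst 0"]) simp
next
  case (insert i I)
  then obtain e e' where "\<forall>a. peval a e = f i a" "\<forall>a. peval a e' = (\<Sum>i\<in>I. f i a)" by blast
  then show ?case using insert by (intro exI[of _ "PAdd e e'"]) simp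
qed

lemma pexp_prod:
  assumes "finite I" "\<And>i. i \<in> I \<Longrightarrow> \<exists>e. \<forall>a. peval a e = f i a"
  shows "\<exists>e. \<forall>a. peval a e = (\<Prod>i\<in>I. f i a)"
  using assms
proof induction
  case empty
  then show ?case by (intro exI[of _ "PConst 1"]) simp
next
  case (insert i I)
  then obtain e e' where "\<forall>a. peval a e = f i a" "\<forall>a. peval a e' = (\<Prod>i\<in>I. f i a)" by blast
  then show ?case using insert by (intro exI[of _ "PMult e e'"]) simp
qed

lemma eval_rat_poly_eq_peval: "\<exists>e. \<forall>a. peval a e = eval_rat_poly p a"
proof -
  have pow: "\<exists>e. \<forall>a. peval a e = a x ^ n" for x :: 'a and n
  proof -
    have "\<exists>e. \<forall>a :: 'a \<Rightarrow> real. peval a e = a x" by (intro exI[of _ "PVar x"]) simp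
    then have "\<exists>e. \<forall>a :: 'a \<Rightarrow> real. peval a e = (\<Prod>i\<in>{..<n}. a x)" by (intro pexp_prod) auto
    then show ?thesis by simp
  qed
  have "\<exists>e. \<forall>a. peval a e = of_rat c * (\<Prod>x\<in>Poly_Mapping.keys m. a x ^ Poly_Mapping.lookup m x)"
    for c and m :: "'a \<Rightarrow>\<^sub>0 nat"
  proof -
    obtain e where "\<forall>a. peval a e = (\<Prod>x\<in>Poly_Mapping.keys m. a x ^ Poly_Mapping.lookup m x)"
      using pexp_prod[of "Poly_Mapping.keys m" "\<lambda>x a. a x ^ Poly_Mapping.lookup m x", OF finite_keys pow] by blast
    then show ?thesis by (intro exI[of _ "PMult (PConst c) e"]) simp
  qed
  then show ?thesis unfolding eval_rat_poly_def by (intro pexp_sum) auto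
qed

lemma derivation_power_scaled:
  "derivation D \<Longrightarrow> D a = w * a \<Longrightarrow> D (a ^ n) = of_nat n * w * a ^ n"
  by (induction n) (simp_all add: derivation_1 derivation_mult algebra_simps)

lemma derivation_prod_power_scaled:
  assumes "derivation D" "\<And>x. D (a x) = w x * a x" "finite S"
  shows "D (\<Prod>x\<in>S. a x ^ k x) = (\<Sum>x\<in>S. of_nat (k x) * w x) * (\<Prod>x\<in>S. a x ^ k x)"
  using assms(3)
proof induction
  case empty
  show ?case by (simp add: derivation_1[OF assms(1)])
next
  case (insert x S)
  then show ?case using derivation_power_scaled[OF assms(1,2), of x "k x"]
    by (simp add: derivation_mult[OF assms(1)] algebra_simps)
qed

text \<open>The derivation with \<open>D (a x) = a x\<close> and \<open>D (a y) = 0\<close> for \<open>y \<noteq> x\<close> multiplies each monomial by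
  its exponent at \<open>x\<close>, so it eliminates one monomial from a linear relation.\<close>

lemma monomials_independent:
  fixes a :: "'x::finite \<Rightarrow> real"
  assumes a: "\<And>v. \<exists>D. derivation D \<and> (\<forall>x. D (a x) = v x)"
    and "finite S" "(\<Sum>m\<in>S. of_rat (c m) * monomial_fn m a) = 0" "m \<in> S"
  shows "c m = 0"
proof -
  have nz: "monomial_fn m a \<noteq> 0" for m
  proof -
    have "a x \<noteq> 0" for x
    proof
      assume "a x = 0"
      obtain D where "derivation D" "\<forall>x. D (a x) = 1" using a[of "\<lambda>_. 1"] by blast
      then show False using derivation_0 \<open>a x = 0\<close> by (metis zero_neq_one)
    qed
    then show ?thesis by (simp add: monomial_fn_def)
  qed
  have "\<forall>m\<in>S. c m = 0"
    using assms(2,3)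
  proof (induction S arbitrary: c)
    case empty
    show ?case by simp
  next
    case (insert m0 S)
    let ?l = "Poly_Mapping.lookup"
    have step: "\<forall>m\<in>S. c m * (of_nat (?l m x) - of_nat (?l m0 x)) = 0" for x
    proof (rule insert.IH)
      define w where "w y = (if y = x then 1 else 0 :: real)" for y
      obtain D where D: "derivation D" "\<And>y. D (a y) = w y * a y" using a[of "\<lambda>y. w y * a y"] by blast
      have Dm: "D (monomial_fn m a) = of_nat (?l m x) * monomial_fn m a" for m
        unfolding monomial_fn_UNIV derivation_prod_power_scaled[OF D finite] w_def
        by (simp add: if_distrib cong: if_cong)
      have "0 = D (\<Sum>m\<in>insert m0 S. of_rat (c m) * monomial_fn m a)"
        unfolding insert.prems using D(1) by (simp add: derivation_0)
      also have "\<dots> = (\<Sum>m\<in>insert m0 S. of_rat (c m) * of_nat (?l m x) * monomial_fn m a)"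
        by (simp add: derivation_sum[OF D(1)] derivation_mult[OF D(1)] derivation_of_rat[OF D(1)] Dm mult.assoc)
      finally have "0 = (\<Sum>m\<in>insert m0 S. of_rat (c m) * of_nat (?l m x) * monomial_fn m a)
          - of_nat (?l m0 x) * (\<Sum>m\<in>insert m0 S. of_rat (c m) * monomial_fn m a)"
        using insert.prems by simp
      also have "\<dots> = (\<Sum>m\<in>insert m0 S. of_rat (c m * (of_nat (?l m x) - of_nat (?l m0 x))) * monomial_fn m a)"
        by (simp add: sum_distrib_left sum_subtractf[symmetric] of_rat_mult of_rat_diff algebra_simps
            del: sum.insert)
      finally show "(\<Sum>m\<in>S. of_rat (c m * (of_nat (?l m x) - of_nat (?l m0 x))) * monomial_fn m a) = 0"
        using insert.hyps by simp
    qed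
    have S0: "c m = 0" if "m \<in> S" for m
    proof -
      have "m \<noteq> m0" using that insert.hyps by blast
      then obtain x where "?l m x \<noteq> ?l m0 x" by (metis poly_mapping_eqI)
      then show ?thesis using step[of x] that by force
    qed
    then have "of_rat (c m0) * monomial_fn m0 a = 0"
      using insert.prems insert.hyps by (simp add: sum.neutral)
    then show ?case using nz S0 by simp
  qed
  then show ?thesis using assms(4) by blast
qed

lemma eval_rat_poly_nonzero:
  fixes a :: "'x::finite \<Rightarrow> real"
  assumes "\<And>v. \<exists>D. derivation D \<and> (\<forall>x. D (a x) = v x)" "p \<noteq> 0"
  shows "eval_rat_poly p a \<noteq> 0"
proof
  assume "eval_rat_poly p a = 0"
  then have "(\<Sum>m\<in>Poly_Mapping.keys p. of_rat (Poly_Mapping.lookup p m) * monomial_fn m a) = 0"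
    by (simp add: eval_rat_poly_superset[OF finite_keys order_refl])
  from monomials_independent[OF assms(1) finite_keys this]
  have "Poly_Mapping.lookup p m = 0" if "m \<in> Poly_Mapping.keys p" for m using that by blast
  then have "p = 0" by (metis in_keys_iff lookup_zero poly_mapping_eqI)
  then show False using assms(2) by simp
qed

abbreviation coords :: "('d::finite, 'v::finite) framework \<Rightarrow> 'v \<times> 'd \<Rightarrow> real" where
  "coords \<rho> \<equiv> (\<lambda>(u, i). \<rho> $ u $ i)"

lemma generic_framework_near:
  fixes \<sigma> :: "('d::finite, 'v::finite) framework"
  assumes "\<epsilon> > 0"
  obtains \<rho> where "generic_framework \<rho>" "\<And>u i. \<bar>\<rho> $ u $ i - \<sigma> $ u $ i\<bar> < \<epsilon>"
proof -
  obtain z where z: "\<And>k. \<bar>z k - coords \<sigma> k\<bar> < \<epsilon>"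
    "\<And>v. \<exists>D. derivation D \<and> (\<forall>k. D (z k) = v k)"
    using exists_generic_near[of "UNIV :: ('v \<times> 'd) set" "{}" \<epsilon> "coords \<sigma>"] assms by auto
  define \<rho> :: "('d, 'v) framework" where "\<rho> = (\<chi> u i. z (u, i))"
  have co: "coords \<rho> = z" by (auto simp: \<rho>_def)
  have "generic_framework \<rho>"
    unfolding generic_framework_def co using eval_rat_poly_nonzero[OF z(2)] by blast
  moreover have "\<bar>\<rho> $ u $ i - \<sigma> $ u $ i\<bar> < \<epsilon>" for u i using z(1)[of "(u, i)"] by (simp add: \<rho>_def)
  ultimately show ?thesis using that by blast
qed

lemma generic_framework_iff:
  "generic_framework \<rho> \<longleftrightarrow> (\<forall>e. peval (coords \<rho>) e = 0 \<longrightarrow> (\<forall>a. peval a e = 0))"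
  (is "?L = ?R")
proof
  assume L: ?L
  show ?R
  proof (intro allI impI)
    fix e a assume e: "peval (coords \<rho>) e = 0"
    obtain p where p: "\<And>a. peval a e = eval_rat_poly p a" using peval_eq_eval_rat_poly by blast
    then have "p = 0" using L e unfolding generic_framework_def by metis
    then show "peval a e = 0" using p by (simp add: eval_rat_poly_0)
  qed
next
  assume R: ?R
  show ?L unfolding generic_framework_def
  proof (intro allI impI notI)
    fix p :: "('b \<times> 'a \<Rightarrow>\<^sub>0 nat) \<Rightarrow>\<^sub>0 rat"
    assume "p \<noteq> 0" and p: "eval_rat_poly p (coords \<rho>) = 0"
    obtain e where e: "\<And>a. peval a e = eval_rat_poly p a" using eval_rat_poly_eq_peval by blast
    \<comment> \<open>A nonzero family of coefficients must be shown to define a nonzero function. A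
      generic framework, available by density, is a point where it does not vanish.\<close>
    obtain \<tau> :: "('a, 'b) framework" where "generic_framework \<tau>"
      using generic_framework_near[of 1] zero_less_one by blast
    then have "eval_rat_poly p (coords \<tau>) \<noteq> 0" using \<open>p \<noteq> 0\<close> by (simp add: generic_framework_def)
    then show False using R p e by metis
  qed
qed

lemma pdiff_has_real_derivative:
  "((\<lambda>t. peval (\<lambda>i. x i + t * y i) e) has_real_derivative pdiff x y e) (at 0)"
  by (induction e) (auto intro!: derivative_eq_intros)

text \<open>Sending the value of an expression at \<open>\<rho>\<close> to its derivative along
  \<open>\<eta>\<close> is well defined: an expression that vanishes at the generic
  \<open>\<rho>\<close> vanishes identically, and so does its derivative.\<close>

lemma generic_derivation:
  fixes \<rho> \<eta> :: "('d::finite, 'v::finite) framework"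
  assumes "generic_framework \<rho>"
  obtains D where "derivation D" "\<And>u i. D (\<rho> $ u $ i) = \<eta> $ u $ i"
proof -
  let ?x = "coords \<rho>" and ?y = "coords \<eta>"
  define G where "G = range (\<lambda>e. (peval ?x e, pdiff ?x ?y e))"
  have GI: "(peval ?x e, pdiff ?x ?y e) \<in> G" for e by (simp add: G_def)
  have "partial_derivation G" unfolding partial_derivation_def dual_ring_def
  proof (intro conjI allI impI)
    show "(1, 0) \<in> G" using GI[of "PConst 1"] by simp
    show "(- a, - b) \<in> G" if ab: "(a, b) \<in> G" for a b
    proof -
      obtain e where "a = peval ?x e" "b = pdiff ?x ?y e" using ab by (auto simp: G_def)
      then show ?thesis using GI[of "PMult (PConst (- 1)) e"] by simp
    qed
    fix a b c d assume "(a, b) \<in> G" "(c, d) \<in> G"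
    then obtain e f where "a = peval ?x e" "b = pdiff ?x ?y e" "c = peval ?x f" "d = pdiff ?x ?y f"
      by (auto simp: G_def)
    then show "(a + c, b + d) \<in> G" "(a * c, a * d + c * b) \<in> G"
      using GI[of "PAdd e f"] GI[of "PMult e f"] by simp_all
  next
    fix b assume "(0, b) \<in> G"
    then obtain e where e: "peval ?x e = 0" "b = pdiff ?x ?y e" by (auto simp: G_def)
    then have "peval a e = 0" for a using assms generic_framework_iff by blast
    then have "((\<lambda>t. 0) has_real_derivative b) (at 0)"
      using pdiff_has_real_derivative[of ?x ?y e] e by simp
    then show "b = 0" using DERIV_const DERIV_unique by blast
  qed
  then obtain D where D: "derivation D" "\<And>a b. (a, b) \<in> G \<Longrightarrow> D a = b"
    using partial_derivation_extends by blast
  have "D (\<rho> $ u $ i) = \<eta> $ u $ i" for u i using D(2)[OF GI[of "PVar (u, i)"]] by simp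
  then show ?thesis using that D by blast
qed

lemma peval_line_poly: "\<exists>P. \<forall>t. peval (\<lambda>i. x i + t * y i) e = poly P t"
proof (induction e)
  case (PConst c)
  show ?case by (intro exI[of _ "[:of_rat c:]"]) simp
next
  case (PVar i)
  show ?case by (intro exI[of _ "[:x i, y i:]"]) simp
next
  case (PAdd e f)
  then obtain P Q where "\<forall>t. peval (\<lambda>i. x i + t * y i) e = poly P t" "\<forall>t. peval (\<lambda>i. x i + t * y i) f = poly Q t"
    by blast
  then show ?case by (intro exI[of _ "P + Q"]) simp
next
  case (PMult e f)
  then obtain P Q where "\<forall>t. peval (\<lambda>i. x i + t * y i) e = poly P t" "\<forall>t. peval (\<lambda>i. x i + t * y i) f = poly Q t"
    by blast
  then show ?case by (intro exI[of _ "P * Q"]) simp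
qed

text \<open>Each of the countably many nontrivial expressions restricts to a polynomial on the line,
  and this polynomial is nonzero at \<open>t = 1\<close>, that is at \<open>\<rho>\<close>.\<close>

lemma generic_on_line:
  fixes \<rho> \<sigma> :: "('d::finite, 'v::finite) framework"
  assumes "generic_framework \<rho>"
  shows "countable {t. \<not> generic_framework (\<sigma> + t *\<^sub>R (\<rho> - \<sigma>))}"
proof -
  define l where "l t = (\<lambda>k. coords \<sigma> k + t * (coords \<rho> k - coords \<sigma> k))" for t
  have l: "coords (\<sigma> + t *\<^sub>R (\<rho> - \<sigma>)) = l t" for t by (auto simp: l_def)
  have l1: "coords \<rho> = l 1" by (auto simp: l_def)
  define B where "B = {e :: ('v \<times> 'd) pexp. \<exists>a. peval a e \<noteq> 0}"
  have fin: "finite {t. peval (l t) e = 0}" if "e \<in> B" for e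
  proof -
    obtain P where P: "\<And>t. peval (l t) e = poly P t"
      using peval_line_poly[of "coords \<sigma>" "\<lambda>k. coords \<rho> k - coords \<sigma> k" e] unfolding l_def by blast
    have "peval (l 1) e \<noteq> 0" using assms that unfolding B_def generic_framework_iff l1 by blast
    then have "P \<noteq> 0" using P by auto
    then show ?thesis unfolding P by (rule poly_roots_finite)
  qed
  have sub: "{t. \<not> generic_framework (\<sigma> + t *\<^sub>R (\<rho> - \<sigma>))} \<subseteq> (\<Union>e\<in>B. {t. peval (l t) e = 0})"
    unfolding generic_framework_iff l B_def by auto
  have "countable B" by (rule countableI_type)
  then have "countable (\<Union>e\<in>B. {t. peval (l t) e = 0})"
    by (rule countable_UN) (rule countable_finite[OF fin])
  then show ?thesis by (rule countable_subset[OF sub])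
qed

text \<open>The perturbation goes towards \<open>\<rho>\<close> rather than in an arbitrary
  direction: if \<open>\<sigma>\<close> lies in a linear subspace that contains
  \<open>\<rho>\<close>, such as the frameworks over the shared kernel, the nearby generic framework
  stays in it.\<close>

lemma generic_on_line_near:
  fixes \<rho> \<sigma> :: "('d::finite, 'v::finite) framework"
  assumes "generic_framework \<rho>" "\<epsilon> > 0"
  obtains t where "generic_framework (\<sigma> + t *\<^sub>R (\<rho> - \<sigma>))" "dist (\<sigma> + t *\<^sub>R (\<rho> - \<sigma>)) \<sigma> < \<epsilon>"
proof -
  define B where "B = {t. \<not> generic_framework (\<sigma> + t *\<^sub>R (\<rho> - \<sigma>))}"
  have B: "countable B" unfolding B_def by (rule generic_on_line[OF assms(1)])
  define \<delta> where "\<delta> = \<epsilon> / (norm (\<rho> - \<sigma>) + 1)"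
  have n: "norm (\<rho> - \<sigma>) + 1 > 0" by (rule add_nonneg_pos) auto
  then have \<delta>: "\<delta> > 0" using assms by (simp add: \<delta>_def)
  have "\<not> {0<..<\<delta>} \<subseteq> B"
  proof
    assume "{0<..<\<delta>} \<subseteq> B"
    from countable_subset[OF this B] show False using uncountable_open_interval[of 0 \<delta>] \<delta> by simp
  qed
  then obtain t where t: "0 < t" "t < \<delta>" "t \<notin> B" unfolding subset_iff greaterThanLessThan_iff by blast
  have "t * norm (\<rho> - \<sigma>) \<le> t * (norm (\<rho> - \<sigma>) + 1)" using t by (simp add: mult_left_mono)
  also have "\<dots> < \<delta> * (norm (\<rho> - \<sigma>) + 1)" using t n by (intro mult_strict_right_mono) auto
  also have "\<dots> = \<epsilon>" using n by (simp add: \<delta>_def)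
  finally have "dist (\<sigma> + t *\<^sub>R (\<rho> - \<sigma>)) \<sigma> < \<epsilon>" using t by (simp add: dist_norm)
  then show ?thesis using that t by (auto simp: B_def)
qed

section \<open>Linear systems with polynomial coefficients\<close>

lemma span_Int_hyperplane:
  fixes r z :: "'a::euclidean_space"
  assumes "z \<in> S" "r \<bullet> z \<noteq> 0"
  shows "{w \<in> span S. r \<bullet> w = 0} = span ((\<lambda>x. (r \<bullet> z) *\<^sub>R x - (r \<bullet> x) *\<^sub>R z) ` S)"
proof -
  \<comment> \<open>Up to the factor \<open>r \<bullet> z\<close> this is the projection along
    \<open>z\<close> onto the hyperplane. Being free of divisions, it maps vectors of polynomial
    expressions to such vectors.\<close>
  define T where "T x = (r \<bullet> z) *\<^sub>R x - (r \<bullet> x) *\<^sub>R z" for x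
  have lin: "linear T" unfolding T_def
    by (rule linearI) (simp_all add: inner_add_right algebra_simps)
  have "{w \<in> span S. r \<bullet> w = 0} = T ` span S"
  proof (intro equalityI subsetI)
    fix w assume w: "w \<in> {w \<in> span S. r \<bullet> w = 0}"
    then have "w = T ((1 / (r \<bullet> z)) *\<^sub>R w)" using assms by (simp add: T_def)
    then show "w \<in> T ` span S" using w by (metis (no_types, lifting) imageI mem_Collect_eq span_scale)
  next
    fix w assume "w \<in> T ` span S"
    then obtain x where x: "x \<in> span S" "w = T x" by blast
    have "T x \<in> span S" unfolding T_def using span_base[OF assms(1)] x(1) by (intro span_diff span_scale)
    then show "w \<in> {w \<in> span S. r \<bullet> w = 0}" using x by (simp add: T_def inner_diff_right)
  qed
  also have "\<dots> = span (T ` S)" using linear_span_image[OF lin, of S] by simp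
  finally show ?thesis by (simp add: T_def)
qed

lemma dim_subspace_Int_hyperplane:
  fixes r z :: "'a::euclidean_space"
  assumes V: "subspace V" and "z \<in> V" "r \<bullet> z \<noteq> 0"
  shows "dim V = dim {w \<in> V. r \<bullet> w = 0} + 1"
proof -
  let ?W = "{w \<in> V. r \<bullet> w = 0}"
  have W: "subspace ?W"
    using V by (auto simp: subspace_def inner_add_right)
  have "z \<notin> span ?W" using W assms by (simp add: span_eq_iff[THEN iffD2])
  then have "dim (insert z ?W) = dim ?W + 1" by (simp add: dim_insert)
  moreover have "span (insert z ?W) = V"
  proof
    show "span (insert z ?W) \<subseteq> V" using assms by (intro span_minimal) auto
    show "V \<subseteq> span (insert z ?W)"
    proof
      fix x assume "x \<in> V"
      define c where "c = (r \<bullet> x) / (r \<bullet> z)"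
      have "x - c *\<^sub>R z \<in> ?W" using V \<open>x \<in> V\<close> assms
        by (auto simp: subspace_diff subspace_scale inner_diff_right c_def)
      then have "c *\<^sub>R z + (x - c *\<^sub>R z) \<in> span (insert z ?W)"
        by (intro span_add span_scale) (auto intro: span_base)
      then show "x \<in> span (insert z ?W)" by simp
    qed
  qed
  ultimately show ?thesis by (metis dim_span)
qed

definition pexp_vec :: "('d::finite, 'v::finite) framework \<Rightarrow> ('i::finite \<Rightarrow> ('v \<times> 'd) pexp) \<Rightarrow> real ^ 'i" where
  "pexp_vec \<rho> z = (\<chi> i. peval (coords \<rho>) (z i))"

lemma pexp_dot:
  fixes r z :: "'i::finite \<Rightarrow> ('v::finite \<times> 'd::finite) pexp"
  shows "\<exists>e. \<forall>\<rho> :: ('d, 'v) framework. peval (coords \<rho>) e = pexp_vec \<rho> r \<bullet> pexp_vec \<rho> z"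
proof -
  have "\<exists>e. \<forall>a. peval a e = (\<Sum>i\<in>UNIV. peval a (r i) * peval a (z i))"
    by (rule pexp_sum) (auto intro: exI[of _ "PMult (r i) (z i)" for i])
  then show ?thesis by (auto simp: pexp_vec_def inner_vec_def)
qed

text \<open>Gaussian elimination on polynomial expressions: an expression that is not identically
  zero is nonzero at all generic frameworks, so the same pivots work for all of them.\<close>

lemma generic_kernel_span:
  fixes R :: "('i::finite \<Rightarrow> ('v::finite \<times> 'd::finite) pexp) set"
  assumes "finite R"
  shows "\<exists>Z n. finite Z \<and> (\<forall>\<rho> :: ('d, 'v) framework. generic_framework \<rho> \<longrightarrow>
      {w. \<forall>r\<in>R. pexp_vec \<rho> r \<bullet> w = 0} = span (pexp_vec \<rho> ` Z) \<and>
      dim {w. \<forall>r\<in>R. pexp_vec \<rho> r \<bullet> w = 0} = n)"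
  using assms
proof induction
  case empty
  let ?Z = "range (\<lambda>i j. if j = i then PConst 1 else PConst 0) :: ('i \<Rightarrow> ('v \<times> 'd) pexp) set"
  have "span (pexp_vec \<rho> ` ?Z) = UNIV" for \<rho> :: "('d, 'v) framework"
  proof -
    have "pexp_vec \<rho> (\<lambda>j. if j = i then PConst 1 else PConst 0) = axis i 1" for i :: 'i
      by (simp add: pexp_vec_def axis_def vec_eq_iff)
    then have "pexp_vec \<rho> ` ?Z = range (\<lambda>i :: 'i. axis i 1)"
      by (simp add: image_image)
    also have "\<dots> = Basis" by (auto simp: Basis_vec_def)
    finally show ?thesis by (simp only: span_Basis)
  qed
  then show ?case by (intro exI[of _ ?Z] exI[of _ "CARD('i)"]) simp
next
  case (insert r R)
  from insert.IH obtain Z n where Z: "finite Z" and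
    IH: "\<forall>\<rho> :: ('d, 'v) framework. generic_framework \<rho> \<longrightarrow>
      {w. \<forall>r\<in>R. pexp_vec \<rho> r \<bullet> w = 0} = span (pexp_vec \<rho> ` Z) \<and>
      dim {w. \<forall>r\<in>R. pexp_vec \<rho> r \<bullet> w = 0} = n"
    by (elim exE conjE)
  note ZR = IH[rule_format, THEN conjunct1] and n = IH[rule_format, THEN conjunct2]
  have "\<forall>z. \<exists>e. \<forall>\<rho> :: ('d, 'v) framework. peval (coords \<rho>) e = pexp_vec \<rho> r \<bullet> pexp_vec \<rho> z"
    using pexp_dot by blast
  then obtain c where c: "\<And>z. \<And>\<rho> :: ('d, 'v) framework. peval (coords \<rho>) (c z) = pexp_vec \<rho> r \<bullet> pexp_vec \<rho> z"
    by metis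
  have ins: "{w. \<forall>r\<in>insert r R. pexp_vec \<rho> r \<bullet> w = 0} = {w \<in> {w. \<forall>r\<in>R. pexp_vec \<rho> r \<bullet> w = 0}. pexp_vec \<rho> r \<bullet> w = 0}"
    for \<rho> :: "('d, 'v) framework" by auto
  show ?case
  proof (cases "\<forall>z\<in>Z. \<forall>a. peval a (c z) = 0")
    case True
    have "{w. \<forall>r\<in>insert r R. pexp_vec \<rho> r \<bullet> w = 0} = {w. \<forall>r\<in>R. pexp_vec \<rho> r \<bullet> w = 0}"
      if \<rho>: "generic_framework \<rho>" for \<rho> :: "('d, 'v) framework"
    proof -
      have "pexp_vec \<rho> ` Z \<subseteq> {w. pexp_vec \<rho> r \<bullet> w = 0}" using True by (auto simp: c[symmetric])
      moreover have "subspace {w. pexp_vec \<rho> r \<bullet> w = 0}" by (rule subspace_hyperplane)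
      ultimately have "span (pexp_vec \<rho> ` Z) \<subseteq> {w. pexp_vec \<rho> r \<bullet> w = 0}" by (rule span_minimal)
      then show ?thesis using ZR[OF \<rho>] by auto
    qed
    then show ?thesis using Z ZR n by (intro exI[of _ Z] exI[of _ n] conjI allI impI) simp_all
  next
    case False
    then obtain z where z: "z \<in> Z" and nz: "\<not> (\<forall>a. peval a (c z) = 0)" by blast
    define T where "T x = (\<lambda>i. PAdd (PMult (c z) (x i)) (PMult (PConst (- 1)) (PMult (c x) (z i))))" for x
    have T: "pexp_vec \<rho> (T x) = (pexp_vec \<rho> r \<bullet> pexp_vec \<rho> z) *\<^sub>R pexp_vec \<rho> x - (pexp_vec \<rho> r \<bullet> pexp_vec \<rho> x) *\<^sub>R pexp_vec \<rho> z"
      for \<rho> :: "('d, 'v) framework" and x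
      unfolding c[symmetric] by (simp add: pexp_vec_def T_def vec_eq_iff)
    have nz': "pexp_vec \<rho> r \<bullet> pexp_vec \<rho> z \<noteq> 0" if "generic_framework \<rho>" for \<rho> :: "('d, 'v) framework"
      using nz that unfolding generic_framework_iff c[symmetric] by blast
    have "{w. \<forall>r\<in>insert r R. pexp_vec \<rho> r \<bullet> w = 0} = span (pexp_vec \<rho> ` (T ` Z)) \<and>
      dim {w. \<forall>r\<in>insert r R. pexp_vec \<rho> r \<bullet> w = 0} = n - 1"
      if \<rho>: "generic_framework \<rho>" for \<rho> :: "('d, 'v) framework"
    proof
      have "{w. \<forall>r\<in>insert r R. pexp_vec \<rho> r \<bullet> w = 0} = {w \<in> span (pexp_vec \<rho> ` Z). pexp_vec \<rho> r \<bullet> w = 0}"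
        unfolding ins ZR[OF \<rho>] ..
      also have "\<dots> = span (pexp_vec \<rho> ` (T ` Z))"
        using z nz'[OF \<rho>] by (subst span_Int_hyperplane[of "pexp_vec \<rho> z"]) (auto simp: image_image T)
      finally show "{w. \<forall>r\<in>insert r R. pexp_vec \<rho> r \<bullet> w = 0} = span (pexp_vec \<rho> ` (T ` Z))" .
      have "dim {w. \<forall>r\<in>R. pexp_vec \<rho> r \<bullet> w = 0} = dim {w. \<forall>r\<in>insert r R. pexp_vec \<rho> r \<bullet> w = 0} + 1"
        unfolding ins
      proof (rule dim_subspace_Int_hyperplane)
        show "subspace {w. \<forall>r\<in>R. pexp_vec \<rho> r \<bullet> w = 0}" unfolding ZR[OF \<rho>] by (rule subspace_span)
        show "pexp_vec \<rho> z \<in> {w. \<forall>r\<in>R. pexp_vec \<rho> r \<bullet> w = 0}" unfolding ZR[OF \<rho>] using z by (intro span_base) simp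
        show "pexp_vec \<rho> r \<bullet> pexp_vec \<rho> z \<noteq> 0" by (rule nz'[OF \<rho>])
      qed
      then show "dim {w. \<forall>r\<in>insert r R. pexp_vec \<rho> r \<bullet> w = 0} = n - 1" using n[OF \<rho>] by simp
    qed
    then show ?thesis using Z
      by (intro exI[of _ "T ` Z"] exI[of _ "n - 1"] conjI[OF finite_imageI] allI impI)
  qed
qed

text \<open>The weighted Laplacians of the graph, with weights of either sign: the conditions on a
  stress matrix that do not involve the framework.\<close>

definition edge_matrices :: "'v::finite set set \<Rightarrow> (real ^ 'v ^ 'v) set" where
  "edge_matrices E = {\<Omega>. transpose \<Omega> = \<Omega> \<and> (\<forall>u w. u \<noteq> w \<and> {u, w} \<notin> E \<longrightarrow> \<Omega> $ u $ w = 0) \<and>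
     (\<forall>u. (\<Sum>w\<in>UNIV. \<Omega> $ u $ w) = 0)}"

definition coord_vec :: "('d::finite, 'v::finite) framework \<Rightarrow> 'd \<Rightarrow> real ^ 'v" where
  "coord_vec \<rho> i = (\<chi> u. \<rho> $ u $ i)"

lemma stress_iff:
  "\<Omega> \<in> equilibrium_stress_matrices E \<rho> \<longleftrightarrow> \<Omega> \<in> edge_matrices E \<and> (\<forall>i. \<Omega> *v coord_vec \<rho> i = 0)"
  unfolding equilibrium_stress_matrices_def edge_matrices_def mem_Collect_eq conj_assoc
  by (auto simp: vec_eq_iff matrix_vector_mult_def coord_vec_def sum_component)

definition matrix_of_pairs :: "real ^ ('v::finite \<times> 'v) \<Rightarrow> real ^ 'v ^ 'v" where
  "matrix_of_pairs w = (\<chi> u v. w $ (u, v))"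

lemma linear_matrix_of_pairs: "linear matrix_of_pairs"
  by (rule linearI) (simp_all add: matrix_of_pairs_def vec_eq_iff)

lemma inj_matrix_of_pairs: "inj matrix_of_pairs"
  by (auto simp: inj_def matrix_of_pairs_def vec_eq_iff)

lemma surj_matrix_of_pairs: "surj matrix_of_pairs"
proof (rule surjI)
  show "matrix_of_pairs (\<chi> p. A $ fst p $ snd p) = A" for A :: "real ^ 'v ^ 'v"
    by (simp add: matrix_of_pairs_def vec_eq_iff)
qed

lemma sum_pairs_fst:
  "(\<Sum>p\<in>UNIV. if fst p = u then f p else 0) = (\<Sum>w\<in>UNIV. f (u, w))"
  for f :: "'v::finite \<times> 'w::finite \<Rightarrow> real"
proof -
  have "(\<Sum>p\<in>UNIV. if fst p = u then f p else 0) = (\<Sum>x\<in>UNIV. \<Sum>w\<in>UNIV. if x = u then f (x, w) else 0)"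
    unfolding sum.cartesian_product UNIV_Times_UNIV by (rule sum.cong) auto
  also have "\<dots> = (\<Sum>x\<in>UNIV. if x = u then (\<Sum>w\<in>UNIV. f (x, w)) else 0)"
    by (intro sum.cong) auto
  finally show ?thesis by simp
qed

text \<open>Elimination is used twice. The stresses solve a linear system whose coefficients are
  expressions in \<open>\<rho>\<close>, so they are spanned by matrices of expressions; the shared
  kernel solves the system formed by the rows of these matrices, whose coefficients are again
  expressions.\<close>

lemma generic_dims:
  fixes E :: "'v::finite set set"
  shows "\<exists>m n. \<forall>\<rho> :: ('d::finite, 'v) framework. generic_framework \<rho> \<longrightarrow>
     dim (equilibrium_stress_matrices E \<rho>) = m \<and> dim (shared_stress_kernel E \<rho>) = n"
proof -
  \<comment> \<open>Equations on a matrix flattened to a vector over pairs: \<open>r1\<close> is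
    symmetry, \<open>r2\<close> the support on the edges, \<open>r3\<close> the row sums,
    \<open>r4\<close> the equilibrium in coordinate \<open>i\<close>.\<close>
  define r1 where "r1 u w = (\<lambda>p. if p = (u, w) then PConst 1 else if p = (w, u) then PConst (- 1) else PConst 0 :: ('v \<times> 'd) pexp)" for u w :: 'v
  define r2 where "r2 u w = (\<lambda>p. if p = (u, w) then PConst 1 else PConst 0 :: ('v \<times> 'd) pexp)" for u w :: 'v
  define r3 where "r3 u = (\<lambda>p :: 'v \<times> 'v. if fst p = u then PConst 1 else PConst 0 :: ('v \<times> 'd) pexp)" for u :: 'v
  define r4 where "r4 u i = (\<lambda>p :: 'v \<times> 'v. if fst p = u then PVar (snd p, i) else PConst 0 :: ('v \<times> 'd) pexp)" for u :: 'v and i :: 'd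
  have e1: "pexp_vec \<rho> (r1 u w) \<bullet> x = x $ (u, w) - x $ (w, u)" if "u \<noteq> w" for \<rho> :: "('d, 'v) framework" and u w and x :: "real ^ ('v \<times> 'v)"
  proof -
    have "pexp_vec \<rho> (r1 u w) = axis (u, w) 1 - axis (w, u) 1"
      using that by (auto simp: pexp_vec_def r1_def axis_def vec_eq_iff)
    then show ?thesis by (simp add: inner_diff_left inner_axis')
  qed
  have e2: "pexp_vec \<rho> (r2 u w) \<bullet> x = x $ (u, w)" for \<rho> :: "('d, 'v) framework" and u w and x :: "real ^ ('v \<times> 'v)"
  proof -
    have "pexp_vec \<rho> (r2 u w) = axis (u, w) 1"
      by (auto simp: pexp_vec_def r2_def axis_def vec_eq_iff)
    then show ?thesis by (simp add: inner_axis')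
  qed
  have e3: "pexp_vec \<rho> (r3 u) \<bullet> x = (\<Sum>w\<in>UNIV. x $ (u, w))" for \<rho> :: "('d, 'v) framework" and u and x :: "real ^ ('v \<times> 'v)"
    unfolding sum_pairs_fst[symmetric] inner_vec_def pexp_vec_def r3_def by (intro sum.cong) auto
  have e4: "pexp_vec \<rho> (r4 u i) \<bullet> x = (\<Sum>w\<in>UNIV. x $ (u, w) * \<rho> $ w $ i)" for \<rho> :: "('d, 'v) framework" and u i and x :: "real ^ ('v \<times> 'v)"
    using sum_pairs_fst[of u "\<lambda>p. x $ p * \<rho> $ snd p $ i"]
    unfolding inner_vec_def pexp_vec_def r4_def by (auto intro!: sum.cong elim!: trans[rotated])
  define R where "R = (\<lambda>(u, w). r1 u w) ` {(u, w). u \<noteq> w} \<union> (\<lambda>(u, w). r2 u w) ` {(u, w). u \<noteq> w \<and> {u, w} \<notin> E}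
      \<union> range r3 \<union> (\<lambda>(u, i). r4 u i) ` UNIV"
  have "finite R" unfolding R_def by simp
  from generic_kernel_span[OF this] obtain Z m where Z: "finite Z" and
    Zm: "\<forall>\<rho> :: ('d, 'v) framework. generic_framework \<rho> \<longrightarrow>
      {w. \<forall>r\<in>R. pexp_vec \<rho> r \<bullet> w = 0} = span (pexp_vec \<rho> ` Z) \<and>
      dim {w. \<forall>r\<in>R. pexp_vec \<rho> r \<bullet> w = 0} = m"
    by (elim exE conjE)
  note ZR = Zm[rule_format, THEN conjunct1] and m = Zm[rule_format, THEN conjunct2]
  have mem: "(\<forall>r\<in>R. pexp_vec \<rho> r \<bullet> x = 0) \<longleftrightarrow> matrix_of_pairs x \<in> equilibrium_stress_matrices E \<rho>"
    for \<rho> :: "('d, 'v) framework" and x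
  proof -
    have "(\<forall>r\<in>R. pexp_vec \<rho> r \<bullet> x = 0) \<longleftrightarrow>
        (\<forall>u w. u \<noteq> w \<longrightarrow> pexp_vec \<rho> (r1 u w) \<bullet> x = 0) \<and> (\<forall>u w. u \<noteq> w \<and> {u, w} \<notin> E \<longrightarrow> pexp_vec \<rho> (r2 u w) \<bullet> x = 0)
        \<and> (\<forall>u. pexp_vec \<rho> (r3 u) \<bullet> x = 0) \<and> (\<forall>u i. pexp_vec \<rho> (r4 u i) \<bullet> x = 0)"
      unfolding R_def ball_Un ball_simps(9) by (simp only: split_paired_all Ball_def mem_Collect_eq UNIV_I) auto
    also have "\<dots> \<longleftrightarrow> (\<forall>u w. u \<noteq> w \<longrightarrow> x $ (u, w) - x $ (w, u) = 0) \<and> (\<forall>u w. u \<noteq> w \<and> {u, w} \<notin> E \<longrightarrow> x $ (u, w) = 0)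
        \<and> (\<forall>u. (\<Sum>w\<in>UNIV. x $ (u, w)) = 0) \<and> (\<forall>u i. (\<Sum>w\<in>UNIV. x $ (u, w) * \<rho> $ w $ i) = 0)"
      by (simp add: e1 e2 e3 e4)
    also have "\<dots> \<longleftrightarrow> matrix_of_pairs x \<in> equilibrium_stress_matrices E \<rho>"
      unfolding equilibrium_stress_matrices_def matrix_of_pairs_def transpose_def
      by (auto simp: vec_eq_iff sum_component) metis
    finally show ?thesis .
  qed
  have S: "equilibrium_stress_matrices E \<rho> = matrix_of_pairs ` {w. \<forall>r\<in>R. pexp_vec \<rho> r \<bullet> w = 0}"
    for \<rho> :: "('d, 'v) framework"
    unfolding mem using surj_matrix_of_pairs by (auto simp: surj_def)
  have dS: "dim (equilibrium_stress_matrices E \<rho>) = m" if "generic_framework \<rho>" for \<rho> :: "('d, 'v) framework"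
    unfolding S m[OF that, symmetric]
    by (rule dim_image_eq[OF linear_matrix_of_pairs inj_on_subset[OF inj_matrix_of_pairs subset_UNIV]])
  define R' where "R' = (\<lambda>(z, u) w. z (u, w)) ` (Z \<times> UNIV)"
  have "finite R'" unfolding R'_def using Z by simp
  from generic_kernel_span[OF this] obtain Z' n where
    Zn: "\<forall>\<rho> :: ('d, 'v) framework. generic_framework \<rho> \<longrightarrow>
      {w. \<forall>r\<in>R'. pexp_vec \<rho> r \<bullet> w = 0} = span (pexp_vec \<rho> ` Z') \<and>
      dim {w. \<forall>r\<in>R'. pexp_vec \<rho> r \<bullet> w = 0} = n"
    by (elim exE conjE)
  note n = Zn[rule_format, THEN conjunct2]
  have "shared_stress_kernel E \<rho> = {y. \<forall>r\<in>R'. pexp_vec \<rho> r \<bullet> y = 0}"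
    if \<rho>: "generic_framework \<rho>" for \<rho> :: "('d, 'v) framework"
  proof -
    have "(\<forall>\<Omega>\<in>equilibrium_stress_matrices E \<rho>. \<Omega> *v y = 0) \<longleftrightarrow> (\<forall>x\<in>span (pexp_vec \<rho> ` Z). matrix_of_pairs x *v y = 0)" for y
      unfolding S ZR[OF \<rho>] by blast
    also have "\<dots> y \<longleftrightarrow> (\<forall>z\<in>Z. matrix_of_pairs (pexp_vec \<rho> z) *v y = 0)" for y
    proof
      assume z: "\<forall>z\<in>Z. matrix_of_pairs (pexp_vec \<rho> z) *v y = 0"
      have "subspace {x. matrix_of_pairs x *v y = 0}"
        by (auto simp: subspace_def linear_matrix_of_pairs[THEN linear_add] linear_matrix_of_pairs[THEN linear_scale]
           linear_matrix_of_pairs[THEN linear_0] matrix_vector_mult_add_rdistrib scaleR_matrix_vector_assoc[symmetric])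
      then have "span (pexp_vec \<rho> ` Z) \<subseteq> {x. matrix_of_pairs x *v y = 0}" using z by (intro span_minimal) auto
      then show "\<forall>x\<in>span (pexp_vec \<rho> ` Z). matrix_of_pairs x *v y = 0" by blast
    qed (auto intro: span_base)
    also have "\<dots> y \<longleftrightarrow> (\<forall>z\<in>Z. \<forall>u. pexp_vec \<rho> (\<lambda>w. z (u, w)) \<bullet> y = 0)" for y
      by (simp add: vec_eq_iff matrix_vector_mult_def matrix_of_pairs_def pexp_vec_def inner_vec_def)
    finally show ?thesis unfolding shared_stress_kernel_def R'_def by auto
  qed
  then have "dim (shared_stress_kernel E \<rho>) = n" if "generic_framework \<rho>" for \<rho> :: "('d, 'v) framework"
    using n[OF that] that by simp
  with dS show ?thesis by (intro exI[of _ m] exI[of _ n]) simp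
qed

section \<open>Stresses and the shared kernel\<close>

lemma matrix_vector_mult_minus_left: "(- A) *v x = - (A *v x)" for A :: "real ^ 'n::finite ^ 'm::finite"
  by (simp add: matrix_vector_mult_def vec_eq_iff sum_negf)

lemma edge_matrices_sum_cong:
  assumes "\<Omega> \<in> edge_matrices E" "\<And>u w. {u, w} \<in> E \<Longrightarrow> F u w = G u w" "\<And>u. F u u = G u u"
  shows "(\<Sum>u\<in>UNIV. \<Sum>w\<in>UNIV. \<Omega> $ u $ w * F u w) = (\<Sum>u\<in>UNIV. \<Sum>w\<in>UNIV. \<Omega> $ u $ w * G u w)"
proof (intro sum.cong refl)
  fix u w
  show "\<Omega> $ u $ w * F u w = \<Omega> $ u $ w * G u w"
  proof (cases "u = w \<or> {u, w} \<in> E")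
    case True
    then show ?thesis using assms(2,3) by auto
  next
    case False
    then have "\<Omega> $ u $ w = 0" using assms(1) by (auto simp: edge_matrices_def)
    then show ?thesis by simp
  qed
qed

lemma edge_matrices_sym: "\<Omega> \<in> edge_matrices E \<Longrightarrow> \<Omega> $ u $ w = \<Omega> $ w $ u"
  unfolding edge_matrices_def mem_Collect_eq transpose_def by (metis vec_lambda_beta)

lemma edge_matrices_inner_sym:
  assumes "\<Omega> \<in> edge_matrices E"
  shows "x \<bullet> (\<Omega> *v y) = (\<Omega> *v x) \<bullet> y"
proof -
  have "transpose \<Omega> = \<Omega>" using assms by (simp add: edge_matrices_def)
  then show ?thesis by (metis dot_lmul_matrix transpose_matrix_vector)
qed

lemma inner_matrix_vector_eq_sum:
  fixes \<Omega> :: "real ^ 'n::finite ^ 'm::finite"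
  shows "x \<bullet> (\<Omega> *v y) = (\<Sum>u\<in>UNIV. \<Sum>w\<in>UNIV. \<Omega> $ u $ w * (x $ u * y $ w))"
  by (simp add: inner_vec_def matrix_vector_mult_def sum_distrib_left mult_ac)

text \<open>In the expanded product the terms \<open>x $ u * y $ u\<close> and
  \<open>x $ w * y $ w\<close> drop out by the zero row and column sums, and the two mixed terms
  agree by symmetry.\<close>

lemma edge_matrices_quadratic:
  assumes "\<Omega> \<in> edge_matrices E"
  shows "(\<Sum>u\<in>UNIV. \<Sum>w\<in>UNIV. \<Omega> $ u $ w * ((x $ u - x $ w) * (y $ u - y $ w))) = - 2 * (x \<bullet> (\<Omega> *v y))"
proof -
  have row: "(\<Sum>w\<in>UNIV. \<Omega> $ u $ w) = 0" for u using assms by (simp add: edge_matrices_def)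
  have a: "(\<Sum>u\<in>UNIV. \<Sum>w\<in>UNIV. \<Omega> $ u $ w * (x $ u * y $ u)) = 0"
    by (simp add: sum_distrib_right[symmetric] row)
  have b: "(\<Sum>u\<in>UNIV. \<Sum>w\<in>UNIV. \<Omega> $ u $ w * (x $ w * y $ w)) = 0"
    by (subst sum.swap) (simp add: sum_distrib_right[symmetric] edge_matrices_sym[OF assms] row
        cong: sum.cong flip: edge_matrices_sym[OF assms, of _ _])
  have c: "(\<Sum>u\<in>UNIV. \<Sum>w\<in>UNIV. \<Omega> $ u $ w * (x $ w * y $ u)) = x \<bullet> (\<Omega> *v y)"
    by (subst sum.swap) (simp add: inner_matrix_vector_eq_sum edge_matrices_sym[OF assms])
  show ?thesis using a b c inner_matrix_vector_eq_sum[of x \<Omega> y]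
    by (simp add: algebra_simps sum.distrib sum_subtractf)
qed

text \<open>The polarized stress energy. For an edge matrix it sees only the inner products of
  corresponding edge vectors, which is how equations along the edges become equations about
  \<open>\<Omega>\<close>.\<close>

definition stress_form ::
    "real ^ 'v ^ 'v \<Rightarrow> ('d::finite, 'v::finite) framework \<Rightarrow> ('d, 'v) framework \<Rightarrow> real" where
  "stress_form \<Omega> p q = (\<Sum>i\<in>UNIV. coord_vec p i \<bullet> (\<Omega> *v coord_vec q i))"

lemma stress_form_eq_sum_edges:
  assumes "\<Omega> \<in> edge_matrices E"
  shows "(\<Sum>u\<in>UNIV. \<Sum>w\<in>UNIV. \<Omega> $ u $ w * ((p $ u - p $ w) \<bullet> (q $ u - q $ w))) = - 2 * stress_form \<Omega> p q"
proof -
  have "(\<Sum>u\<in>UNIV. \<Sum>w\<in>UNIV. \<Omega> $ u $ w * ((p $ u - p $ w) \<bullet> (q $ u - q $ w)))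
      = (\<Sum>u\<in>UNIV. \<Sum>w\<in>UNIV. \<Sum>i\<in>UNIV. \<Omega> $ u $ w * ((p $ u $ i - p $ w $ i) * (q $ u $ i - q $ w $ i)))"
    by (simp add: inner_vec_def sum_distrib_left)
  also have "\<dots> = (\<Sum>u\<in>UNIV. \<Sum>i\<in>UNIV. \<Sum>w\<in>UNIV. \<Omega> $ u $ w * ((p $ u $ i - p $ w $ i) * (q $ u $ i - q $ w $ i)))"
    by (intro sum.cong refl sum.swap)
  also have "\<dots> = (\<Sum>i\<in>UNIV. \<Sum>u\<in>UNIV. \<Sum>w\<in>UNIV. \<Omega> $ u $ w * ((p $ u $ i - p $ w $ i) * (q $ u $ i - q $ w $ i)))"
    by (rule sum.swap)
  also have "\<dots> = (\<Sum>i\<in>UNIV. - 2 * (coord_vec p i \<bullet> (\<Omega> *v coord_vec q i)))"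
  proof (rule sum.cong[OF refl])
    show "(\<Sum>u\<in>UNIV. \<Sum>w\<in>UNIV. \<Omega> $ u $ w * ((p $ u $ i - p $ w $ i) * (q $ u $ i - q $ w $ i)))
        = - 2 * (coord_vec p i \<bullet> (\<Omega> *v coord_vec q i))" for i
      unfolding edge_matrices_quadratic[OF assms, symmetric] by (simp add: coord_vec_def)
  qed
  finally show ?thesis by (simp add: stress_form_def sum_distrib_left)
qed

lemma stress_form_cong:
  assumes "\<Omega> \<in> edge_matrices E"
    and "\<And>u w. {u, w} \<in> E \<Longrightarrow> (p $ u - p $ w) \<bullet> (q $ u - q $ w) = (p' $ u - p' $ w) \<bullet> (q' $ u - q' $ w)"
  shows "stress_form \<Omega> p q = stress_form \<Omega> p' q'"
proof -
  have "(\<Sum>u\<in>UNIV. \<Sum>w\<in>UNIV. \<Omega> $ u $ w * ((p $ u - p $ w) \<bullet> (q $ u - q $ w)))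
     = (\<Sum>u\<in>UNIV. \<Sum>w\<in>UNIV. \<Omega> $ u $ w * ((p' $ u - p' $ w) \<bullet> (q' $ u - q' $ w)))"
    by (rule edge_matrices_sum_cong[OF assms(1)]) (simp_all add: assms(2))
  then show ?thesis unfolding stress_form_eq_sum_edges[OF assms(1)] by simp
qed

lemma stress_form_sym: "\<Omega> \<in> edge_matrices E \<Longrightarrow> stress_form \<Omega> p q = stress_form \<Omega> q p"
  unfolding stress_form_def by (intro sum.cong refl) (metis edge_matrices_inner_sym inner_commute)

definition framework_of_coords :: "('d::finite \<Rightarrow> real ^ 'v) \<Rightarrow> ('d, 'v::finite) framework" where
  "framework_of_coords f = (\<chi> u i. f i $ u)"

lemma coord_vec_of_coords [simp]: "coord_vec (framework_of_coords f) i = f i"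
  by (simp add: coord_vec_def framework_of_coords_def vec_eq_iff)

lemma inner_framework: "p \<bullet> q = (\<Sum>i\<in>UNIV. coord_vec p i \<bullet> coord_vec q i)"
  by (simp add: inner_vec_def coord_vec_def) (rule sum.swap)

lemma coord_vec_add [simp]: "coord_vec (p + q) i = coord_vec p i + coord_vec q i"
  and coord_vec_scaleR [simp]: "coord_vec (c *\<^sub>R p) i = c *\<^sub>R coord_vec p i"
  and coord_vec_diff [simp]: "coord_vec (p - q) i = coord_vec p i - coord_vec q i"
  and coord_vec_0 [simp]: "coord_vec 0 i = 0"
  by (simp_all add: coord_vec_def vec_eq_iff)

lemma framework_eqI: "(\<And>i. coord_vec p i = coord_vec q i) \<Longrightarrow> p = q"
  by (simp add: coord_vec_def vec_eq_iff)

lemma subspace_edge_matrices: "subspace (edge_matrices E)"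
  unfolding subspace_def edge_matrices_def transpose_def
  by (auto simp: vec_eq_iff sum.distrib sum_distrib_left[symmetric])

lemma subspace_stresses: "subspace (equilibrium_stress_matrices E \<rho>)"
proof -
  have "equilibrium_stress_matrices E \<rho> = edge_matrices E \<inter> {\<Omega>. \<forall>i. \<Omega> *v coord_vec \<rho> i = 0}"
    using stress_iff by blast
  moreover have "subspace {\<Omega>. \<forall>i. \<Omega> *v coord_vec \<rho> i = 0}"
    by (auto simp: subspace_def matrix_vector_mult_add_rdistrib scaleR_matrix_vector_assoc[symmetric])
  ultimately show ?thesis using subspace_inter[OF subspace_edge_matrices] by simp
qed

lemma mem_shared_kernel: "y \<in> shared_stress_kernel E \<rho> \<longleftrightarrow> (\<forall>\<Omega>\<in>equilibrium_stress_matrices E \<rho>. \<Omega> *v y = 0)"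
  by (auto simp: shared_stress_kernel_def)

lemma subspace_shared_kernel: "subspace (shared_stress_kernel E \<rho>)"
  by (auto simp: subspace_def mem_shared_kernel matrix_vector_right_distrib matrix_vector_mult_scaleR)

lemma coord_vec_in_kernel: "coord_vec \<rho> i \<in> shared_stress_kernel E \<rho>"
  by (simp add: mem_shared_kernel stress_iff)

lemma one_in_kernel: "1 \<in> shared_stress_kernel E \<rho>"
  by (auto simp: mem_shared_kernel stress_iff edge_matrices_def matrix_vector_mult_def vec_eq_iff)

section \<open>Derivations acting on vectors, matrices and frameworks\<close>

definition derive_vec :: "(real \<Rightarrow> real) \<Rightarrow> real ^ 'n \<Rightarrow> real ^ 'n::finite" where
  "derive_vec D x = (\<chi> u. D (x $ u))"

definition derive_mat :: "(real \<Rightarrow> real) \<Rightarrow> real ^ 'n ^ 'm \<Rightarrow> real ^ 'n::finite ^ 'm::finite" where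
  "derive_mat D A = (\<chi> u. derive_vec D (A $ u))"

context
  fixes D assumes D: "derivation D"
begin

lemma derive_vec_0: "derive_vec D 0 = 0"
  by (simp add: derive_vec_def vec_eq_iff derivation_0[OF D])

lemma derive_vec_diff: "derive_vec D (x - y) = derive_vec D x - derive_vec D y"
  by (simp add: derive_vec_def vec_eq_iff derivation_diff[OF D])

lemma derive_mat_mult_vec: "derive_vec D (A *v x) = derive_mat D A *v x + A *v derive_vec D x"
  by (simp add: derive_vec_def derive_mat_def vec_eq_iff matrix_vector_mult_def derivation_sum[OF D]
      derivation_mult[OF D] sum.distrib algebra_simps)

lemma derivation_inner: "D (x \<bullet> y) = derive_vec D x \<bullet> y + x \<bullet> derive_vec D y"
  by (simp add: inner_vec_def derive_vec_def derivation_sum[OF D] derivation_mult[OF D] sum.distrib algebra_simps)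

lemma derive_mat_edge_matrices:
  assumes "\<Omega> \<in> edge_matrices E"
  shows "derive_mat D \<Omega> \<in> edge_matrices E"
proof -
  have "(\<Sum>w\<in>UNIV. D (\<Omega> $ u $ w)) = D 0" for u
    using assms by (simp add: derivation_sum[OF D, symmetric] edge_matrices_def)
  then show ?thesis using assms edge_matrices_sym[OF assms]
    unfolding edge_matrices_def derive_mat_def derive_vec_def transpose_def
    by (auto simp: derivation_0[OF D] vec_eq_iff)
qed

end

lemma generic_derive_framework:
  fixes \<rho> \<eta> :: "('d::finite, 'v::finite) framework"
  assumes "generic_framework \<rho>"
  obtains D where "derivation D" "derive_mat D \<rho> = \<eta>" "\<And>i. derive_vec D (coord_vec \<rho> i) = coord_vec \<eta> i"
proof -
  obtain D where "derivation D" "\<And>u i. D (\<rho> $ u $ i) = \<eta> $ u $ i"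
    using generic_derivation[OF assms] by blast
  then show ?thesis
    by (intro that[of D]) (simp_all add: derive_mat_def derive_vec_def coord_vec_def vec_eq_iff)
qed

text \<open>The frameworks in which every stress of \<open>\<rho>\<close> is still in
  equilibrium.\<close>

definition kernel_frameworks :: "'v::finite set set \<Rightarrow> ('d::finite, 'v) framework \<Rightarrow> ('d, 'v) framework set" where
  "kernel_frameworks E \<rho> = {\<eta>. \<forall>i. coord_vec \<eta> i \<in> shared_stress_kernel E \<rho>}"

lemma in_kernel_frameworksI:
  fixes \<eta> \<rho> :: "('d::finite, 'v::finite) framework"
  assumes "\<And>\<Omega> \<theta>. \<Omega> \<in> equilibrium_stress_matrices E \<rho> \<Longrightarrow> stress_form \<Omega> (\<theta> :: ('d, 'v) framework) \<eta> = 0"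
  shows "\<eta> \<in> kernel_frameworks E \<rho>"
proof -
  have "\<Omega> *v coord_vec \<eta> i = 0" if "\<Omega> \<in> equilibrium_stress_matrices E \<rho>" for \<Omega> i
  proof -
    \<comment> \<open>The test framework \<open>\<theta> = \<Omega> \<eta>\<close> turns the form
      into a sum of squares.\<close>
    have "(\<Sum>i\<in>UNIV. (\<Omega> *v coord_vec \<eta> i) \<bullet> (\<Omega> *v coord_vec \<eta> i)) = 0"
      using assms[OF that, of "framework_of_coords (\<lambda>i. \<Omega> *v coord_vec \<eta> i)"] by (simp add: stress_form_def)
    then have "(\<Omega> *v coord_vec \<eta> i) \<bullet> (\<Omega> *v coord_vec \<eta> i) = 0"
      by (subst (asm) sum_nonneg_eq_0_iff) auto
    then show ?thesis by simp
  qed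
  then show ?thesis by (simp add: kernel_frameworks_def mem_shared_kernel)
qed

text \<open>Differentiating \<open>\<Omega> \<rho> = 0\<close> and \<open>\<Omega> y = 0\<close> along a derivation that moves \<open>\<rho>\<close> in an arbitrary
  direction shows that the second fundamental form vanishes on the shared kernel: the locus of
  frameworks with the same stresses is flat.\<close>

lemma stress_form_flat:
  fixes \<rho> :: "('d::finite, 'v::finite) framework"
  assumes gen: "generic_framework \<rho>" and \<Omega>: "\<Omega> \<in> edge_matrices E"
    and orth: "\<And>i y. y \<in> shared_stress_kernel E \<rho> \<Longrightarrow> y \<bullet> (\<Omega> *v coord_vec \<rho> i) = 0"
    and xy: "x \<in> shared_stress_kernel E \<rho>" "y \<in> shared_stress_kernel E \<rho>"
  shows "x \<bullet> (\<Omega> *v y) = 0"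
proof -
  let ?K = "shared_stress_kernel E \<rho>" and ?S = "equilibrium_stress_matrices E \<rho>"
  \<comment> \<open>The motions \<open>\<Omega>' \<rho>\<close> by matrices \<open>\<Omega>'\<close>
    for which the conclusion holds. It is enough that \<open>\<Omega> \<rho>\<close> lies in
    \<open>P\<close>, because then \<open>\<Omega> - \<Omega>'\<close> is a stress and vanishes on
    the kernel. Membership comes by duality: \<open>P\<close> contains all
    \<open>\<Omega>0 \<eta>\<close> with \<open>\<Omega>0\<close> a stress, so its orthogonal
    complement lies in the kernel frameworks, and \<open>\<Omega> \<rho>\<close> is orthogonal to
    those.\<close>
  define P where "P = {p :: ('d, 'v) framework. \<exists>\<Omega>'\<in>edge_matrices E. (\<forall>i. \<Omega>' *v coord_vec \<rho> i = coord_vec p i) \<and>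
    (\<forall>x\<in>?K. \<forall>y\<in>?K. x \<bullet> (\<Omega>' *v y) = 0)}"
  have P: "p \<in> P" if "\<Omega>' \<in> edge_matrices E" "\<And>i. \<Omega>' *v coord_vec \<rho> i = coord_vec p i"
    "\<And>x y. x \<in> ?K \<Longrightarrow> y \<in> ?K \<Longrightarrow> x \<bullet> (\<Omega>' *v y) = 0" for p \<Omega>'
    using that unfolding P_def by blast
  have subP: "subspace P"
    unfolding subspace_def
  proof (intro conjI ballI allI)
    show "0 \<in> P" by (rule P[OF subspace_0[OF subspace_edge_matrices]]) simp_all
    fix p q assume "p \<in> P" "q \<in> P"
    then obtain A B where A: "A \<in> edge_matrices E" "\<And>i. A *v coord_vec \<rho> i = coord_vec p i"
        "\<And>x y. x \<in> ?K \<Longrightarrow> y \<in> ?K \<Longrightarrow> x \<bullet> (A *v y) = 0"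
      and B: "B \<in> edge_matrices E" "\<And>i. B *v coord_vec \<rho> i = coord_vec q i"
        "\<And>x y. x \<in> ?K \<Longrightarrow> y \<in> ?K \<Longrightarrow> x \<bullet> (B *v y) = 0" unfolding P_def by blast
    show "p + q \<in> P"
      by (rule P[OF subspace_add[OF subspace_edge_matrices A(1) B(1)]])
         (simp_all add: matrix_vector_mult_add_rdistrib A B inner_add_right)
    show "c *\<^sub>R p \<in> P" for c
      by (rule P[OF subspace_scale[OF subspace_edge_matrices A(1), of c]])
         (simp_all add: scaleR_matrix_vector_assoc[symmetric] A)
  qed
  have stressP: "framework_of_coords (\<lambda>i. \<Omega>0 *v coord_vec \<eta> i) \<in> P"
    if \<Omega>0: "\<Omega>0 \<in> ?S" for \<Omega>0 and \<eta> :: "('d, 'v) framework"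
  proof -
    obtain D where D: "derivation D" "\<And>i. derive_vec D (coord_vec \<rho> i) = coord_vec \<eta> i"
      using generic_derive_framework[OF gen] by blast
    have e0: "\<Omega>0 \<in> edge_matrices E" using \<Omega>0 stress_iff by blast
    have d: "derive_mat D \<Omega>0 *v x = - (\<Omega>0 *v derive_vec D x)" if "\<Omega>0 *v x = 0" for x
      using derive_mat_mult_vec[OF D(1), of \<Omega>0 x] unfolding that derive_vec_0[OF D(1)]
      by (simp only: eq_neg_iff_add_eq_0)
    show ?thesis
    \<comment> \<open>Differentiating \<open>\<Omega>0 \<rho> = 0\<close> shows that
      \<open>- D \<Omega>0\<close> sends \<open>\<rho>\<close> to \<open>\<Omega>0 \<eta>\<close>.
      Paired with kernel vectors it gives \<open>x \<bullet> \<Omega>0 (D y)\<close>, which is zero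
      because \<open>\<Omega>0 x = 0\<close>.\<close>
    proof (rule P[of "- derive_mat D \<Omega>0"])
      show "- derive_mat D \<Omega>0 \<in> edge_matrices E"
        by (intro subspace_neg[OF subspace_edge_matrices] derive_mat_edge_matrices D e0)
      show "- derive_mat D \<Omega>0 *v coord_vec \<rho> i = coord_vec (framework_of_coords (\<lambda>i. \<Omega>0 *v coord_vec \<eta> i)) i" for i
        using d[of "coord_vec \<rho> i"] \<Omega>0 D(2) by (simp add: stress_iff matrix_vector_mult_minus_left)
      show "x \<bullet> (- derive_mat D \<Omega>0 *v y) = 0" if "x \<in> ?K" "y \<in> ?K" for x y
      proof -
        have "\<Omega>0 *v x = 0" "\<Omega>0 *v y = 0" using that \<Omega>0 mem_shared_kernel by blast+
        then show ?thesis using d[of y] edge_matrices_inner_sym[OF e0, of x "derive_vec D y"]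
          by (simp add: matrix_vector_mult_minus_left)
      qed
    qed
  qed
  have "framework_of_coords (\<lambda>i. \<Omega> *v coord_vec \<rho> i) \<in> P\<^sup>\<bottom>\<^sup>\<bottom>"
    unfolding orthogonal_comp_def[of "P\<^sup>\<bottom>"]
  proof (intro CollectI ballI)
    fix q assume "q \<in> P\<^sup>\<bottom>"
    then have q: "p \<bullet> q = 0" if "p \<in> P" for p using that by (simp add: orthogonal_comp_def orthogonal_def)
    have "q \<in> kernel_frameworks E \<rho>"
    proof (rule in_kernel_frameworksI)
      fix \<Omega>0 and \<theta> :: "('d, 'v) framework" assume \<Omega>0: "\<Omega>0 \<in> ?S"
      then have e0: "\<Omega>0 \<in> edge_matrices E" using stress_iff by blast
      have "stress_form \<Omega>0 \<theta> q = framework_of_coords (\<lambda>i. \<Omega>0 *v coord_vec \<theta> i) \<bullet> q"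
        by (simp add: stress_form_def inner_framework edge_matrices_inner_sym[OF e0])
      then show "stress_form \<Omega>0 \<theta> q = 0" using q stressP[OF \<Omega>0] by simp
    qed
    then show "orthogonal q (framework_of_coords (\<lambda>i. \<Omega> *v coord_vec \<rho> i))"
      using orth by (simp add: orthogonal_def inner_framework kernel_frameworks_def)
  qed
  then have "framework_of_coords (\<lambda>i. \<Omega> *v coord_vec \<rho> i) \<in> P" using orthogonal_comp_self[OF subP] by simp
  then obtain \<Omega>' where \<Omega>': "\<Omega>' \<in> edge_matrices E" "\<And>i. \<Omega>' *v coord_vec \<rho> i = \<Omega> *v coord_vec \<rho> i"
    "\<And>x y. x \<in> ?K \<Longrightarrow> y \<in> ?K \<Longrightarrow> x \<bullet> (\<Omega>' *v y) = 0"
    unfolding P_def by auto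
  have "\<Omega> - \<Omega>' \<in> ?S"
    using subspace_diff[OF subspace_edge_matrices \<Omega> \<Omega>'(1)] \<Omega>'(2)
    by (simp add: stress_iff matrix_vector_mult_diff_rdistrib)
  then have "(\<Omega> - \<Omega>') *v y = 0" using xy mem_shared_kernel by blast
  then have "\<Omega> *v y = \<Omega>' *v y" by (simp add: matrix_vector_mult_diff_rdistrib)
  then show ?thesis using \<Omega>'(3) xy by simp
qed

text \<open>Differentiating the flex equations along \<open>D \<rho> = \<theta>\<close> turns the
  pairing of \<open>\<theta>\<close> with \<open>\<eta>\<close> on each edge into one of
  \<open>\<rho>\<close> with \<open>- D \<eta>\<close>, and a stress of \<open>\<rho>\<close>
  annihilates the latter.\<close>

lemma flex_in_kernel_frameworks:
  fixes \<rho> :: "('d::finite, 'v::finite) framework"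
  assumes gen: "generic_framework \<rho>"
    and flex: "\<And>u w. {u, w} \<in> E \<Longrightarrow> (\<rho> $ u - \<rho> $ w) \<bullet> (\<eta> $ u - \<eta> $ w) = 0"
  shows "\<eta> \<in> kernel_frameworks E \<rho>"
proof (rule in_kernel_frameworksI)
  fix \<Omega> and \<theta> :: "('d, 'v) framework" assume "\<Omega> \<in> equilibrium_stress_matrices E \<rho>"
  then have \<Omega>: "\<Omega> \<in> edge_matrices E" "\<And>i. \<Omega> *v coord_vec \<rho> i = 0" by (simp_all add: stress_iff)
  obtain D where D: "derivation D" "derive_mat D \<rho> = \<theta>" using generic_derive_framework[OF gen] by blast
  have "(\<theta> $ u - \<theta> $ w) \<bullet> (\<eta> $ u - \<eta> $ w) = (\<rho> $ u - \<rho> $ w) \<bullet> ((- derive_mat D \<eta>) $ u - (- derive_mat D \<eta>) $ w)"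
    if "{u, w} \<in> E" for u w
  proof -
    have "0 = D ((\<rho> $ u - \<rho> $ w) \<bullet> (\<eta> $ u - \<eta> $ w))" using flex[OF that] by (simp add: derivation_0[OF D(1)])
    also have "\<dots> = (\<theta> $ u - \<theta> $ w) \<bullet> (\<eta> $ u - \<eta> $ w) + (\<rho> $ u - \<rho> $ w) \<bullet> (derive_mat D \<eta> $ u - derive_mat D \<eta> $ w)"
      by (simp add: derivation_inner[OF D(1)] derive_vec_diff[OF D(1)] D(2)[symmetric] derive_mat_def)
    finally show ?thesis by (simp add: inner_diff_right)
  qed
  from stress_form_cong[OF \<Omega>(1) this] have "stress_form \<Omega> \<theta> \<eta> = stress_form \<Omega> \<rho> (- derive_mat D \<eta>)" .
  also have "\<dots> = stress_form \<Omega> (- derive_mat D \<eta>) \<rho>" by (rule stress_form_sym[OF \<Omega>(1)])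
  also have "\<dots> = 0" by (simp add: stress_form_def \<Omega>)
  finally show "stress_form \<Omega> \<theta> \<eta> = 0" .
qed

lemma stresses_subset_of_same_lengths:
  fixes \<rho> \<sigma> :: "('d::finite, 'v::finite) framework"
  assumes gen: "generic_framework \<rho>" and same: "same_edge_lengths E \<rho> \<sigma>"
  shows "equilibrium_stress_matrices E \<sigma> \<subseteq> equilibrium_stress_matrices E \<rho>"
proof
  fix \<Omega> assume "\<Omega> \<in> equilibrium_stress_matrices E \<sigma>"
  then have \<Omega>: "\<Omega> \<in> edge_matrices E" "\<And>i. \<Omega> *v coord_vec \<sigma> i = 0" by (simp_all add: stress_iff)
  have "\<Omega> *v coord_vec \<rho> i = 0" for i
  proof -
    \<comment> \<open>With \<open>D \<rho> = \<Omega> \<rho>\<close> the form of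
      \<open>\<Omega>\<close> at \<open>\<eta>\<close> and \<open>\<rho>\<close> is the squared norm
      of \<open>\<Omega> \<rho>\<close>. The differentiated equality of lengths identifies it with
      the form at \<open>D \<sigma>\<close> and \<open>\<sigma>\<close>, which is zero.\<close>
    let ?\<eta> = "framework_of_coords (\<lambda>i. \<Omega> *v coord_vec \<rho> i)"
    obtain D where D: "derivation D" "derive_mat D \<rho> = ?\<eta>" using generic_derive_framework[OF gen] by blast
    have "(?\<eta> $ u - ?\<eta> $ w) \<bullet> (\<rho> $ u - \<rho> $ w)
        = (derive_mat D \<sigma> $ u - derive_mat D \<sigma> $ w) \<bullet> (\<sigma> $ u - \<sigma> $ w)" if "{u, w} \<in> E" for u w
    proof -
      have "(\<rho> $ u - \<rho> $ w) \<bullet> (\<rho> $ u - \<rho> $ w) = (\<sigma> $ u - \<sigma> $ w) \<bullet> (\<sigma> $ u - \<sigma> $ w)"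
        using same that by (simp add: same_edge_lengths_def dist_norm norm_eq)
      from arg_cong[OF this, of D] show ?thesis
        by (simp add: derivation_inner[OF D(1)] derive_vec_diff[OF D(1)] D(2)[symmetric] derive_mat_def
            inner_commute)
    qed
    from stress_form_cong[OF \<Omega>(1) this] have "stress_form \<Omega> ?\<eta> \<rho> = 0" by (simp add: stress_form_def \<Omega>)
    then have "(\<Sum>i\<in>UNIV. (\<Omega> *v coord_vec \<rho> i) \<bullet> (\<Omega> *v coord_vec \<rho> i)) = 0" by (simp add: stress_form_def)
    then have "(\<Omega> *v coord_vec \<rho> i) \<bullet> (\<Omega> *v coord_vec \<rho> i) = 0"
      by (subst (asm) sum_nonneg_eq_0_iff) auto
    then show ?thesis by simp
  qed
  then show "\<Omega> \<in> equilibrium_stress_matrices E \<rho>" using \<Omega> by (simp add: stress_iff)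
qed

lemma exists_orthogonal_of_dim_less:
  fixes A B :: "'a::euclidean_space set"
  assumes "subspace A" "subspace B" "dim B < dim A"
  obtains a where "a \<in> A" "norm a = 1" "\<And>b. b \<in> B \<Longrightarrow> b \<bullet> a = 0"
proof -
  let ?C = "{y \<in> UNIV. \<forall>x\<in>B. orthogonal x y}"
  have "?C = B\<^sup>\<bottom>" by (auto simp: orthogonal_comp_def)
  then have C: "subspace ?C" using subspace_orthogonal_comp by metis
  have "dim ?C + dim B = DIM('a)"
    using dim_subspace_orthogonal_to_vectors[of B UNIV] assms by (simp only: subspace_UNIV dim_UNIV subset_UNIV)
  moreover have "dim {x + y |x y. x \<in> A \<and> y \<in> ?C} + dim (A \<inter> ?C) = dim A + dim ?C"
    by (rule dim_sums_Int[OF assms(1) C])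
  moreover have "dim {x + y |x y. x \<in> A \<and> y \<in> ?C} \<le> DIM('a)" by (rule dim_subset_UNIV)
  ultimately have "dim (A \<inter> ?C) \<noteq> 0" using assms(3) by linarith
  then have "\<not> A \<inter> ?C \<subseteq> {0}" by (simp only: dim_eq_0 not_False_eq_True)
  then obtain a where a: "a \<in> A" "a \<in> ?C" "a \<noteq> 0" by blast
  show ?thesis
  proof (rule that[of "(1 / norm a) *\<^sub>R a"])
    show "(1 / norm a) *\<^sub>R a \<in> A" by (rule subspace_scale[OF assms(1) a(1)])
    show "norm ((1 / norm a) *\<^sub>R a) = 1" using a(3) by simp
    show "b \<bullet> ((1 / norm a) *\<^sub>R a) = 0" if "b \<in> B" for b using a(2) that by (simp add: orthogonal_def)
  qed
qed

lemma continuous_matrix_vector_mult_seq: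
  fixes A :: "nat \<Rightarrow> real ^ 'n::finite ^ 'm::finite"
  assumes "A \<longlonglongrightarrow> B" "x \<longlonglongrightarrow> y"
  shows "(\<lambda>k. A k *v x k) \<longlonglongrightarrow> B *v y"
  unfolding matrix_vector_mult_def
  by (intro tendsto_vec_lambda tendsto_sum tendsto_mult tendsto_vec_nth assms)

lemma closed_edge_matrices: "closed (edge_matrices E)"
  by (rule closed_subspace[OF subspace_edge_matrices])

text \<open>Compactness: otherwise generic frameworks converging to \<open>\<sigma>\<close> would
  carry unit stresses orthogonal to all stresses of \<open>\<sigma>\<close>. A limit of these is a
  unit stress of \<open>\<sigma>\<close> that is orthogonal to itself.\<close>

lemma dim_stresses_generic_le:
  fixes \<rho> \<sigma> :: "('d::finite, 'v::finite) framework"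
  assumes "generic_framework \<rho>"
  shows "dim (equilibrium_stress_matrices E \<rho>) \<le> dim (equilibrium_stress_matrices E \<sigma>)"
proof (rule ccontr)
  let ?S = "equilibrium_stress_matrices E"
  assume less: "\<not> ?thesis"
  obtain m where m: "\<And>\<tau> :: ('d, 'v) framework. generic_framework \<tau> \<Longrightarrow> dim (?S \<tau>) = m"
    using generic_dims[where 'd = 'd, of E] by blast
  have "\<exists>x \<Omega>. dist x \<sigma> < 1 / (real n + 1) \<and> \<Omega> \<in> ?S x \<and> norm \<Omega> = 1 \<and> (\<forall>B\<in>?S \<sigma>. B \<bullet> \<Omega> = 0)" for n :: nat
  proof -
    obtain t where t: "generic_framework (\<sigma> + t *\<^sub>R (\<rho> - \<sigma>))" "dist (\<sigma> + t *\<^sub>R (\<rho> - \<sigma>)) \<sigma> < 1 / (real n + 1)"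
      using generic_on_line_near[OF assms, of "1 / (real n + 1)" \<sigma>] by auto
    then have "dim (?S \<sigma>) < dim (?S (\<sigma> + t *\<^sub>R (\<rho> - \<sigma>)))" using less m[OF t(1)] m[OF assms] by simp
    from exists_orthogonal_of_dim_less[OF subspace_stresses subspace_stresses this]
    obtain \<Omega> where "\<Omega> \<in> ?S (\<sigma> + t *\<^sub>R (\<rho> - \<sigma>))" "norm \<Omega> = 1" "\<And>B. B \<in> ?S \<sigma> \<Longrightarrow> B \<bullet> \<Omega> = 0" by blast
    with t(2) show ?thesis by blast
  qed
  then obtain x \<Omega> where x: "\<And>n. dist (x n) \<sigma> < 1 / (real n + 1)" and \<Omega>: "\<And>n. \<Omega> n \<in> ?S (x n)"
    and n1: "\<And>n. norm (\<Omega> n) = 1" and orth: "\<And>n B. B \<in> ?S \<sigma> \<Longrightarrow> B \<bullet> \<Omega> n = 0" by metis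
  have "\<forall>n. \<Omega> n \<in> sphere 0 1" using n1 by simp
  then obtain L r where L: "strict_mono r" "(\<Omega> \<circ> r) \<longlonglongrightarrow> L"
    using compact_imp_seq_compact[OF compact_sphere, of "0 :: real ^ 'v ^ 'v" 1] by (metis seq_compactE)
  have "x \<longlonglongrightarrow> \<sigma>"
  proof (rule metric_LIMSEQ_I)
    fix e :: real assume "e > 0"
    then obtain N where N: "1 / (real N + 1) < e" using nat_approx_posE by (metis of_nat_Suc add.commute)
    have "dist (x n) \<sigma> < e" if "n \<ge> N" for n
    proof -
      have "1 / (real n + 1) \<le> 1 / (real N + 1)" using that by (intro divide_left_mono) auto
      then show ?thesis using x[of n] N by linarith
    qed
    then show "\<exists>N. \<forall>n\<ge>N. dist (x n) \<sigma> < e" by blast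
  qed
  then have xr: "(x \<circ> r) \<longlonglongrightarrow> \<sigma>" by (rule LIMSEQ_subseq_LIMSEQ[OF _ L(1)])
  have "L \<in> ?S \<sigma>" unfolding stress_iff
  proof (intro conjI allI)
    show "L \<in> edge_matrices E"
      by (rule closed_sequentially[OF closed_edge_matrices _ L(2)]) (use \<Omega> stress_iff in auto)
    fix i
    have "(\<lambda>k. coord_vec ((x \<circ> r) k) i) \<longlonglongrightarrow> coord_vec \<sigma> i"
      unfolding coord_vec_def by (intro tendsto_vec_lambda tendsto_vec_nth xr)
    then have "(\<lambda>k. (\<Omega> \<circ> r) k *v coord_vec ((x \<circ> r) k) i) \<longlonglongrightarrow> L *v coord_vec \<sigma> i"
      by (rule continuous_matrix_vector_mult_seq[OF L(2)])
    moreover have "(\<Omega> \<circ> r) k *v coord_vec ((x \<circ> r) k) i = 0" for k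
      using \<Omega>[of "r k"] by (simp add: stress_iff)
    ultimately show "L *v coord_vec \<sigma> i = 0" by (simp only: LIMSEQ_const_iff)
  qed
  then have "L \<bullet> (\<Omega> \<circ> r) k = 0" for k using orth by simp
  moreover have "(\<lambda>k. L \<bullet> (\<Omega> \<circ> r) k) \<longlonglongrightarrow> L \<bullet> L" by (intro tendsto_intros L(2))
  ultimately have "L \<bullet> L = 0" by (simp only: LIMSEQ_const_iff)
  moreover have "(\<lambda>k. norm ((\<Omega> \<circ> r) k)) \<longlonglongrightarrow> norm L" by (intro tendsto_intros L(2))
  then have "norm L = 1" by (simp only: comp_def n1 LIMSEQ_const_iff)
  ultimately show False by simp
qed

section \<open>Affine images of a generic framework and sufficiency\<close>

definition affine_comb :: "('d::finite, 'v::finite) framework \<Rightarrow> (real ^ 'd) \<times> real \<Rightarrow> real ^ 'v" where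
  "affine_comb \<rho> = (\<lambda>(c, b). b *\<^sub>R 1 + (\<Sum>i\<in>UNIV. c $ i *\<^sub>R coord_vec \<rho> i))"

lemma linear_affine_comb: "linear (affine_comb \<rho>)"
  by (rule linearI)
     (auto simp: affine_comb_def algebra_simps sum.distrib scaleR_sum_right)

lemma affine_comb_in_kernel: "range (affine_comb \<rho>) \<subseteq> shared_stress_kernel E \<rho>"
  by (auto simp: affine_comb_def intro!: subspace_add subspace_scale subspace_sum subspace_shared_kernel
      one_in_kernel coord_vec_in_kernel)

text \<open>A relation with \<open>c $ j \<noteq> 0\<close>, differentiated while only the
  \<open>j\<close>-th coordinates of the vertices move, would express every vector \<open>y\<close>
  by the \<open>d + 1\<close> parameters of an affine combination, too few for \<open>d + 2\<close>
  vertices.\<close>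

lemma generic_affine_comb_inj:
  fixes \<rho> :: "('d::finite, 'v::finite) framework"
  assumes gen: "generic_framework \<rho>" and card: "CARD('v) \<ge> CARD('d) + 2"
  shows "inj (affine_comb \<rho>)"
proof -
  have "x = 0" if x0: "affine_comb \<rho> x = 0" for x
  proof -
    obtain c b where x: "x = (c, b)" by (cases x)
    have eq: "b + (\<Sum>i\<in>UNIV. c $ i * \<rho> $ u $ i) = 0" for u
      using x0 by (simp add: affine_comb_def x vec_eq_iff coord_vec_def sum_component)
    have "c $ j = 0" for j
    proof (rule ccontr)
      assume cj: "c $ j \<noteq> 0"
      have "y \<in> range (affine_comb \<rho>)" for y
      proof -
        \<comment> \<open>Scaled so that the part of the differentiated relation in which
          \<open>c\<close> is not differentiated equals \<open>- y\<close>.\<close>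
        define \<eta> :: "('d, 'v) framework" where "\<eta> = (\<chi> u i. if i = j then - y $ u / c $ j else 0)"
        obtain D where D: "derivation D" "\<And>u i. D (\<rho> $ u $ i) = \<eta> $ u $ i"
          using generic_derivation[OF gen] by blast
        have "D b + (\<Sum>i\<in>UNIV. D (c $ i) * \<rho> $ u $ i) = y $ u" for u
        proof -
          have "0 = D (b + (\<Sum>i\<in>UNIV. c $ i * \<rho> $ u $ i))" unfolding eq using derivation_0[OF D(1)] by simp
          also have "\<dots> = D b + (\<Sum>i\<in>UNIV. D (c $ i) * \<rho> $ u $ i) + (\<Sum>i\<in>UNIV. c $ i * \<eta> $ u $ i)"
            by (simp add: derivation_add[OF D(1)] derivation_sum[OF D(1)] derivation_mult[OF D(1)] D(2)
                sum.distrib algebra_simps)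
          also have "(\<Sum>i\<in>UNIV. c $ i * \<eta> $ u $ i) = (\<Sum>i\<in>UNIV. if i = j then - y $ u else 0)"
            by (rule sum.cong) (auto simp: \<eta>_def cj)
          also have "\<dots> = - y $ u" by simp
          finally show ?thesis by simp
        qed
        then have "y = affine_comb \<rho> (\<chi> i. D (c $ i), D b)"
          by (simp add: affine_comb_def vec_eq_iff coord_vec_def sum_component)
        then show ?thesis by blast
      qed
      then have "range (affine_comb \<rho>) = UNIV" by blast
      moreover have "dim (range (affine_comb \<rho>)) \<le> dim (UNIV :: ((real ^ 'd) \<times> real) set)"
        by (rule dim_image_le[OF linear_affine_comb])
      ultimately show False using card by simp
    qed
    then show ?thesis using eq x by (simp add: vec_eq_iff zero_prod_def)
  qed
  then show ?thesis using linear_injective_0[OF linear_affine_comb] by blast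
qed

lemma dim_range_affine_comb:
  fixes \<rho> :: "('d::finite, 'v::finite) framework"
  assumes "generic_framework \<rho>" "CARD('v) \<ge> CARD('d) + 2"
  shows "dim (range (affine_comb \<rho>)) = CARD('d) + 1"
proof -
  have "dim (range (affine_comb \<rho>)) = dim (UNIV :: ((real ^ 'd) \<times> real) set)"
    by (rule dim_image_eq[OF linear_affine_comb inj_on_subset[OF generic_affine_comb_inj[OF assms] subset_UNIV]])
  then show ?thesis by simp
qed

lemma inner_symmetric_matrix:
  fixes M :: "real ^ 'd::finite ^ 'd"
  assumes "transpose M = M"
  shows "x \<bullet> (M *v y) = (M *v x) \<bullet> y"
  by (metis assms dot_lmul_matrix transpose_matrix_vector)

text \<open>Differentiating the equations of the conic turns every motion \<open>M \<eta>\<close> into an infinitesimal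
  flex, up to an affine motion.\<close>

lemma no_conic_at_infinity:
  fixes \<rho> :: "('d::finite, 'v::finite) framework"
  assumes gen: "generic_framework \<rho>" and ne: "shared_stress_kernel E \<rho> \<noteq> UNIV"
    and sym: "transpose M = M"
    and conic: "\<And>u w. {u, w} \<in> E \<Longrightarrow> (\<rho> $ u - \<rho> $ w) \<bullet> (M *v (\<rho> $ u - \<rho> $ w)) = 0"
  shows "M = 0"
proof (rule ccontr)
  assume "M \<noteq> 0"
  then obtain i j where ij: "M $ i $ j \<noteq> 0" by (auto simp: vec_eq_iff)
  have "y \<in> shared_stress_kernel E \<rho>" for y
  proof -
    define \<eta> :: "('d, 'v) framework" where "\<eta> = (\<chi> u. y $ u *\<^sub>R axis j 1)"
    obtain D where D: "derivation D" "derive_mat D \<rho> = \<eta>" using generic_derive_framework[OF gen] by blast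
    define N where "N = derive_mat D M"
    \<comment> \<open>The derivative of \<open>e \<bullet> M e\<close> is
      \<open>2 e \<bullet> (M f + (1/2) N e)\<close>, where \<open>f\<close> is the edge vector of
      \<open>\<eta>\<close> and \<open>N = D M\<close>; the bracket is the edge vector of
      \<open>\<theta>\<close>. The summand with \<open>N\<close> is a linear image of
      \<open>\<rho>\<close>, whose coordinates lie in the kernel anyway.\<close>
    define \<theta> :: "('d, 'v) framework" where "\<theta> = (\<chi> u. M *v (\<eta> $ u) + (1 / 2) *\<^sub>R (N *v (\<rho> $ u)))"
    have "\<theta> \<in> kernel_frameworks E \<rho>"
    proof (rule flex_in_kernel_frameworks[OF gen])
      fix u w assume uw: "{u, w} \<in> E"
      let ?e = "\<rho> $ u - \<rho> $ w" and ?f = "\<eta> $ u - \<eta> $ w"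
      have De: "derive_vec D ?e = ?f"
        by (simp add: derive_vec_diff[OF D(1)] D(2)[symmetric] derive_mat_def)
      have "0 = D (?e \<bullet> (M *v ?e))" using conic[OF uw] derivation_0[OF D(1)] by simp
      also have "\<dots> = ?f \<bullet> (M *v ?e) + ?e \<bullet> (N *v ?e + M *v ?f)"
        by (simp only: derivation_inner[OF D(1)] derive_mat_mult_vec[OF D(1)] De N_def)
      also have "\<dots> = 2 * (?e \<bullet> (M *v ?f)) + ?e \<bullet> (N *v ?e)"
        unfolding inner_symmetric_matrix[OF sym, of ?f] by (simp add: inner_add_right inner_commute)
      also have "\<dots> = 2 * (?e \<bullet> (M *v ?f + (1 / 2) *\<^sub>R (N *v ?e)))" by (simp add: inner_add_right)
      also have "M *v ?f + (1 / 2) *\<^sub>R (N *v ?e) = \<theta> $ u - \<theta> $ w"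
        by (simp add: \<theta>_def matrix_vector_mult_diff_distrib algebra_simps)
      finally show "?e \<bullet> (\<theta> $ u - \<theta> $ w) = 0" by simp
    qed
    then have "coord_vec \<theta> i \<in> shared_stress_kernel E \<rho>" by (simp add: kernel_frameworks_def)
    moreover have "coord_vec \<theta> i = M $ i $ j *\<^sub>R y + (1 / 2) *\<^sub>R (\<Sum>l\<in>UNIV. N $ i $ l *\<^sub>R coord_vec \<rho> l)"
    proof -
      have "(M *v (\<eta> $ u)) $ i = M $ i $ j * y $ u" for u
        by (simp add: \<eta>_def matrix_vector_mult_scaleR matrix_vector_mul_component inner_axis mult.commute)
      then show ?thesis
        by (simp add: vec_eq_iff coord_vec_def \<theta>_def sum_component matrix_vector_mult_def)
    qed
    moreover have "(1 / 2) *\<^sub>R (\<Sum>l\<in>UNIV. N $ i $ l *\<^sub>R coord_vec \<rho> l) \<in> shared_stress_kernel E \<rho>"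
      by (intro subspace_scale subspace_sum subspace_shared_kernel coord_vec_in_kernel)
    ultimately have "M $ i $ j *\<^sub>R y \<in> shared_stress_kernel E \<rho>"
      using subspace_diff[OF subspace_shared_kernel, of "coord_vec \<theta> i" E \<rho>
          "(1 / 2) *\<^sub>R (\<Sum>l\<in>UNIV. N $ i $ l *\<^sub>R coord_vec \<rho> l)"] by simp
    then have "(1 / M $ i $ j) *\<^sub>R (M $ i $ j *\<^sub>R y) \<in> shared_stress_kernel E \<rho>"
      by (rule subspace_scale[OF subspace_shared_kernel])
    then show ?thesis using ij by simp
  qed
  then show False using ne by blast
qed

theorem generic_globally_rigid_of_kernel_dim:
  fixes \<rho> :: "('d::finite, 'v::finite) framework"
  assumes gen: "generic_framework \<rho>" and card: "CARD('v) \<ge> CARD('d) + 2"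
    and dim: "dim (shared_stress_kernel E \<rho>) = CARD('d) + 1"
  shows "globally_rigid E \<rho>"
  unfolding globally_rigid_def
proof (intro allI impI)
  fix \<sigma> assume same: "same_edge_lengths E \<rho> \<sigma>"
  have SS: "equilibrium_stress_matrices E \<sigma> = equilibrium_stress_matrices E \<rho>"
    by (rule subspace_dim_equal[OF subspace_stresses subspace_stresses
          stresses_subset_of_same_lengths[OF gen same] dim_stresses_generic_le[OF gen]])
  have KR: "range (affine_comb \<rho>) = shared_stress_kernel E \<rho>"
  proof (rule subspace_dim_equal[OF _ subspace_shared_kernel affine_comb_in_kernel])
    show "subspace (range (affine_comb \<rho>))" by (rule linear_subspace_image[OF linear_affine_comb subspace_UNIV])
    show "dim (shared_stress_kernel E \<rho>) \<le> dim (range (affine_comb \<rho>))"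
      unfolding dim dim_range_affine_comb[OF gen card] ..
  qed
  have "coord_vec \<sigma> i \<in> range (affine_comb \<rho>)" for i
    using coord_vec_in_kernel[of \<sigma> i E] unfolding KR shared_stress_kernel_def SS .
  then have "\<forall>i. \<exists>x. coord_vec \<sigma> i = affine_comb \<rho> x" by blast
  then obtain x where x: "\<And>i. coord_vec \<sigma> i = affine_comb \<rho> (x i)" by metis
  define A :: "real ^ 'd ^ 'd" where "A = (\<chi> i. fst (x i))"
  define t :: "real ^ 'd" where "t = (\<chi> i. snd (x i))"
  have \<sigma>: "\<sigma> $ u = A *v (\<rho> $ u) + t" for u
  proof -
    have "\<sigma> $ u $ i = (A *v (\<rho> $ u) + t) $ i" for i
      using arg_cong[OF x[of i], of "\<lambda>y. y $ u"]
      by (simp add: coord_vec_def affine_comb_def case_prod_unfold A_def t_def matrix_vector_mult_def sum_component)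
    then show ?thesis by (simp add: vec_eq_iff)
  qed
  \<comment> \<open>Equality of the edge lengths says exactly that the quadratic form of this matrix
    vanishes on the edge directions of \<open>\<rho>\<close>.\<close>
  have "transpose A ** A - mat 1 = 0"
  proof (rule no_conic_at_infinity[OF gen])
    show "shared_stress_kernel E \<rho> \<noteq> UNIV"
    proof
      assume "shared_stress_kernel E \<rho> = UNIV"
      then show False using dim card by simp
    qed
    show "transpose (transpose A ** A - mat 1) = transpose A ** A - mat 1"
      by (simp add: matrix_transpose_mul transpose_def vec_eq_iff mat_def matrix_matrix_mult_def mult.commute)
    fix u w assume uw: "{u, w} \<in> E"
    let ?e = "\<rho> $ u - \<rho> $ w"
    have "A *v ?e = \<sigma> $ u - \<sigma> $ w" by (simp add: \<sigma> matrix_vector_mult_diff_distrib)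
    then have "(A *v ?e) \<bullet> (A *v ?e) = ?e \<bullet> ?e"
      using same uw by (simp add: same_edge_lengths_def dist_norm norm_eq)
    moreover have "?e \<bullet> (transpose A *v (A *v ?e)) = (A *v ?e) \<bullet> (A *v ?e)"
      by (metis dot_lmul_matrix vector_transpose_matrix)
    ultimately show "?e \<bullet> ((transpose A ** A - mat 1) *v ?e) = 0"
      by (simp add: matrix_vector_mult_diff_rdistrib inner_diff_right matrix_vector_mul_assoc[symmetric])
  qed
  then have "orthogonal_matrix A" by (simp add: orthogonal_matrix)
  then have "orthogonal_transformation (\<lambda>x. A *v x)"
    by (simp add: orthogonal_transformation_matrix)
  then show "congruent_frameworks \<rho> \<sigma>"
    unfolding congruent_frameworks_def using \<sigma> by blast
qed

section \<open>Folds of quadratic maps\<close>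

text \<open>Source and target have the same dimension, so that regularity is a nonzero determinant.
  The linear terms allow a component to be replaced by a single coordinate, and a map given on some
  coordinates to be padded by the identity on the others.\<close>

definition quad_map :: "('n \<Rightarrow> real ^ 'n ^ 'n) \<Rightarrow> ('n \<Rightarrow> real ^ 'n) \<Rightarrow> real ^ 'n \<Rightarrow> real ^ 'n::finite" where
  "quad_map a b x = (\<chi> k. x \<bullet> (a k *v x) + b k \<bullet> x)"

definition quad_jac :: "('n \<Rightarrow> real ^ 'n ^ 'n) \<Rightarrow> ('n \<Rightarrow> real ^ 'n) \<Rightarrow> real ^ 'n \<Rightarrow> real ^ 'n ^ 'n::finite" where
  "quad_jac a b x = (\<chi> k. 2 *\<^sub>R (a k *v x) + b k)"

lemma quad_jac_mult: "(quad_jac a b x *v h) $ k = 2 * ((a k *v x) \<bullet> h) + b k \<bullet> h"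
  by (simp add: quad_jac_def matrix_vector_mul_component inner_add_left)

lemma continuous_on_quad_map: "continuous_on S (quad_map a b)"
  unfolding quad_map_def
  by (intro continuous_on_vec_lambda continuous_intros
      linear_continuous_on bounded_linear.linear matrix_vector_mul_bounded_linear)

lemma continuous_on_det_quad_jac: "continuous_on S (\<lambda>x. det (quad_jac a b x))"
proof -
  have "continuous_on S (\<lambda>x. quad_jac a b x $ i $ j)" for i j
    by (simp add: quad_jac_def matrix_vector_mult_def) (intro continuous_intros)
  then show ?thesis unfolding det_def
    by (intro continuous_on_sum continuous_on_mult continuous_on_const continuous_on_prod)
qed

lemma det_nonzero_iff: "det A \<noteq> 0 \<longleftrightarrow> (\<forall>x. A *v x = 0 \<longrightarrow> x = 0)" for A :: "real ^ 'n::finite ^ 'n"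
  using matrix_left_invertible_ker[of A] invertible_left_inverse[of A] invertible_det_nz[of A] by blast

lemma surj_imp_det_nonzero:
  fixes A :: "real ^ 'n::finite ^ 'n"
  assumes "\<And>w. \<exists>x. A *v x = w"
  shows "det A \<noteq> 0"
proof -
  have "surj ((*v) A)" using assms by (metis surjI)
  then show ?thesis
    using matrix_right_invertible_surjective[of A] invertible_right_inverse[of A] invertible_det_nz[of A] by blast
qed

lemma poly_det:
  fixes M :: "real poly ^ 'n::finite ^ 'n"
  shows "poly (det M) t = det (\<chi> i j. poly (M $ i $ j) t)"
  by (simp add: det_def poly_sum poly_prod)

lemma derivation_coeffs_mult:
  assumes D: "derivation D" and "\<And>n. D (coeff P n) = 0" "\<And>n. D (coeff Q n) = 0"
  shows "D (coeff (P * Q) n) = 0"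
  by (simp add: coeff_mult derivation_sum[OF D] derivation_mult[OF D] assms)

lemma derivation_coeffs_det:
  fixes M :: "real poly ^ 'n::finite ^ 'n"
  assumes D: "derivation D" and M: "\<And>i j n. D (coeff (M $ i $ j) n) = 0"
  shows "D (coeff (det M) n) = 0"
proof -
  have prod: "D (coeff (\<Prod>i\<in>I. M $ i $ p i) n) = 0" for I p n
    by (induction I arbitrary: n rule: infinite_finite_induct)
       (simp_all add: coeff_1 derivation_0[OF D] derivation_1[OF D] derivation_coeffs_mult[OF D] M)
  have "D (coeff (of_int s * (\<Prod>i\<in>UNIV. M $ i $ p i)) n) = 0" for s p
    using derivation_coeffs_mult[OF D, of "[:of_int s:]" "\<Prod>i\<in>UNIV. M $ i $ p i"] prod
    by (simp add: of_int_poly coeff_pCons derivation_of_int[OF D] derivation_0[OF D] split: nat.split)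
  then show ?thesis by (simp add: det_def coeff_sum derivation_sum[OF D])
qed

context
  fixes a :: "'n::finite \<Rightarrow> real ^ 'n ^ 'n" and b :: "'n \<Rightarrow> real ^ 'n"
  assumes sym: "\<And>k. transpose (a k) = a k"
begin

text \<open>For quadratic maps the mean value theorem is exact, with the midpoint as intermediate
  point.\<close>

lemma quad_map_diff:
  "quad_map a b y - quad_map a b x = quad_jac a b ((1 / 2) *\<^sub>R (x + y)) *v (y - x)"
proof -
  have "y \<bullet> (a k *v y) - x \<bullet> (a k *v x) = (a k *v (x + y)) \<bullet> (y - x)" for k
    using inner_symmetric_matrix[OF sym, of x k y] inner_commute[of y "a k *v y"]
      inner_commute[of x "a k *v x"] inner_commute[of x "a k *v y"]
    by (simp add: matrix_vector_right_distrib inner_add_left inner_diff_right)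
  then show ?thesis
    by (simp add: vec_eq_iff quad_jac_mult quad_map_def matrix_vector_mult_scaleR inner_diff_right algebra_simps)
qed

lemma derive_quad_map:
  assumes D: "derivation D" and "\<And>k. derive_mat D (a k) = 0" "\<And>k. derive_vec D (b k) = 0"
  shows "derive_vec D (quad_map a b x) = quad_jac a b x *v derive_vec D x"
proof -
  have "D (x \<bullet> (a k *v x) + b k \<bullet> x) = 2 * ((a k *v x) \<bullet> derive_vec D x) + b k \<bullet> derive_vec D x" for k
  proof -
    have "D (x \<bullet> (a k *v x)) = derive_vec D x \<bullet> (a k *v x) + x \<bullet> (a k *v derive_vec D x)"
      by (simp add: derivation_inner[OF D] derive_mat_mult_vec[OF D] assms)
    also have "\<dots> = 2 * ((a k *v x) \<bullet> derive_vec D x)"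
      unfolding inner_symmetric_matrix[OF sym, of x k "derive_vec D x"]
        inner_commute[of "derive_vec D x" "a k *v x"] by simp
    finally show ?thesis by (simp add: derivation_add[OF D] derivation_inner[OF D] assms)
  qed
  then show ?thesis by (simp add: vec_eq_iff quad_jac_mult quad_map_def derive_vec_def[where x = "vec_lambda _"])
qed

text \<open>On a ball of regular points the midpoint identity gives injectivity, since balls are
  convex. Invariance of domain then provides the open image and the continuous inverse.\<close>

lemma quad_map_local_homeomorphism:
  assumes "det (quad_jac a b p) \<noteq> 0" "\<epsilon> > 0"
  obtains r g where "0 < r" "r \<le> \<epsilon>" "homeomorphism (ball p r) (quad_map a b ` ball p r) (quad_map a b) g"
    "open (quad_map a b ` ball p r)" "\<And>x. x \<in> ball p r \<Longrightarrow> det (quad_jac a b x) \<noteq> 0"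
proof -
  have "open {x. det (quad_jac a b x) \<noteq> 0}"
    by (rule open_Collect_neq) (intro continuous_on_det_quad_jac continuous_on_const)+
  then obtain r0 where r0: "r0 > 0" "ball p r0 \<subseteq> {x. det (quad_jac a b x) \<noteq> 0}"
    using assms(1) open_contains_ball by blast
  define r where "r = min r0 \<epsilon>"
  have det: "det (quad_jac a b x) \<noteq> 0" if "x \<in> ball p r" for x
    using r0 that by (auto simp: r_def subset_iff)
  have inj: "inj_on (quad_map a b) (ball p r)"
  proof (rule inj_onI)
    fix x y assume xy: "x \<in> ball p r" "y \<in> ball p r" "quad_map a b x = quad_map a b y"
    have "(1 / 2) *\<^sub>R (x + y) \<in> ball p r"
      using convexD[OF convex_ball xy(1,2), of "1 / 2" "1 / 2"] by (simp add: scaleR_add_right)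
    moreover have "quad_jac a b ((1 / 2) *\<^sub>R (x + y)) *v (y - x) = 0"
      using quad_map_diff[of y x] xy(3) by simp
    ultimately show "x = y" using det det_nonzero_iff by fastforce
  qed
  obtain g where "homeomorphism (ball p r) (quad_map a b ` ball p r) (quad_map a b) g"
    using invariance_of_domain_homeomorphism[OF open_ball continuous_on_quad_map order_refl inj] by blast
  moreover have "open (quad_map a b ` ball p r)"
    by (rule invariance_of_domain_gen[OF open_ball continuous_on_quad_map inj]) simp
  ultimately show ?thesis using that[of r] r0 assms(2) det by (simp add: r_def)
qed

text \<open>The coordinates of a base point where the Jacobian does not vanish are replaced one at a
  time by those of \<open>x\<close>.\<close>

lemma generic_det_nonzero:
  assumes generic: "\<And>\<xi>. \<exists>D. derivation D \<and> (\<forall>s\<in>A. D s = 0) \<and> derive_vec D x = \<xi>"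
    and A: "\<And>k i j. a k $ i $ j \<in> A" "\<And>k i. b k $ i \<in> A" "\<And>i. x0 $ i \<in> A"
    and x0: "det (quad_jac a b x0) \<noteq> 0"
  shows "det (quad_jac a b x) \<noteq> 0"
proof -
  define y where "y S = (\<chi> i. if i \<in> S then x $ i else x0 $ i)" for S
  have "det (quad_jac a b (y S)) \<noteq> 0" if "finite S" for S
    using that
  proof induction
    case empty
    have "y {} = x0" by (simp add: y_def vec_eq_iff)
    then show ?case using x0 by simp
  next
    case (insert l S)
    obtain D where D: "derivation D" "\<forall>s\<in>A. D s = 0" "derive_vec D x = axis l 1" using generic by blast
    have Dx: "D (x $ i) = (if i = l then 1 else 0)" for i
      using arg_cong[OF D(3), of "\<lambda>v. v $ i"] by (simp add: derive_vec_def axis_def)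
    define z where "z = (\<chi> i. if i = l then 0 else y S $ i)"
    have Dz: "D (z $ i) = 0" for i
      using insert.hyps Dx D(2) A(3) by (auto simp: z_def y_def derivation_0[OF D(1)])
    \<comment> \<open>The Jacobian on the line in direction \<open>l\<close>, with the coordinate
      \<open>l\<close> as indeterminate. \<open>D\<close> kills all its coefficients while
      \<open>D (x $ l) = 1\<close>, so the determinant, which is nonzero at \<open>x0 $ l\<close>,
      has no root at \<open>x $ l\<close>.\<close>
    define M :: "real poly ^ 'n ^ 'n" where
      "M = (\<chi> k j. [:2 * (\<Sum>i\<in>UNIV. a k $ j $ i * z $ i) + b k $ j, 2 * a k $ j $ l:])"
    have M: "poly (M $ k $ j) t = quad_jac a b (z + t *\<^sub>R axis l 1) $ k $ j" for k j t
    proof -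
      have "(\<Sum>i\<in>UNIV. a k $ j $ i * (t * axis l 1 $ i)) = (\<Sum>i\<in>UNIV. if i = l then a k $ j $ l * t else 0)"
        by (rule sum.cong) (auto simp: axis_def)
      then show ?thesis
        by (simp add: M_def quad_jac_def matrix_vector_mult_def sum.distrib algebra_simps)
    qed
    have DM: "D (coeff (M $ k $ j) n) = 0" for k j n
    proof -
      have "D (2 * (\<Sum>i\<in>UNIV. a k $ j $ i * z $ i) + b k $ j) = 0" "D (2 * a k $ j $ l) = 0"
        using D(2) A Dz derivation_of_int[OF D(1), of 2]
        by (simp_all add: derivation_add[OF D(1)] derivation_mult[OF D(1)] derivation_sum[OF D(1)])
      then show ?thesis by (auto simp: M_def coeff_pCons derivation_0[OF D(1)] split: nat.split)
    qed
    have det: "poly (det M) t = det (quad_jac a b (z + t *\<^sub>R axis l 1))" for t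
      by (simp add: poly_det M)
    have "z + (x0 $ l) *\<^sub>R axis l 1 = y S"
      using insert.hyps by (auto simp: z_def y_def vec_eq_iff axis_def)
    then have "det M \<noteq> 0" using det[of "x0 $ l"] insert.IH by auto
    moreover have "D (coeff (det M) n) = 0" for n by (rule derivation_coeffs_det[OF D(1) DM])
    moreover have "D (x $ l) \<noteq> 0" using Dx by simp
    ultimately have "poly (det M) (x $ l) \<noteq> 0" using derivation_algebraic[OF D(1)] by blast
    moreover have "z + (x $ l) *\<^sub>R axis l 1 = y (insert l S)"
      by (auto simp: z_def y_def vec_eq_iff axis_def)
    ultimately show ?case using det[of "x $ l"] by simp
  qed
  then have "det (quad_jac a b (y UNIV)) \<noteq> 0" by simp
  moreover have "y UNIV = x" by (simp add: y_def vec_eq_iff)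
  ultimately show ?thesis by simp
qed

end

text \<open>Plays the role of the algebraic closure of the field generated by \<open>A\<close>; it
  is countable when \<open>A\<close> is.\<close>

definition derivation_closure :: "real set \<Rightarrow> real set" where
  "derivation_closure A = {s. \<forall>D. derivation D \<longrightarrow> (\<forall>s\<in>A. D s = 0) \<longrightarrow> D s = 0}"

section \<open>Generic fibers of a quadratic map\<close>

context
  fixes a :: "'n::finite \<Rightarrow> real ^ 'n ^ 'n" and b :: "'n \<Rightarrow> real ^ 'n"
    and k0 :: 'n and A :: "real set" and z :: "'n \<Rightarrow> real" and x0 :: "real ^ 'n"
  assumes sym: "\<And>k. transpose (a k) = a k"
    and A: "\<And>k i j. a k $ i $ j \<in> A" "\<And>k i. b k $ i \<in> A" "\<And>i. x0 $ i \<in> A"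
    and x0: "det (quad_jac a b x0) \<noteq> 0"
    and generic: "\<And>v. \<exists>D. derivation D \<and> (\<forall>s\<in>A. D s = 0) \<and> (\<forall>k\<in>UNIV - {k0}. D (z k) = v k)"
begin

text \<open>The preimage of a line parallel to the axis \<open>k0\<close> whose other coordinates
  are generic over the coefficients of the map.\<close>

definition "fiber = {x. \<forall>k. k \<noteq> k0 \<longrightarrow> quad_map a b x $ k = z k}"

text \<open>Component \<open>k0\<close> is replaced by the coordinate \<open>x $ i\<close>. Where
  the resulting map is regular, \<open>x $ i\<close> is a local parameter of the fiber.\<close>

definition "row_a = a(k0 := 0)"
definition "row_b i = b(k0 := axis i 1)"

lemma row_map: "quad_map row_a (row_b i) x $ k = (if k = k0 then x $ i else quad_map a b x $ k)"
  by (simp add: quad_map_def row_a_def row_b_def inner_axis')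

lemma row_jac: "(quad_jac row_a (row_b i) x *v \<xi>) $ k = (if k = k0 then \<xi> $ i else (quad_jac a b x *v \<xi>) $ k)"
  by (simp add: quad_jac_mult row_a_def row_b_def inner_axis')

lemma sym_row: "transpose (row_a k) = row_a k"
  using sym by (simp add: row_a_def transpose_def vec_eq_iff)

lemma derive_jac:
  assumes "derivation D" "\<forall>s\<in>A. D s = 0"
  shows "derive_vec D (quad_map a b x) = quad_jac a b x *v derive_vec D x"
  using assms A by (intro derive_quad_map[OF sym]) (auto simp: derive_mat_def derive_vec_def vec_eq_iff)

text \<open>Since the derivatives of the \<open>z k\<close> can be prescribed, the Jacobian without
  row \<open>k0\<close> is onto at every point of the fiber, and a derivation supplies the
  preimages.\<close>

lemma fiber_derivation:
  assumes "x \<in> fiber"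
  obtains D where "derivation D" "\<forall>s\<in>A. D s = 0" "\<And>k. k \<noteq> k0 \<Longrightarrow> (quad_jac a b x *v derive_vec D x) $ k = v $ k"
proof -
  obtain D where D: "derivation D" "\<forall>s\<in>A. D s = 0" "\<forall>k\<in>UNIV - {k0}. D (z k) = v $ k" using generic by blast
  have "(quad_jac a b x *v derive_vec D x) $ k = v $ k" if "k \<noteq> k0" for k
  proof -
    have "(quad_jac a b x *v derive_vec D x) $ k = D (quad_map a b x $ k)" using derive_jac[OF D(1,2), of x] by (metis derive_vec_def vec_lambda_beta)
    also have "\<dots> = v $ k" using assms that D(3) by (simp add: fiber_def)
    finally show ?thesis .
  qed
  with D(1,2) that show ?thesis by blast
qed

text \<open>A derivation maps \<open>0\<close> to \<open>0\<close>, so the preimages it supplies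
  vanish wherever \<open>x\<close> does. The rows other than \<open>k0\<close> are thus already onto
  on vectors with these zeros, and the axis vector \<open>e\<close> takes care of the row
  \<open>x $ k\<close>.\<close>

lemma zero_coordinate_preimage:
  assumes x: "x \<in> fiber" and k: "x $ k = 0"
  obtains \<xi> where "quad_jac row_a (row_b k) x *v \<xi> = w" "\<And>l. l \<noteq> k \<Longrightarrow> x $ l = 0 \<Longrightarrow> \<xi> $ l = 0"
proof -
  let ?H = "quad_jac row_a (row_b k) x"
  define e :: "real ^ 'n" where "e = axis k 1"
  obtain D where D: "derivation D" "\<And>j. j \<noteq> k0 \<Longrightarrow> (quad_jac a b x *v derive_vec D x) $ j = (w - w $ k0 *\<^sub>R (?H *v e)) $ j"
    using fiber_derivation[OF x] by metis
  have D0: "derive_vec D x $ l = 0" if "x $ l = 0" for l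
    using that by (simp add: derive_vec_def derivation_0[OF D(1)])
  show ?thesis
  proof (rule that)
    show "?H *v (w $ k0 *\<^sub>R e + derive_vec D x) = w"
      using D(2) D0[OF k]
      by (auto simp: vec_eq_iff row_jac matrix_vector_right_distrib matrix_vector_mult_scaleR e_def)
    show "(w $ k0 *\<^sub>R e + derive_vec D x) $ l = 0" if "l \<noteq> k" "x $ l = 0" for l
      using that D0 by (simp add: e_def axis_def)
  qed
qed

lemma zero_coordinate_det: "x \<in> fiber \<Longrightarrow> x $ k = 0 \<Longrightarrow> det (quad_jac row_a (row_b k) x) \<noteq> 0"
  by (rule surj_imp_det_nonzero) (metis zero_coordinate_preimage)

text \<open>The fiber is a curve: one vanishing coordinate can be met, two are too many. Otherwise
  the image of the axis vector \<open>l\<close> under the invertible Jacobian would have a second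
  preimage, with entry \<open>0\<close> at \<open>l\<close>.\<close>

lemma fiber_one_zero:
  assumes x: "x \<in> fiber" and "x $ k = 0" "x $ l = 0"
  shows "k = l"
proof (rule ccontr)
  assume "k \<noteq> l"
  let ?H = "quad_jac row_a (row_b k) x"
  obtain \<xi> where \<xi>: "?H *v \<xi> = ?H *v axis l 1" "\<xi> $ l = 0"
    using zero_coordinate_preimage[OF x assms(2)] \<open>k \<noteq> l\<close> assms(3) by metis
  have "?H *v (\<xi> - axis l 1) = 0" using \<xi>(1) by (simp add: matrix_vector_mult_diff_distrib)
  then have "\<xi> - axis l 1 = 0" using zero_coordinate_det[OF x assms(2)] det_nonzero_iff by blast
  then have "\<xi> $ l = axis l (1 :: real) $ l" by simp
  with \<xi>(2) show False by (simp add: axis_def)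
qed

lemma fiber_zero_tangent:
  assumes x: "x \<in> fiber" and "x $ k = 0" "\<xi> $ k = 0" "quad_jac a b x *v \<xi> = 0"
  shows "\<xi> = 0"
proof -
  have "quad_jac row_a (row_b k) x *v \<xi> = 0" using assms by (simp add: vec_eq_iff row_jac)
  then show ?thesis using zero_coordinate_det[OF x assms(2)] det_nonzero_iff by blast
qed

lemma tangent_det:
  assumes x: "x \<in> fiber" and "\<zeta> $ i \<noteq> 0" "\<And>k. k \<noteq> k0 \<Longrightarrow> (quad_jac a b x *v \<zeta>) $ k = 0"
  shows "det (quad_jac row_a (row_b i) x) \<noteq> 0"
proof (rule surj_imp_det_nonzero)
  fix w
  obtain D where D: "\<And>j. j \<noteq> k0 \<Longrightarrow> (quad_jac a b x *v derive_vec D x) $ j = w $ j"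
    using fiber_derivation[OF x] by metis
  let ?\<xi> = "derive_vec D x + ((w $ k0 - derive_vec D x $ i) / \<zeta> $ i) *\<^sub>R \<zeta>"
  have "quad_jac row_a (row_b i) x *v ?\<xi> = w"
    using assms(2,3) D by (auto simp: vec_eq_iff row_jac matrix_vector_right_distrib matrix_vector_mult_scaleR)
  then show "\<exists>\<xi>. quad_jac row_a (row_b i) x *v \<xi> = w" by blast
qed

text \<open>If a critical point of the fiber had a coordinate moved by a derivation that fixes \<open>z\<close>, then
  it would be generic, contradicting the vanishing of the Jacobian.\<close>

lemma critical_coordinate:
  assumes x: "x \<in> fiber" and crit: "det (quad_jac a b x) = 0"
  shows "x $ i \<in> derivation_closure (A \<union> z ` (UNIV - {k0}))"
proof (rule ccontr)
  assume "\<not> ?thesis"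
  then obtain D1 where D1: "derivation D1" "\<forall>s\<in>A \<union> z ` (UNIV - {k0}). D1 s = 0" "D1 (x $ i) \<noteq> 0"
    by (auto simp: derivation_closure_def)
  define \<zeta> where "\<zeta> = derive_vec D1 x"
  have \<zeta>i: "\<zeta> $ i \<noteq> 0" using D1 by (simp add: \<zeta>_def derive_vec_def)
  have \<zeta>: "(quad_jac a b x *v \<zeta>) $ k = 0" if "k \<noteq> k0" for k
  proof -
    have "(quad_jac a b x *v \<zeta>) $ k = D1 (quad_map a b x $ k)" unfolding \<zeta>_def
      using derive_jac[of D1 x] D1 by (metis UnI1 derive_vec_def vec_lambda_beta)
    then show ?thesis using x that D1(2) by (auto simp: fiber_def)
  qed
  have det: "det (quad_jac row_a (row_b i) x) \<noteq> 0" by (rule tangent_det[OF x \<zeta>i \<zeta>])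
  have "\<exists>D. derivation D \<and> (\<forall>s\<in>A. D s = 0) \<and> derive_vec D x = \<xi>" for \<xi>
  proof -
    obtain D2 where D2: "derivation D2" "\<forall>s\<in>A. D2 s = 0" "\<And>k. k \<noteq> k0 \<Longrightarrow> (quad_jac a b x *v derive_vec D2 x) $ k = (quad_jac a b x *v \<xi>) $ k"
      using fiber_derivation[OF x, of "quad_jac a b x *v \<xi>"] by metis
    \<comment> \<open>\<open>D2\<close> realizes \<open>\<xi>\<close> in all rows but
      \<open>k0\<close>. A multiple of \<open>D1\<close>, whose motion \<open>\<zeta>\<close> is
      tangent to the fiber, adjusts coordinate \<open>i\<close>, and regularity of the map with row
      \<open>x $ i\<close> forces agreement in all coordinates.\<close>
    define c where "c = (\<xi> $ i - derive_vec D2 x $ i) / \<zeta> $ i"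
    define D where "D = (\<lambda>s. D2 s + c * D1 s)"
    have Dx: "derive_vec D x = derive_vec D2 x + c *\<^sub>R \<zeta>"
      by (simp add: derive_vec_def D_def \<zeta>_def vec_eq_iff)
    have "quad_jac row_a (row_b i) x *v (derive_vec D x - \<xi>) = 0"
      using D2(3) \<zeta> \<zeta>i unfolding Dx
      by (auto simp: vec_eq_iff row_jac matrix_vector_right_distrib matrix_vector_mult_scaleR
          matrix_vector_mult_diff_distrib c_def)
    then have "derive_vec D x = \<xi>" using det det_nonzero_iff by fastforce
    moreover have "derivation D" unfolding D_def by (rule derivation_lincomb[OF D2(1) D1(1)])
    moreover have "\<forall>s\<in>A. D s = 0" using D1 D2 by (simp add: D_def)
    ultimately show ?thesis by blast
  qed
  then have "det (quad_jac a b x) \<noteq> 0" by (rule generic_det_nonzero[OF sym _ A x0])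
  then show False using crit by simp
qed

text \<open>The value is a polynomial in coordinates that no derivation constant on \<open>A\<close>
  and \<open>z\<close> can move. Hence all critical values on the fiber lie in one countable
  set.\<close>

lemma critical_value:
  assumes x: "x \<in> fiber" and crit: "det (quad_jac a b x) = 0"
  shows "quad_map a b x $ k0 \<in> derivation_closure (A \<union> z ` (UNIV - {k0}))"
  unfolding derivation_closure_def
proof (intro CollectI allI impI)
  fix D assume D: "derivation D" "\<forall>s\<in>A \<union> z ` (UNIV - {k0}). D s = 0"
  have "D (x $ i) = 0" for i using critical_coordinate[OF assms, of i] D by (simp add: derivation_closure_def)
  then have "derive_vec D x = 0" by (simp add: derive_vec_def vec_eq_iff)
  then have "derive_vec D (quad_map a b x) = 0" using derive_jac[of D x] D by simp
  then show "D (quad_map a b x $ k0) = 0" by (metis derive_vec_def vec_lambda_beta zero_index)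
qed

text \<open>The fiber is a curve near a minimum of the remaining coordinate, and that coordinate increases
  on both sides, so a noncritical value just above the minimum is attained twice.\<close>

lemma fiber_fold:
  assumes "countable A" and xs: "xs \<in> fiber" and mn: "\<And>y. y \<in> fiber \<Longrightarrow> quad_map a b xs $ k0 \<le> quad_map a b y $ k0"
    and "\<epsilon> > 0"
  obtains x y where "x \<noteq> y" "dist x xs < \<epsilon>" "dist y xs < \<epsilon>" "quad_map a b x = quad_map a b y"
    "det (quad_jac a b x) \<noteq> 0" "det (quad_jac a b y) \<noteq> 0"
proof -
  define C where "C = derivation_closure (A \<union> z ` (UNIV - {k0}))"
  have cC: "countable C" unfolding C_def derivation_closure_def
    by (intro countable_derivation_closure countable_Un assms countable_finite) simp
  have avoid: "\<exists>t. l < t \<and> t < u \<and> t + s \<notin> C" if "l < u" for l u s :: real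
  proof (rule ccontr)
    assume "\<not> ?thesis"
    then have "{l<..<u} \<subseteq> (\<lambda>t. t - s) ` C" by (auto simp: image_iff) (metis add_diff_cancel_right')
    from countable_subset[OF this] cC have "countable {l<..<u}" by simp
    then show False using uncountable_open_interval[of l u] that by simp
  qed
  \<comment> \<open>With row \<open>k0\<close> set to zero the Jacobian is singular, which yields a
    tangent vector of the fiber at \<open>xs\<close>.\<close>
  have "\<not> (\<forall>\<zeta>. (\<chi> k. if k = k0 then 0 else quad_jac a b xs $ k) *v \<zeta> = 0 \<longrightarrow> \<zeta> = 0)"
    unfolding det_nonzero_iff[symmetric] by (simp add: det_zero_row(2)[of k0] row_def vec_eq_iff)
  then obtain \<zeta> where "\<zeta> \<noteq> 0" and \<zeta>: "(\<chi> k. if k = k0 then 0 else quad_jac a b xs $ k) *v \<zeta> = 0" by blast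
  then obtain i where i: "\<zeta> $ i \<noteq> 0" by (auto simp: vec_eq_iff)
  have "(quad_jac a b xs *v \<zeta>) $ k = 0" if "k \<noteq> k0" for k
    using arg_cong[OF \<zeta>, of "\<lambda>v. v $ k"] that by (simp add: matrix_vector_mul_component)
  then have det: "det (quad_jac row_a (row_b i) xs) \<noteq> 0" by (rule tangent_det[OF xs i])
  let ?\<Phi> = "quad_map row_a (row_b i)"
  obtain r g where r: "0 < r" "r \<le> \<epsilon>" and hom: "homeomorphism (ball xs r) (?\<Phi> ` ball xs r) ?\<Phi> g"
    and op: "open (?\<Phi> ` ball xs r)"
    using quad_map_local_homeomorphism[OF sym_row det \<open>\<epsilon> > 0\<close>] by metis
  have "?\<Phi> xs \<in> ?\<Phi> ` ball xs r" using r by simp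
  then obtain \<delta> where \<delta>: "\<delta> > 0" "ball (?\<Phi> xs) \<delta> \<subseteq> ?\<Phi> ` ball xs r" using op open_contains_ball by blast
  \<comment> \<open>The curve \<open>c\<close> below is the local preimage of this segment: it stays
    in the fiber and is parametrized by its coordinate \<open>i\<close>.\<close>
  define p where "p \<tau> = ?\<Phi> xs + \<tau> *\<^sub>R axis k0 1" for \<tau> :: real
  have p: "p \<tau> \<in> ?\<Phi> ` ball xs r" if "\<bar>\<tau>\<bar> < \<delta>" for \<tau>
    using \<delta>(2) that by (intro subsetD[OF \<delta>(2)]) (simp add: p_def dist_norm)
  define c where "c \<tau> = g (p \<tau>)" for \<tau>
  have c: "c \<tau> \<in> ball xs r" "?\<Phi> (c \<tau>) = p \<tau>" if "\<bar>\<tau>\<bar> < \<delta>" for \<tau>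
    using hom p[OF that] unfolding c_def homeomorphism_def by auto
  have ci: "c \<tau> $ i = \<tau> + xs $ i" if "\<bar>\<tau>\<bar> < \<delta>" for \<tau>
    using arg_cong[OF c(2)[OF that], of "\<lambda>v. v $ k0"] by (simp add: row_map p_def)
  have fc: "quad_map a b (c \<tau>) $ k = z k" if "\<bar>\<tau>\<bar> < \<delta>" "k \<noteq> k0" for \<tau> k
    using arg_cong[OF c(2)[OF that(1)], of "\<lambda>v. v $ k"] that(2) xs by (simp add: row_map p_def fiber_def axis_def)
  then have cfib: "c \<tau> \<in> fiber" if "\<bar>\<tau>\<bar> < \<delta>" for \<tau> using that by (simp add: fiber_def)
  have c0: "c 0 = xs" using hom r unfolding c_def p_def homeomorphism_def by simp
  have contc: "continuous_on {- \<delta><..<\<delta>} c"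
  proof -
    have "continuous_on {- \<delta><..<\<delta>} p" unfolding p_def by (intro continuous_intros)
    moreover
    have "p ` {- \<delta><..<\<delta>} \<subseteq> ?\<Phi> ` ball xs r" using p by auto
    then have "continuous_on (p ` {- \<delta><..<\<delta>}) g"
      by (rule continuous_on_subset[OF homeomorphism_cont2[OF hom]])
    ultimately have "continuous_on {- \<delta><..<\<delta>} (g \<circ> p)" by (intro continuous_on_compose)
    then show ?thesis by (simp add: c_def comp_def)
  qed
  define G where "G \<tau> = quad_map a b (c \<tau>) $ k0" for \<tau>
  have contG: "continuous_on {- \<delta><..<\<delta>} G" unfolding G_def
    by (intro continuous_on_component continuous_on_compose2[OF continuous_on_quad_map[of UNIV] contc]) auto
  have G0: "G 0 \<le> G \<tau>" if "\<bar>\<tau>\<bar> < \<delta>" for \<tau> using mn[OF cfib[OF that]] by (simp add: G_def c0)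
  \<comment> \<open>If \<open>G\<close> were constant on an interval, some parameter there puts
    coordinate \<open>i\<close> outside the countable set \<open>C\<close>. That point is
    noncritical, so the whole map is injective near it, yet it would be constant along the
    curve.\<close>
  have nonconst: "\<exists>\<tau>. l < \<tau> \<and> \<tau> < u \<and> G 0 < G \<tau>" if lu: "- \<delta> \<le> l" "l < u" "u \<le> \<delta>" for l u
  proof (rule ccontr)
    assume "\<not> ?thesis"
    then have const: "G \<tau> = G 0" if "l < \<tau>" "\<tau> < u" for \<tau> using that lu G0[of \<tau>] by force
    obtain \<tau> where \<tau>: "l < \<tau>" "\<tau> < u" "\<tau> + xs $ i \<notin> C" using avoid[OF lu(2)] by blast
    have small: "\<bar>\<tau>\<bar> < \<delta>" using \<tau> lu by linarith
    then have dc: "det (quad_jac a b (c \<tau>)) \<noteq> 0" using critical_coordinate[OF cfib[OF small], of i] \<tau>(3) ci[OF small] unfolding C_def by auto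
    from quad_map_local_homeomorphism[OF sym dc zero_less_one]
    obtain r' g' where r': "0 < r'" "homeomorphism (ball (c \<tau>) r') (quad_map a b ` ball (c \<tau>) r') (quad_map a b) g'" by blast
    have "isCont c \<tau>" using contc \<tau> lu by (intro continuous_on_interior[OF contc]) auto
    then obtain s where s: "s > 0" "\<And>t. dist t \<tau> < s \<Longrightarrow> dist (c t) (c \<tau>) < r'"
      using r'(1) unfolding continuous_at_eps_delta by metis
    define t where "t = \<tau> + min (s / 2) ((u - \<tau>) / 2)"
    have t: "\<tau> < t" "t < u" "dist t \<tau> < s" using s(1) \<tau>
      by (auto simp: t_def dist_real_def min_def field_simps)
    then have st: "\<bar>t\<bar> < \<delta>" using \<tau> lu by linarith
    have "quad_map a b (c t) $ k = quad_map a b (c \<tau>) $ k" for k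
      using const[of t] const[of \<tau>] t \<tau> fc[OF st, of k] fc[OF small, of k] by (cases "k = k0") (auto simp: G_def)
    then have "quad_map a b (c t) = quad_map a b (c \<tau>)" by (simp add: vec_eq_iff)
    moreover have "c t \<in> ball (c \<tau>) r'" "c \<tau> \<in> ball (c \<tau>) r'" using s(2)[OF t(3)] r'(1) by (simp_all add: dist_commute)
    ultimately have "c t = c \<tau>" using homeomorphism_apply1[OF r'(2)] by metis
    then show False using ci[OF st] ci[OF small] t(1) by simp
  qed
  obtain \<tau>1 where \<tau>1: "0 < \<tau>1" "\<tau>1 < \<delta>" "G 0 < G \<tau>1" using nonconst[of 0 \<delta>] \<delta>(1) by auto
  obtain \<tau>2 where \<tau>2: "- \<delta> < \<tau>2" "\<tau>2 < 0" "G 0 < G \<tau>2" using nonconst[of "- \<delta>" 0] \<delta>(1) by auto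
  obtain v where v: "G 0 < v" "v < min (G \<tau>1) (G \<tau>2)" "v \<notin> C"
    using avoid[of "G 0" "min (G \<tau>1) (G \<tau>2)" 0] \<tau>1(3) \<tau>2(3) by auto
  obtain s1 where s1: "0 \<le> s1" "s1 \<le> \<tau>1" "G s1 = v"
  proof -
    have "continuous_on {0..\<tau>1} G" using \<tau>1 by (intro continuous_on_subset[OF contG]) auto
    then show ?thesis using IVT'[of G 0 v \<tau>1] v \<tau>1 that by auto
  qed
  obtain s2 where s2: "\<tau>2 \<le> s2" "s2 \<le> 0" "G s2 = v"
  proof -
    have "continuous_on {\<tau>2..0} G" using \<tau>2 by (intro continuous_on_subset[OF contG]) auto
    then show ?thesis using IVT2'[of G 0 v \<tau>2] v \<tau>2 that by auto
  qed
  have ss: "\<bar>s1\<bar> < \<delta>" "\<bar>s2\<bar> < \<delta>" "s1 \<noteq> 0" "s2 \<noteq> 0" using s1 s2 \<tau>1 \<tau>2 v by auto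
  have reg: "det (quad_jac a b (c \<tau>)) \<noteq> 0" if "\<bar>\<tau>\<bar> < \<delta>" "G \<tau> = v" for \<tau>
    using critical_value[OF cfib[OF that(1)]] v(3) that(2) unfolding G_def C_def by auto
  show ?thesis
  proof (rule that)
    show "c s1 \<noteq> c s2" using ci[OF ss(1)] ci[OF ss(2)] s1 s2 ss by auto
    show "dist (c s1) xs < \<epsilon>" "dist (c s2) xs < \<epsilon>" using c(1)[OF ss(1)] c(1)[OF ss(2)] r(2) by (simp_all add: dist_commute)
    have "quad_map a b (c s1) $ k = quad_map a b (c s2) $ k" for k
      using fc[OF ss(1), of k] fc[OF ss(2), of k] s1(3) s2(3) by (cases "k = k0") (auto simp: G_def)
    then show "quad_map a b (c s1) = quad_map a b (c s2)" by (simp add: vec_eq_iff)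
    show "det (quad_jac a b (c s1)) \<noteq> 0" "det (quad_jac a b (c s2)) \<noteq> 0" using reg ss s1 s2 by blast+
  qed
qed

end

text \<open>The map is open near \<open>x0\<close>, so generic values close to that of
  \<open>x0\<close> have a nonempty fiber, and properness provides a minimum \<open>xs\<close> of
  component \<open>k0\<close> on it. The first two conclusions record that the fiber is in general
  position to the coordinate hyperplanes at \<open>xs\<close>.\<close>

theorem quadratic_map_fold:
  fixes a :: "'n::finite \<Rightarrow> real ^ 'n ^ 'n" and b :: "'n \<Rightarrow> real ^ 'n"
  assumes sym: "\<And>k. transpose (a k) = a k" and x0: "det (quad_jac a b x0) \<noteq> 0"
    and proper: "\<And>c. bounded {x. \<forall>k. if k = k0 then quad_map a b x $ k \<le> c else \<bar>quad_map a b x $ k\<bar> \<le> c}"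
  obtains xs where "\<forall>k l. xs $ k = 0 \<longrightarrow> xs $ l = 0 \<longrightarrow> k = l"
    "\<forall>k \<xi>. xs $ k = 0 \<longrightarrow> \<xi> $ k = 0 \<longrightarrow> quad_jac a b xs *v \<xi> = 0 \<longrightarrow> \<xi> = 0"
    "\<forall>\<epsilon>>0. \<exists>x y. x \<noteq> y \<and> dist x xs < \<epsilon> \<and> dist y xs < \<epsilon> \<and> quad_map a b x = quad_map a b y \<and>
      det (quad_jac a b x) \<noteq> 0 \<and> det (quad_jac a b y) \<noteq> 0"
proof -
  let ?f = "quad_map a b"
  define A where "A = range (\<lambda>(k, i, j). a k $ i $ j) \<union> range (\<lambda>(k, i). b k $ i) \<union> range (($) x0)"
  have A: "a k $ i $ j \<in> A" "b k $ i \<in> A" "x0 $ i \<in> A" for k i j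
  proof -
    have "a k $ i $ j \<in> range (\<lambda>(k, i, j). a k $ i $ j)" by (rule range_eqI[of _ _ "(k, i, j)"]) simp
    moreover have "b k $ i \<in> range (\<lambda>(k, i). b k $ i)" by (rule range_eqI[of _ _ "(k, i)"]) simp
    ultimately show "a k $ i $ j \<in> A" "b k $ i \<in> A" "x0 $ i \<in> A" by (simp_all add: A_def)
  qed
  have "finite A" by (simp add: A_def)
  then have cA: "countable A" by (rule countable_finite)
  obtain r g where "0 < r" "open (?f ` ball x0 r)" using quad_map_local_homeomorphism[OF sym x0 zero_less_one] by metis
  moreover from this have "?f x0 \<in> ?f ` ball x0 r" by simp
  ultimately obtain \<delta> where \<delta>: "\<delta> > 0" "ball (?f x0) \<delta> \<subseteq> ?f ` ball x0 r" using open_contains_ball by blast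
  define e where "e = \<delta> / (2 * CARD('n))"
  have e: "e > 0" using \<delta>(1) by (simp add: e_def)
  obtain z where z: "\<And>k. k \<in> UNIV - {k0} \<Longrightarrow> \<bar>z k - ?f x0 $ k\<bar> < e"
    and generic: "\<And>v. \<exists>D. derivation D \<and> (\<forall>s\<in>A. D s = 0) \<and> (\<forall>k\<in>UNIV - {k0}. D (z k) = v k)"
    using exists_generic_near[of "UNIV - {k0}" A e "\<lambda>k. ?f x0 $ k"] cA e by auto
  define y where "y = (\<chi> k. if k = k0 then ?f x0 $ k else z k)"
  have "norm (y - ?f x0) \<le> (\<Sum>k\<in>UNIV. \<bar>(y - ?f x0) $ k\<bar>)" by (rule norm_le_l1_cart)
  also have "\<dots> \<le> (\<Sum>k\<in>(UNIV :: 'n set). e)"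
  proof (rule sum_mono)
    fix k show "\<bar>(y - ?f x0) $ k\<bar> \<le> e" using z[of k] e by (cases "k = k0") (auto simp: y_def)
  qed
  also have "\<dots> < \<delta>" using \<delta>(1) by (simp add: e_def field_simps)
  finally have "y \<in> ball (?f x0) \<delta>" by (simp add: dist_norm norm_minus_commute)
  then obtain x1 where x1: "?f x1 = y" using \<delta>(2) by blast
  note ctx = sym A x0 generic
  let ?F = "fiber a b k0 z"
  have F: "x \<in> ?F \<longleftrightarrow> (\<forall>k. k \<noteq> k0 \<longrightarrow> ?f x $ k = z k)" for x by (simp add: fiber_def[OF ctx])
  have x1F: "x1 \<in> ?F" by (simp add: F x1 y_def)
  let ?S = "{x. \<forall>k. if k = k0 then ?f x $ k \<le> ?f x1 $ k else ?f x $ k = z k}"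
  define c where "c = \<bar>?f x1 $ k0\<bar> + (\<Sum>k\<in>UNIV. \<bar>z k\<bar>)"
  have "compact ?S" unfolding compact_eq_bounded_closed
  proof
    have zc: "\<bar>z k\<bar> \<le> c" for k
      using member_le_sum[of k UNIV "\<lambda>k. \<bar>z k\<bar>"] by (simp add: c_def)
    have x1c: "?f x1 $ k0 \<le> c" unfolding c_def by (intro add_increasing2 sum_nonneg) auto
    have "?S \<subseteq> {x. \<forall>k. if k = k0 then ?f x $ k \<le> c else \<bar>?f x $ k\<bar> \<le> c}"
      using zc x1c by (auto intro: order_trans)
    then show "bounded ?S" by (rule bounded_subset[OF proper])
    have "closed {x. if k = k0 then ?f x $ k \<le> ?f x1 $ k else ?f x $ k = z k}" for k
      by (cases "k = k0")
         (auto intro!: closed_Collect_le closed_Collect_eq continuous_on_component continuous_on_quad_map continuous_on_const)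
    then show "closed ?S" by (intro closed_Collect_all)
  qed
  moreover have "x1 \<in> ?S" using x1F by (simp add: F)
  ultimately obtain xs where xs: "xs \<in> ?S" and mn: "\<And>y. y \<in> ?S \<Longrightarrow> ?f xs $ k0 \<le> ?f y $ k0"
    using continuous_attains_inf[of ?S "\<lambda>x. ?f x $ k0"] continuous_on_component[OF continuous_on_quad_map] by blast
  have xsF: "xs \<in> ?F" using xs by (auto simp: F)
  have mnF: "?f xs $ k0 \<le> ?f y $ k0" if "y \<in> ?F" for y
  proof (cases "?f y $ k0 \<le> ?f x1 $ k0")
    case True
    then show ?thesis using that by (intro mn) (auto simp: F)
  next
    case False
    moreover have "?f xs $ k0 \<le> ?f x1 $ k0" using xs by (auto split: if_splits)
    ultimately show ?thesis by linarith
  qed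
  show ?thesis
  proof (rule that)
    show "\<forall>k l. xs $ k = 0 \<longrightarrow> xs $ l = 0 \<longrightarrow> k = l"
      by (intro allI impI) (rule fiber_one_zero[OF ctx xsF])
    show "\<forall>k \<xi>. xs $ k = 0 \<longrightarrow> \<xi> $ k = 0 \<longrightarrow> quad_jac a b xs *v \<xi> = 0 \<longrightarrow> \<xi> = 0"
      by (intro allI impI) (rule fiber_zero_tangent[OF ctx xsF])
    show "\<forall>\<epsilon>>0. \<exists>x y. x \<noteq> y \<and> dist x xs < \<epsilon> \<and> dist y xs < \<epsilon> \<and> quad_map a b x = quad_map a b y \<and>
      det (quad_jac a b x) \<noteq> 0 \<and> det (quad_jac a b y) \<noteq> 0"
    proof (intro allI impI)
      fix \<epsilon> :: real assume "\<epsilon> > 0"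
      then show "\<exists>x y. x \<noteq> y \<and> dist x xs < \<epsilon> \<and> dist y xs < \<epsilon> \<and> quad_map a b x = quad_map a b y \<and>
        det (quad_jac a b x) \<noteq> 0 \<and> det (quad_jac a b y) \<noteq> 0"
        using fiber_fold[OF ctx cA xsF mnF] by metis
    qed
  qed
qed

section \<open>Length maps on the shared kernel\<close>

text \<open>Reduced echelon form: take a coordinate that is not identically zero on
  \<open>K\<close>, slice \<open>K\<close> by its vanishing, and correct a vector outside the slice
  by the basis of the slice. For the shared kernel, \<open>W\<close> consists of vertices whose
  positions determine a kernel framework.\<close>

lemma subspace_coordinate_dual_basis:
  fixes K :: "(real ^ 'v::finite) set"
  assumes "subspace K"
  shows "\<exists>W c. card W = dim K \<and> (\<forall>w\<in>W. c w \<in> K) \<and> (\<forall>w\<in>W. \<forall>w'\<in>W. c w $ w' = (if w = w' then 1 else 0)) \<and>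
     (\<forall>y\<in>K. y = (\<Sum>w\<in>W. y $ w *\<^sub>R c w))"
  using assms
proof (induction "dim K" arbitrary: K)
  case 0
  then have "K \<subseteq> {0}" by (simp only: dim_eq_0[symmetric])
  then show ?case using 0 by (intro exI[of _ "{}"]) auto
next
  case (Suc n K)
  have "\<not> K \<subseteq> {0}" using Suc.hyps(2) by (metis Zero_not_Suc dim_eq_0)
  then obtain y where "y \<in> K" "y \<noteq> 0" by blast
  then obtain u where y: "y \<in> K" "y $ u \<noteq> 0" by (auto simp: vec_eq_iff)
  define K' where "K' = {x \<in> K. axis u 1 \<bullet> x = 0}"
  have K': "x \<in> K' \<longleftrightarrow> x \<in> K \<and> x $ u = 0" for x by (simp add: K'_def inner_axis')
  have "dim K = dim K' + 1" unfolding K'_def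
    by (rule dim_subspace_Int_hyperplane[OF Suc.prems y(1)]) (simp add: inner_axis' y)
  then have dK': "n = dim K'" using Suc.hyps(2) by simp
  have sK': "subspace K'" using Suc.prems by (auto simp: subspace_def K')
  obtain W c where W: "card W = dim K'" "\<And>w. w \<in> W \<Longrightarrow> c w \<in> K'"
    "\<And>w w'. w \<in> W \<Longrightarrow> w' \<in> W \<Longrightarrow> c w $ w' = (if w = w' then 1 else 0)"
    "\<And>y. y \<in> K' \<Longrightarrow> y = (\<Sum>w\<in>W. y $ w *\<^sub>R c w)"
    using Suc.hyps(1)[OF dK' sK'] by metis
  have u: "u \<notin> W" using W(2,3)[of u] K' by force
  define cu where "cu = (1 / y $ u) *\<^sub>R (y - (\<Sum>w\<in>W. y $ w *\<^sub>R c w))"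
  have cuK: "cu \<in> K" unfolding cu_def
    using W(2) K' y by (intro subspace_scale subspace_diff subspace_sum Suc.prems) auto
  have cuu: "cu $ u = 1" using W(2) K' y by (simp add: cu_def sum_component)
  have cuw: "cu $ w = 0" if "w \<in> W" for w
  proof -
    have "(\<Sum>w'\<in>W. y $ w' * c w' $ w) = (\<Sum>w'\<in>W. if w' = w then y $ w else 0)"
      using that W(3) by (intro sum.cong) auto
    then show ?thesis using that by (simp add: cu_def sum_component)
  qed
  define c' where "c' = c(u := cu)"
  have c'w: "c' w = c w" if "w \<in> W" for w using that u by (auto simp: c'_def)
  show ?case
  proof (intro exI[of _ "insert u W"] exI[of _ c'] conjI ballI)
    show "card (insert u W) = dim K" using u W(1) dK' Suc.hyps(2) by simp
    show "c' w \<in> K" if "w \<in> insert u W" for w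
      using that cuK W(2) K' c'w by (auto simp: c'_def)
    show "c' w $ w' = (if w = w' then 1 else 0)" if ww: "w \<in> insert u W" "w' \<in> insert u W" for w w'
    proof (cases "w = u")
      case True
      then show ?thesis using ww cuu cuw u by (auto simp: c'_def)
    next
      case False
      then have "w \<in> W" using ww by simp
      then show ?thesis using ww W(2)[of w] W(3)[of w w'] K' c'w u False by auto
    qed
    fix x assume x: "x \<in> K"
    have xK': "x - x $ u *\<^sub>R cu \<in> K'"
      using x cuK cuu Suc.prems by (simp add: K' subspace_diff subspace_scale)
    have "x - x $ u *\<^sub>R cu = (\<Sum>w\<in>W. (x - x $ u *\<^sub>R cu) $ w *\<^sub>R c w)" by (rule W(4)[OF xK'])
    also have "\<dots> = (\<Sum>w\<in>W. x $ w *\<^sub>R c' w)" by (rule sum.cong) (simp_all add: cuw c'w)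
    finally show "x = (\<Sum>w\<in>insert u W. x $ w *\<^sub>R c' w)" using u by (simp add: c'_def algebra_simps)
  qed
qed

text \<open>Differentiating a combination of constant vectors changes only its coefficients.\<close>

lemma derive_vec_in_span:
  assumes D: "derivation D" and S: "\<And>s. s \<in> S \<Longrightarrow> derive_vec D s = 0" and x: "x \<in> span S"
  shows "derive_vec D x \<in> span S"
proof -
  have "subspace {x \<in> span S. derive_vec D x \<in> span S}"
    unfolding subspace_def
  proof (intro conjI ballI allI)
    show "0 \<in> {x \<in> span S. derive_vec D x \<in> span S}" by (simp add: derive_vec_0[OF D] span_zero)
    fix x y assume xy: "x \<in> {x \<in> span S. derive_vec D x \<in> span S}" "y \<in> {x \<in> span S. derive_vec D x \<in> span S}"
    have "derive_vec D (x + y) = derive_vec D x + derive_vec D y"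
      by (simp add: derive_vec_def vec_eq_iff derivation_add[OF D])
    then show "x + y \<in> {x \<in> span S. derive_vec D x \<in> span S}" using xy by (simp add: span_add)
    have "derive_vec D (t *\<^sub>R x) = D t *\<^sub>R x + t *\<^sub>R derive_vec D x" for t
      by (simp add: derive_vec_def vec_eq_iff derivation_mult[OF D])
    then show "t *\<^sub>R x \<in> {x \<in> span S. derive_vec D x \<in> span S}" for t using xy by (simp add: span_add span_scale)
  qed
  moreover have "S \<subseteq> {x \<in> span S. derive_vec D x \<in> span S}" using S by (auto simp: span_base span_zero)
  ultimately have "span S \<subseteq> {x \<in> span S. derive_vec D x \<in> span S}" by (intro span_minimal)
  then show ?thesis using x by blast
qed

text \<open>The single vertex \<open>h j\<close> is moved: the earlier vertices stay fixed, so a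
  dependence would place every vector in the span of \<open>j - 1 < d\<close> vectors.\<close>

lemma generic_vertices_independent:
  fixes \<rho> :: "('d::finite, 'v::finite) framework"
  assumes gen: "generic_framework \<rho>" and h: "inj_on h {..j}" and j: "0 < j" "j \<le> CARD('d)"
  shows "\<rho> $ h j - \<rho> $ h 0 \<notin> span ((\<lambda>l. \<rho> $ h l - \<rho> $ h 0) ` {0<..<j})"
proof
  let ?p = "\<lambda>l. \<rho> $ h l - \<rho> $ h 0" and ?V = "span ((\<lambda>l. \<rho> $ h l - \<rho> $ h 0) ` {0<..<j})"
  assume pj: "?p j \<in> ?V"
  have ne: "h l \<noteq> h j" if "l < j" for l using inj_onD[OF h, of l j] that by auto
  have "y \<in> ?V" for y
  proof -
    obtain D where D: "derivation D" "derive_mat D \<rho> = (\<chi> v. if v = h j then y else 0)"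
      using generic_derive_framework[OF gen] by blast
    have Dv: "derive_vec D (\<rho> $ v) = (if v = h j then y else 0)" for v
      using arg_cong[OF D(2), of "\<lambda>A. A $ v"] by (simp add: derive_mat_def)
    have "derive_vec D (?p j) \<in> ?V"
    proof (rule derive_vec_in_span[OF D(1) _ pj])
      fix s assume "s \<in> ?p ` {0<..<j}"
      then obtain l where "l < j" "s = ?p l" by auto
      then show "derive_vec D s = 0" using ne[of l] ne[of 0] j by (simp add: derive_vec_diff[OF D(1)] Dv)
    qed
    moreover have "derive_vec D (?p j) = y" using ne[of 0] j by (simp add: derive_vec_diff[OF D(1)] Dv)
    ultimately show ?thesis by simp
  qed
  then have "?V = UNIV" by blast
  then have "dim (?p ` {0<..<j}) = CARD('d)" by (metis dim_span dim_UNIV DIM_cart DIM_real mult.right_neutral)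
  moreover have "dim (?p ` {0<..<j}) \<le> card (?p ` {0<..<j})" by (rule dim_le_card') simp
  moreover have "card (?p ` {0<..<j}) \<le> card {0<..<j}" by (rule card_image_le) simp
  ultimately show False using j by simp
qed

text \<open>Gram--Schmidt: row \<open>i\<close> of \<open>Q\<close> is a unit vector in the span of \<open>p 1, \<dots>, p (r i + 1)\<close> orthogonal
  to all but the last of them.\<close>

lemma triangular_coordinates:
  fixes p :: "nat \<Rightarrow> real ^ 'd::finite" and r :: "'d \<Rightarrow> nat"
  assumes r: "bij_betw r UNIV {..<CARD('d)}"
    and p: "\<And>j. 0 < j \<Longrightarrow> j \<le> CARD('d) \<Longrightarrow> p j \<notin> span (p ` {0<..<j})"
  obtains Q :: "real ^ 'd ^ 'd" where "orthogonal_matrix Q"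
    "\<And>i j. 0 < j \<Longrightarrow> j \<le> r i \<Longrightarrow> (Q *v p j) $ i = 0" "\<And>i. (Q *v p (Suc (r i))) $ i \<noteq> 0"
proof -
  have rlt: "r i < CARD('d)" for i using r by (auto simp: bij_betw_def)
  have "\<exists>q. q \<in> span (p ` {0<..Suc (r i)}) \<and> norm q = 1 \<and> (\<forall>b\<in>span (p ` {0<..<Suc (r i)}). b \<bullet> q = 0)" for i
  proof -
    have pn: "p (Suc (r i)) \<notin> span (p ` {0<..<Suc (r i)})" using p[of "Suc (r i)"] rlt[of i] by simp
    have "{0<..Suc (r i)} = insert (Suc (r i)) {0<..<Suc (r i)}" by auto
    then have "dim (p ` {0<..Suc (r i)}) = dim (p ` {0<..<Suc (r i)}) + 1"
      using pn by (simp add: dim_insert)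
    then show ?thesis
      using exists_orthogonal_of_dim_less[of "span (p ` {0<..Suc (r i)})" "span (p ` {0<..<Suc (r i)})"]
      by (metis dim_span less_add_one subspace_span)
  qed
  then obtain q where q: "\<And>i. q i \<in> span (p ` {0<..Suc (r i)})" "\<And>i. norm (q i) = 1"
    "\<And>i b. b \<in> span (p ` {0<..<Suc (r i)}) \<Longrightarrow> b \<bullet> q i = 0" by metis
  have lt: "q i \<bullet> q l = 0" if "r i < r l" for i l
  proof (rule q(3))
    show "q i \<in> span (p ` {0<..<Suc (r l)})"
      by (rule subsetD[OF span_mono q(1)]) (use that in auto)
  qed
  have orth: "q i \<bullet> q l = 0" if "i \<noteq> l" for i l
  proof -
    have "r i \<noteq> r l" using r that by (metis bij_betw_def injD)
    then show ?thesis using lt[of i l] lt[of l i] by (metis inner_commute linorder_neqE_nat)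
  qed
  define Q :: "real ^ 'd ^ 'd" where "Q = (\<chi> i. q i)"
  have Qv: "(Q *v y) $ i = q i \<bullet> y" for y i by (simp add: Q_def matrix_vector_mul_component)
  have "Q ** transpose Q = mat 1"
  proof -
    have "(Q ** transpose Q) $ i $ l = q i \<bullet> q l" for i l
      by (simp add: Q_def matrix_matrix_mult_def transpose_def inner_vec_def)
    moreover have "q i \<bullet> q i = 1" for i using q(2)[of i] by (simp add: norm_eq_1)
    ultimately show ?thesis using orth by (auto simp: vec_eq_iff mat_def)
  qed
  then have "orthogonal_matrix Q"
    using matrix_left_right_inverse by (auto simp: orthogonal_matrix)
  moreover have "(Q *v p j) $ i = 0" if "0 < j" "j \<le> r i" for i j
    using that q(3)[of "p j" i] by (simp add: Qv inner_commute span_base)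
  moreover have "(Q *v p (Suc (r i))) $ i \<noteq> 0" for i
  proof
    assume 0: "(Q *v p (Suc (r i))) $ i = 0"
    have "q i \<bullet> q i = 0"
    proof -
      have "p ` {0<..Suc (r i)} \<subseteq> {x. q i \<bullet> x = 0}"
      proof
        fix x assume "x \<in> p ` {0<..Suc (r i)}"
        then obtain j where j: "0 < j" "j \<le> Suc (r i)" "x = p j" by auto
        show "x \<in> {x. q i \<bullet> x = 0}"
        proof (cases "j = Suc (r i)")
          case True
          then show ?thesis using 0 j by (simp add: Qv)
        next
          case False
          then have "x \<in> span (p ` {0<..<Suc (r i)})" using j by (intro span_base) auto
          then show ?thesis using q(3) by (simp add: inner_commute)
        qed
      qed
      then have "span (p ` {0<..Suc (r i)}) \<subseteq> {x. q i \<bullet> x = 0}" by (rule span_minimal[OF _ subspace_hyperplane])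
      then show ?thesis using q(1)[of i] by blast
    qed
    then show False using q(2)[of i] by simp
  qed
  ultimately show ?thesis by (rule that)
qed

text \<open>The Laplacian of a single edge, of rank at most one; its form is the inner product of
  the two edge vectors.\<close>

definition pair_matrix :: "'v \<Rightarrow> 'v \<Rightarrow> real ^ 'v ^ 'v::finite" where
  "pair_matrix u w = (\<chi> i j. (axis u 1 - axis w 1) $ i * (axis u 1 - axis w 1) $ j)"

lemma pair_matrix_mult: "pair_matrix u w *v y = (y $ u - y $ w) *\<^sub>R (axis u 1 - axis w 1)"
proof -
  have "(\<chi> i j. v $ i * v $ j) *v y = (v \<bullet> y) *\<^sub>R v" for v :: "real ^ 'a"
    by (simp add: vec_eq_iff matrix_vector_mult_def inner_vec_def sum_distrib_left mult_ac)
  then have "pair_matrix u w *v y = ((axis u 1 - axis w 1) \<bullet> y) *\<^sub>R (axis u 1 - axis w 1)"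
    unfolding pair_matrix_def .
  then show ?thesis by (simp add: inner_diff_left inner_axis')
qed

lemma pair_matrix_in_edge_matrices:
  assumes "{u, w} \<in> E"
  shows "pair_matrix u w \<in> edge_matrices E"
proof -
  have "pair_matrix u w *v 1 = 0" unfolding pair_matrix_mult by simp
  then have "(\<Sum>j\<in>UNIV. pair_matrix u w $ i $ j) = 0" for i
    by (simp add: vec_eq_iff matrix_vector_mult_def)
  moreover have "pair_matrix u w $ i $ j = 0" if "i \<noteq> j" "{i, j} \<notin> E" for i j
  proof -
    have "{i, j} \<noteq> {u, w}" using that assms by metis
    then show ?thesis using that by (auto simp: pair_matrix_def axis_def)
  qed
  ultimately show ?thesis
    by (auto simp: edge_matrices_def transpose_def vec_eq_iff) (simp add: pair_matrix_def mult.commute)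
qed

lemma stress_form_pair: "stress_form (pair_matrix u w) p q = (p $ u - p $ w) \<bullet> (q $ u - q $ w)"
proof -
  have "x \<bullet> (pair_matrix u w *v y) = (x $ u - x $ w) * (y $ u - y $ w)" for x y
    by (simp add: pair_matrix_mult inner_diff_right inner_axis)
  then have "stress_form (pair_matrix u w) p q
      = (\<Sum>i\<in>UNIV. (coord_vec p i $ u - coord_vec p i $ w) * (coord_vec q i $ u - coord_vec q i $ w))"
    by (simp add: stress_form_def)
  then show ?thesis by (simp add: coord_vec_def inner_vec_def)
qed

lemma stress_form_linear:
  "stress_form (A + B) p q = stress_form A p q + stress_form B p q"
  "stress_form (A - B) p q = stress_form A p q - stress_form B p q"
  "stress_form (t *\<^sub>R A) p q = t * stress_form A p q"
  "stress_form 0 p q = 0"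
  by (simp_all add: stress_form_def matrix_vector_mult_add_rdistrib matrix_vector_mult_diff_rdistrib
      scaleR_matrix_vector_assoc[symmetric] inner_add_right inner_diff_right sum.distrib sum_subtractf sum_distrib_left)

lemma stress_form_linear_left:
  "stress_form A (p + p') q = stress_form A p q + stress_form A p' q"
  "stress_form A (t *\<^sub>R p) q = t * stress_form A p q"
  and stress_form_linear_right:
  "stress_form A q (p + p') = stress_form A q p + stress_form A q p'"
  "stress_form A q (t *\<^sub>R p) = t * stress_form A q p"
  by (simp_all add: stress_form_def inner_add_left inner_add_right sum.distrib sum_distrib_left
      matrix_vector_right_distrib matrix_vector_mult_scaleR)

lemma congruent_imp_same_dist:
  assumes "congruent_frameworks \<rho> \<sigma>"
  shows "dist (\<sigma> $ u) (\<sigma> $ w) = dist (\<rho> $ u) (\<rho> $ w)"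
proof -
  obtain g t where g: "orthogonal_transformation g" "\<And>u. \<sigma> $ u = g (\<rho> $ u) + t"
    using assms by (auto simp: congruent_frameworks_def)
  then show ?thesis by (simp add: dist_norm orthogonal_transformation_norm
        linear_diff[OF orthogonal_transformation_linear[OF g(1)], symmetric])
qed

text \<open>Frameworks with coordinates in the shared kernel are determined by the positions of the
  vertices \<open>h 0, \<dots>, h n\<close>, and \<open>c\<close> is the dual basis. The gauge puts \<open>h 0\<close> at the origin and makes
  the positions of \<open>h 1, \<dots>, h n\<close> lower triangular; \<open>r\<close> numbers the coordinate axes from \<open>0\<close>.\<close>

locale kernel_gauge =
  fixes E :: "'v::finite set set" and \<rho> :: "('d::finite, 'v) framework"
    and c :: "nat \<Rightarrow> real ^ 'v" and h :: "nat \<Rightarrow> 'v" and n :: nat and r :: "'d \<Rightarrow> nat"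
    and Q :: "real ^ 'd ^ 'd"
  assumes gen: "generic_framework \<rho>" and h: "inj_on h {..n}" and n: "CARD('d) < n"
    and r: "bij_betw r UNIV {..<CARD('d)}"
    and cK: "\<And>j. j \<le> n \<Longrightarrow> c j \<in> shared_stress_kernel E \<rho>"
    and ch: "\<And>j l. j \<le> n \<Longrightarrow> l \<le> n \<Longrightarrow> c j $ h l = (if j = l then 1 else 0)"
    and expand: "\<And>y. y \<in> shared_stress_kernel E \<rho> \<Longrightarrow> y = (\<Sum>j\<le>n. y $ h j *\<^sub>R c j)"
    and Q: "orthogonal_matrix Q"
    and Q0: "\<And>i j. 0 < j \<Longrightarrow> j \<le> r i \<Longrightarrow> (Q *v (\<rho> $ h j - \<rho> $ h 0)) $ i = 0"
    and Q1: "\<And>i. (Q *v (\<rho> $ h (Suc (r i)) - \<rho> $ h 0)) $ i \<noteq> 0"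
begin

abbreviation "K \<equiv> shared_stress_kernel E \<rho>"

text \<open>Vertex \<open>h j\<close> uses only the axes numbered below \<open>j\<close>. The vector
  \<open>x\<close> has an entry for every vertex and axis because its index set must be a type; the
  entries outside \<open>idx\<close> are padding.\<close>

definition pos :: "real ^ ('v \<times> 'd) \<Rightarrow> nat \<Rightarrow> 'd \<Rightarrow> real" where
  "pos x j i = (if r i < j then x $ (h j, i) else 0)"

definition place :: "real ^ ('v \<times> 'd) \<Rightarrow> ('d, 'v) framework" where
  "place x = framework_of_coords (\<lambda>i. \<Sum>j\<le>n. pos x j i *\<^sub>R c j)"

definition idx :: "('v \<times> 'd) set" where
  "idx = {(h j, i) | j i. j \<le> n \<and> r i < j}"

definition base :: "real ^ ('v \<times> 'd)" where
  "base = (\<chi> k. (Q *v (\<rho> $ fst k - \<rho> $ h 0)) $ snd k)"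

lemma r_less: "r i < CARD('d)" and r_inj: "r i = r l \<Longrightarrow> i = l"
  and r_surj: "m < CARD('d) \<Longrightarrow> \<exists>i. r i = m"
  using r unfolding bij_betw_def inj_on_def by (auto simp: image_iff set_eq_iff) metis

lemma h_eq: "j \<le> n \<Longrightarrow> l \<le> n \<Longrightarrow> h j = h l \<longleftrightarrow> j = l"
  using h by (auto simp: inj_on_def)

lemma idx_iff: "j \<le> n \<Longrightarrow> (h j, i) \<in> idx \<longleftrightarrow> r i < j"
  unfolding idx_def by (auto simp: h_eq)

lemma idxE:
  assumes "k \<in> idx" obtains j i where "k = (h j, i)" "j \<le> n" "r i < j"
  using assms by (auto simp: idx_def)

lemma pos_0 [simp]: "pos x 0 i = 0"
  by (simp add: pos_def)

lemma pos_linear: "pos (x + y) j i = pos x j i + pos y j i" "pos (t *\<^sub>R x) j i = t * pos x j i"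
  by (simp_all add: pos_def)

lemma linear_place: "linear place"
  by (rule linearI; rule framework_eqI)
     (simp_all add: place_def pos_linear sum.distrib scaleR_sum_right algebra_simps)

lemma coord_place: "coord_vec (place x) i = (\<Sum>j\<le>n. pos x j i *\<^sub>R c j)"
  by (simp add: place_def)

lemma place_K: "place x \<in> kernel_frameworks E \<rho>"
  by (auto simp: kernel_frameworks_def coord_place intro!: subspace_sum subspace_scale subspace_shared_kernel cK)

lemma place_h: "j \<le> n \<Longrightarrow> place x $ h j $ i = pos x j i"
proof -
  assume j: "j \<le> n"
  have "place x $ h j $ i = coord_vec (place x) i $ h j" by (simp add: coord_vec_def)
  also have "\<dots> = (\<Sum>l\<le>n. if l = j then pos x j i else 0)"
    unfolding coord_place sum_component using j by (intro sum.cong) (auto simp: ch)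
  also have "\<dots> = pos x j i" using j by simp
  finally show ?thesis .
qed

lemma place_axis_notin: "k \<notin> idx \<Longrightarrow> place (axis k 1) = 0"
proof -
  assume k: "k \<notin> idx"
  have "pos (axis k 1) j i = 0" if "j \<le> n" for j i
    using k that idx_iff[OF that, of i] by (auto simp: pos_def axis_def)
  then show ?thesis by (intro framework_eqI) (simp add: coord_place)
qed

lemma coord_place_axis:
  assumes "j \<le> n" "r i < j"
  shows "coord_vec (place (axis (h j, i) 1)) l = (if l = i then c j else 0)"
proof -
  have "pos (axis (h j, i) 1) m l = (if l = i \<and> m = j then 1 else 0)" if "m \<le> n" for m
    using assms that by (auto simp: pos_def axis_def h_eq)
  then have "coord_vec (place (axis (h j, i) 1)) l = (\<Sum>m\<le>n. if m = j then (if l = i then c j else 0) else 0)"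
    unfolding coord_place by (intro sum.cong) auto
  then show ?thesis using assms(1) by simp
qed

lemma kernel_coords: "\<eta> \<in> kernel_frameworks E \<rho> \<Longrightarrow> coord_vec \<eta> i = (\<Sum>j\<le>n. \<eta> $ h j $ i *\<^sub>R c j)"
  using expand[of "coord_vec \<eta> i"] by (simp add: kernel_frameworks_def coord_vec_def)

lemma place_base: "place base $ v = Q *v (\<rho> $ v - \<rho> $ h 0)"
proof -
  define \<eta> :: "('d, 'v) framework" where "\<eta> = (\<chi> v. Q *v (\<rho> $ v - \<rho> $ h 0))"
  have "coord_vec \<eta> i \<in> K" for i
  proof -
    have "coord_vec \<eta> i = (\<Sum>l\<in>UNIV. Q $ i $ l *\<^sub>R coord_vec \<rho> l) - ((Q *v (\<rho> $ h 0)) $ i) *\<^sub>R 1"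
      by (simp add: vec_eq_iff coord_vec_def \<eta>_def sum_component matrix_vector_mult_diff_distrib
          matrix_vector_mult_def[of Q "\<rho> $ _"])
    then show ?thesis
      by (auto intro!: subspace_diff subspace_sum subspace_scale subspace_shared_kernel coord_vec_in_kernel one_in_kernel)
  qed
  then have \<eta>: "\<eta> \<in> kernel_frameworks E \<rho>" by (simp add: kernel_frameworks_def)
  have "pos base j i = \<eta> $ h j $ i" if "j \<le> n" for i j
  proof (cases "r i < j")
    case False
    then have "\<eta> $ h j $ i = 0" using Q0[of j i] by (cases "j = 0") (auto simp: \<eta>_def)
    then show ?thesis using False by (simp add: pos_def)
  qed (simp add: pos_def base_def \<eta>_def)
  then have "coord_vec (place base) i = coord_vec \<eta> i" for i
    unfolding coord_place kernel_coords[OF \<eta>] by (intro sum.cong) auto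
  then have "place base = \<eta>" by (rule framework_eqI)
  then show ?thesis by (simp add: \<eta>_def)
qed

lemma pos_base_diag: "pos base (Suc (r i)) i \<noteq> 0"
  using Q1[of i] by (simp add: pos_def base_def)

lemma coord_vec_from_base:
  "coord_vec \<rho> l = (\<Sum>i\<in>UNIV. Q $ i $ l *\<^sub>R coord_vec (place base) i) + (\<rho> $ h 0 $ l) *\<^sub>R 1"
proof -
  have "transpose Q *v (place base $ v) = \<rho> $ v - \<rho> $ h 0" for v
    using Q by (simp add: place_base matrix_vector_mul_assoc orthogonal_matrix)
  then have "(\<Sum>i\<in>UNIV. Q $ i $ l * place base $ v $ i) = \<rho> $ v $ l - \<rho> $ h 0 $ l" for v
    by (simp add: vec_eq_iff matrix_vector_mult_def transpose_def)
  then show ?thesis by (simp add: vec_eq_iff coord_vec_def sum_component)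
qed

text \<open>The components of \<open>\<Omega> (place base)\<close> that the gauge does not see vanish one by one, by rotation
  invariance.\<close>

lemma gauge_flat:
  assumes \<Omega>: "\<Omega> \<in> edge_matrices E" and orth: "\<And>\<xi>. stress_form \<Omega> (place base) (place \<xi>) = 0"
    and pq: "p \<in> kernel_frameworks E \<rho>" "q \<in> kernel_frameworks E \<rho>"
  shows "stress_form \<Omega> p q = 0"
proof -
  let ?P = "coord_vec (place base)"
  \<comment> \<open>Components of \<open>\<Omega> (place base)\<close> against the dual basis. The
    hypothesis kills those with \<open>r i < j\<close>; the identity \<open>sym\<close>, which
    expresses invariance under rotations, ties the remaining ones to them, by descending induction
    on \<open>j\<close>.\<close>
  define \<gamma> where "\<gamma> j i = c j \<bullet> (\<Omega> *v ?P i)" for j i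
  have expand_sum: "y \<bullet> (\<Omega> *v ?P i) = (\<Sum>j\<le>n. y $ h j * \<gamma> j i)" if "y \<in> K" for y i
    by (subst expand[OF that]) (simp add: inner_sum_left \<gamma>_def)
  have tri: "\<gamma> j i = 0" if "j \<le> n" "r i < j" for j i
  proof -
    have "stress_form \<Omega> (place base) (place (axis (h j, i) 1))
        = (\<Sum>l\<in>UNIV. if l = i then c j \<bullet> (\<Omega> *v ?P i) else 0)"
      unfolding stress_form_sym[OF \<Omega>, of "place base"]
      by (simp only: stress_form_def coord_place_axis[OF that]) (intro sum.cong, auto)
    then show ?thesis using orth by (simp add: \<gamma>_def)
  qed
  have sym: "(\<Sum>j\<le>n. pos base j l * \<gamma> j i) = (\<Sum>j\<le>n. pos base j i * \<gamma> j l)" for i l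
  proof -
    have K: "?P i \<in> K" for i using place_K by (simp add: kernel_frameworks_def)
    have "?P l \<bullet> (\<Omega> *v ?P i) = ?P i \<bullet> (\<Omega> *v ?P l)"
      using edge_matrices_inner_sym[OF \<Omega>] by (metis inner_commute)
    moreover have "(\<Sum>j\<le>n. ?P l $ h j * \<gamma> j i) = (\<Sum>j\<le>n. pos base j l * \<gamma> j i)" for i l
      by (rule sum.cong) (simp_all add: coord_vec_def place_h)
    ultimately show ?thesis unfolding expand_sum[OF K] by simp
  qed
  have pos_vanish: "\<gamma> j i = 0" if "0 < j" "j \<le> n" for i j
    using that
  proof (induction "n - j" arbitrary: j rule: less_induct)
    case less
    show ?case
    proof (cases "r i < j")
      case True
      then show ?thesis using tri less.prems by blast
    next
      case False
      then have "j - 1 < CARD('d)" using r_less[of i] less.prems by linarith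
      \<comment> \<open>The axis whose pivot is vertex \<open>j\<close>: on the left of
        \<open>sym\<close> only the term \<open>j\<close> survives, on the right every term has a
        vanishing factor.\<close>
      then obtain l where l: "r l = j - 1" using r_surj by blast
      have "(\<Sum>m\<le>n. pos base m l * \<gamma> m i) = (\<Sum>m\<le>n. if m = j then pos base j l * \<gamma> j i else 0)"
      proof (rule sum.cong[OF refl])
        fix m assume m: "m \<in> {..n}"
        show "pos base m l * \<gamma> m i = (if m = j then pos base j l * \<gamma> j i else 0)"
        proof (cases m j rule: linorder_cases)
          case less
          then show ?thesis using l by (simp add: pos_def)
        next
          case greater
          then have "\<gamma> m i = 0" using m less.prems by (intro less.hyps) auto
          then show ?thesis using greater by simp
        qed simp
      qed
      also have "\<dots> = pos base j l * \<gamma> j i" using less.prems by simp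
      finally have "pos base j l * \<gamma> j i = (\<Sum>m\<le>n. pos base m i * \<gamma> m l)" using sym[of l i] by simp
      also have "\<dots> = 0"
      proof (rule sum.neutral, rule ballI)
        fix m assume "m \<in> {..n}"
        then show "pos base m i * \<gamma> m l = 0"
          using tri[of m l] False l less.prems by (cases "r i < m") (auto simp: pos_def)
      qed
      finally have "pos base j l * \<gamma> j i = 0" .
      moreover have "j = Suc (r l)" using l less.prems by simp
      ultimately show ?thesis using pos_base_diag[of l] by simp
    qed
  qed
  have "\<gamma> j i = 0" if "j \<le> n" for j i
  proof (cases "j = 0")
    case True
    have "1 \<bullet> (\<Omega> *v ?P i) = (\<Omega> *v 1) \<bullet> ?P i" by (rule edge_matrices_inner_sym[OF \<Omega>])
    also have "\<Omega> *v 1 = 0" using \<Omega> by (simp add: edge_matrices_def matrix_vector_mult_def vec_eq_iff)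
    finally have "(\<Sum>j\<le>n. \<gamma> j i) = 0" using expand_sum[OF one_in_kernel, of i] by simp
    moreover have "(\<Sum>j\<le>n. \<gamma> j i) = (\<Sum>j\<le>n. if j = 0 then \<gamma> 0 i else 0)"
      using pos_vanish by (intro sum.cong) auto
    ultimately show ?thesis using True by simp
  next
    case False
    then show ?thesis using pos_vanish that by simp
  qed
  then have P0: "y \<bullet> (\<Omega> *v ?P i) = 0" if "y \<in> K" for y i using expand_sum[OF that, of i] by (simp add: sum.neutral)
  have "y \<bullet> (\<Omega> *v coord_vec \<rho> l) = 0" if "y \<in> K" for y l
  proof -
    have "\<Omega> *v 1 = 0" using \<Omega> by (simp add: edge_matrices_def matrix_vector_mult_def vec_eq_iff)
    then show ?thesis unfolding coord_vec_from_base[of l]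
      by (simp add: matrix_vector_right_distrib matrix_vector_mult_scaleR linear_sum[OF matrix_vector_mul_linear]
          inner_sum_right P0[OF that])
  qed
  then have "x \<bullet> (\<Omega> *v y) = 0" if "x \<in> K" "y \<in> K" for x y
    using stress_form_flat[OF gen \<Omega> _ that] by blast
  then show ?thesis using pq by (simp add: stress_form_def kernel_frameworks_def)
qed

text \<open>Axis by axis. In products with the pivot vertex \<open>h (Suc (r i))\<close> only axis
  \<open>i\<close> contributes: earlier axes vanish by induction, later ones by triangularity. The
  product with its own velocity shows that the pivot vertex does not move, and the cross products
  then stop axis \<open>i\<close> of all other vertices.\<close>

lemma gauge_rigid:
  assumes rigid: "\<And>u w. (place base $ u - place base $ w) \<bullet> (place \<xi> $ u - place \<xi> $ w) = 0" and "k \<in> idx"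
  shows "\<xi> $ k = 0"
proof -
  let ?P = "\<lambda>j. place base $ h j" and ?X = "\<lambda>j. place \<xi> $ h j"
  have h0: "?P 0 = 0" "?X 0 = 0" by (simp_all add: vec_eq_iff place_h)
  have self: "?P j \<bullet> ?X j = 0" for j using rigid[of "h j" "h 0"] h0 by simp
  have cross: "?P j \<bullet> ?X l + ?P l \<bullet> ?X j = 0" for j l
    using rigid[of "h j" "h l"] self[of j] self[of l] by (simp add: inner_diff_left inner_diff_right)
  have "pos \<xi> j i = 0" if "j \<le> n" for i j
    using that
  proof (induction "r i" arbitrary: i j rule: less_induct)
    case less
    let ?s = "Suc (r i)"
    have s: "?s \<le> n" using r_less[of i] n by linarith
    have one: "?P ?s \<bullet> ?X l = pos base ?s i * pos \<xi> l i" if "l \<le> n" for l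
    proof -
      have "?P ?s \<bullet> ?X l = (\<Sum>m\<in>UNIV. if m = i then pos base ?s i * pos \<xi> l i else 0)"
        unfolding inner_vec_def inner_real_def
      proof (rule sum.cong[OF refl])
        fix m
        show "?P ?s $ m * ?X l $ m = (if m = i then pos base ?s i * pos \<xi> l i else 0)"
        proof (cases "r m" "r i" rule: linorder_cases)
          case less
          then show ?thesis using less.hyps[OF less that] that by (auto simp: place_h)
        next
          case equal
          then show ?thesis using r_inj s that by (auto simp: place_h)
        next
          case greater
          then show ?thesis using s by (auto simp: place_h pos_def)
        qed
      qed
      then show ?thesis by simp
    qed
    have s0: "pos \<xi> ?s i = 0" using one[OF s] self[of ?s] pos_base_diag[of i] by simp
    have "?X ?s = 0"
    proof -
      have "pos \<xi> ?s m = 0" for m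
      proof (cases "r m" "r i" rule: linorder_cases)
        case less
        then show ?thesis using less.hyps[OF less s] by simp
      next
        case equal
        then show ?thesis using r_inj s0 by metis
      qed (simp add: pos_def)
      then show ?thesis using s by (simp add: vec_eq_iff place_h)
    qed
    then have "?P ?s \<bullet> ?X j = 0" using cross[of ?s j] by simp
    then show ?case using one[OF less.prems] pos_base_diag[of i] by simp
  qed
  then show ?thesis using assms(2) by (metis idxE pos_def)
qed

end

section \<open>Choice of the quadratic forms and their gradients\<close>

lemma stress_form_sum: "stress_form (sum A I) p q = (\<Sum>i\<in>I. stress_form (A i) p q)"
  by (induction I rule: infinite_finite_induct) (simp_all add: stress_form_linear)

lemma stress_form_sum_left: "stress_form A (sum p I) q = (\<Sum>i\<in>I. stress_form A (p i) q)"
  and stress_form_sum_right: "stress_form A q (sum p I) = (\<Sum>i\<in>I. stress_form A q (p i))"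
proof -
  have z: "stress_form A 0 q = 0" "stress_form A q 0 = 0" by (simp_all add: stress_form_def)
  show "stress_form A (sum p I) q = (\<Sum>i\<in>I. stress_form A (p i) q)"
    by (induction I rule: infinite_finite_induct) (simp_all add: z stress_form_linear_left)
  show "stress_form A q (sum p I) = (\<Sum>i\<in>I. stress_form A q (p i))"
    by (induction I rule: infinite_finite_induct) (simp_all add: z stress_form_linear_right)
qed

text \<open>The sum runs over ordered pairs, so its form is twice the total squared edge length.
  This is the component to be minimized.\<close>

definition graph_laplacian :: "'v::finite set set \<Rightarrow> real ^ 'v ^ 'v" where
  "graph_laplacian E = (\<Sum>(u, w) | {u, w} \<in> E. pair_matrix u w)"

lemma graph_laplacian_in: "graph_laplacian E \<in> edge_matrices E"
  unfolding graph_laplacian_def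
  by (rule subspace_sum[OF subspace_edge_matrices]) (auto intro: pair_matrix_in_edge_matrices)

lemma stress_form_laplacian:
  "stress_form (graph_laplacian E) p p = (\<Sum>(u, w) | {u, w} \<in> E. (norm (p $ u - p $ w))\<^sup>2)"
  unfolding graph_laplacian_def stress_form_sum
  by (rule sum.cong) (auto simp: stress_form_pair power2_norm_eq_inner)

lemma edge_matrices_mono: "E \<subseteq> F \<Longrightarrow> edge_matrices E \<subseteq> edge_matrices F"
  by (auto simp: edge_matrices_def)

definition graph_connected :: "'v set set \<Rightarrow> bool" where
  "graph_connected E \<longleftrightarrow> (\<forall>U. U \<noteq> {} \<longrightarrow> U \<noteq> UNIV \<longrightarrow> (\<exists>u\<in>U. \<exists>w. w \<notin> U \<and> {u, w} \<in> E))"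

context kernel_gauge
begin

definition form :: "real ^ 'v ^ 'v \<Rightarrow> real ^ ('v \<times> 'd) ^ ('v \<times> 'd)" where
  "form \<Omega> = (\<chi> p q. stress_form \<Omega> (place (axis p 1)) (place (axis q 1)))"

text \<open>Half the gradient at \<open>base\<close> of the quadratic form of
  \<open>\<Omega>\<close> in gauge coordinates.\<close>

definition covec :: "real ^ 'v ^ 'v \<Rightarrow> real ^ ('v \<times> 'd)" where
  "covec \<Omega> = form \<Omega> *v base"

definition gauged :: "(real ^ ('v \<times> 'd)) set" where
  "gauged = {x. \<forall>k. k \<notin> idx \<longrightarrow> x $ k = 0}"

lemma form_inner: "x \<bullet> (form \<Omega> *v y) = stress_form \<Omega> (place x) (place y)"
proof -
  have e: "place x = (\<Sum>k\<in>UNIV. x $ k *\<^sub>R place (axis k 1))" for x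
  proof -
    have "x = (\<Sum>k\<in>UNIV. x $ k *\<^sub>R axis k 1)" using basis_expansion[of x] by (simp add: scalar_mult_eq_scaleR)
    then have "place x = place (\<Sum>k\<in>UNIV. x $ k *\<^sub>R axis k 1)" by simp
    then show ?thesis by (simp add: linear_sum[OF linear_place] linear_scale[OF linear_place])
  qed
  have "stress_form \<Omega> (place x) (place y)
      = (\<Sum>i\<in>UNIV. \<Sum>j\<in>UNIV. x $ j * (y $ i * stress_form \<Omega> (place (axis j 1)) (place (axis i 1))))"
    unfolding e[of x] e[of y] stress_form_sum_left stress_form_sum_right
    by (simp add: stress_form_linear_left stress_form_linear_right sum_distrib_left mult_ac)
  also have "\<dots> = x \<bullet> (form \<Omega> *v y)"
    by (subst sum.swap) (simp add: inner_vec_def matrix_vector_mult_def form_def sum_distrib_left mult_ac)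
  finally show ?thesis ..
qed

lemma form_sym: "\<Omega> \<in> edge_matrices F \<Longrightarrow> transpose (form \<Omega>) = form \<Omega>"
  by (simp add: form_def transpose_def vec_eq_iff stress_form_sym)

lemma covec_inner:
  assumes "\<Omega> \<in> edge_matrices F"
  shows "covec \<Omega> \<bullet> \<xi> = stress_form \<Omega> (place base) (place \<xi>)"
  unfolding covec_def inner_symmetric_matrix[OF form_sym[OF assms], symmetric] form_inner ..

lemma covec_linear: "linear covec"
proof (rule linearI)
  have "form (A + B) = form A + form B" for A B by (simp add: form_def vec_eq_iff stress_form_linear)
  then show "covec (A + B) = covec A + covec B" for A B
    by (simp add: covec_def matrix_vector_mult_add_rdistrib)
  have "form (t *\<^sub>R A) = t *\<^sub>R form A" for t A by (simp add: form_def vec_eq_iff stress_form_linear)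
  then show "covec (t *\<^sub>R A) = t *\<^sub>R covec A" for t A
    by (simp add: covec_def scaleR_matrix_vector_assoc)
qed

lemma covec_gauged: "covec \<Omega> \<in> gauged"
proof -
  have "form \<Omega> $ k = 0" if "k \<notin> idx" for k
  proof -
    have "stress_form \<Omega> (place (axis k 1)) q = 0" for q
      unfolding place_axis_notin[OF that] by (simp add: stress_form_def)
    then show ?thesis by (simp only: form_def vec_eq_iff vec_lambda_beta zero_index) simp
  qed
  then show ?thesis by (simp add: gauged_def covec_def matrix_vector_mul_component)
qed

lemma subspace_gauged: "subspace gauged"
  by (auto simp: gauged_def subspace_def)

text \<open>A gauged vector orthogonal to the image would be an infinitesimal motion that preserves
  all distances to first order, and \<open>gauge_rigid\<close> leaves only zero.\<close>

lemma covec_surj: "covec ` edge_matrices UNIV = gauged"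
proof (rule subspace_dim_equal)
  show sV: "subspace (covec ` edge_matrices UNIV)"
    by (rule linear_subspace_image[OF covec_linear subspace_edge_matrices])
  show "subspace gauged" by (rule subspace_gauged)
  show "covec ` edge_matrices UNIV \<subseteq> gauged" using covec_gauged by blast
  show "dim gauged \<le> dim (covec ` edge_matrices UNIV)"
  proof (rule ccontr)
    assume "\<not> ?thesis"
    then obtain x where x: "x \<in> gauged" "norm x = 1" "\<And>b. b \<in> covec ` edge_matrices UNIV \<Longrightarrow> b \<bullet> x = 0"
      using exists_orthogonal_of_dim_less[OF subspace_gauged sV] by (metis not_le)
    have "(place base $ u - place base $ w) \<bullet> (place x $ u - place x $ w) = 0" for u w
    proof -
      have pm: "pair_matrix u w \<in> edge_matrices UNIV" by (rule pair_matrix_in_edge_matrices) simp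
      then have "covec (pair_matrix u w) \<bullet> x = 0" using x(3) by blast
      then show ?thesis by (simp add: covec_inner[OF pm] stress_form_pair)
    qed
    then have "x $ k = 0" if "k \<in> idx" for k using gauge_rigid that by blast
    then have "x $ k = 0" for k using x(1) unfolding gauged_def by blast
    then have "x = 0" by (simp add: vec_eq_iff)
    then show False using x(2) by simp
  qed
qed

lemma laplacian_zero:
  assumes "graph_connected E" and s: "stress_form (graph_laplacian E) (place x) (place x) = 0" and k: "k \<in> idx"
  shows "x $ k = 0"
proof -
  have edge: "place x $ u = place x $ w" if "{u, w} \<in> E" for u w
  proof -
    have "\<forall>e\<in>{(u, w). {u, w} \<in> E}. (case e of (u, w) \<Rightarrow> (norm (place x $ u - place x $ w))\<^sup>2) = 0"
      using s unfolding stress_form_laplacian by (subst (asm) sum_nonneg_eq_0_iff) auto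
    then show ?thesis using that by auto
  qed
  define U where "U = {u. place x $ u = place x $ h 0}"
  have "U = UNIV"
  proof (rule ccontr)
    assume "U \<noteq> UNIV"
    moreover have "U \<noteq> {}" by (auto simp: U_def)
    ultimately obtain u w where "u \<in> U" "w \<notin> U" "{u, w} \<in> E" using assms(1) unfolding graph_connected_def by metis
    then show False using edge by (auto simp: U_def)
  qed
  then have eq: "place x $ v = place x $ h 0" for v by (auto simp: U_def)
  obtain j i where ji: "k = (h j, i)" "j \<le> n" "r i < j" using k by (rule idxE)
  have "pos x j i = pos x 0 i" using eq[of "h j"] place_h[OF ji(2), of x i] place_h[of 0 x i] by simp
  then show ?thesis using ji by (simp add: pos_def)
qed

text \<open>Compactness of the unit sphere. The form is positive because on a connected graph zero
  energy moves every vertex to the position of \<open>h 0\<close>, the origin.\<close>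

lemma laplacian_bound:
  assumes "graph_connected E"
  obtains \<mu> where "\<mu> > 0" "\<And>x. x \<in> gauged \<Longrightarrow> \<mu> * (norm x)\<^sup>2 \<le> stress_form (graph_laplacian E) (place x) (place x)"
proof -
  let ?s = "\<lambda>x. stress_form (graph_laplacian E) (place x) (place x)"
  let ?S = "sphere 0 1 \<inter> gauged"
  have cont: "continuous_on ?S ?s" unfolding form_inner[symmetric]
    by (intro continuous_intros linear_continuous_on matrix_vector_mul_bounded_linear)
  have pos: "?s x > 0" if "x \<in> ?S" for x
  proof -
    have "?s x \<ge> 0" unfolding stress_form_laplacian by (rule sum_nonneg) auto
    moreover have "?s x \<noteq> 0"
    proof
      assume "?s x = 0"
      then have "x $ k = 0" for k using laplacian_zero[OF assms] that unfolding gauged_def by blast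
      then have "x = 0" by (simp add: vec_eq_iff)
      then show False using that by simp
    qed
    ultimately show ?thesis by simp
  qed
  have "compact ?S" by (intro compact_Int_closed compact_sphere closed_subspace subspace_gauged)
  have "\<exists>\<mu>>0. \<forall>x\<in>?S. \<mu> \<le> ?s x"
  proof (cases "?S = {}")
    case True
    then show ?thesis by (intro exI[of _ 1]) auto
  next
    case False
    then obtain y where "y \<in> ?S" "\<forall>x\<in>?S. ?s y \<le> ?s x"
      using continuous_attains_inf[OF \<open>compact ?S\<close> _ cont] by blast
    then show ?thesis using pos by blast
  qed
  then obtain \<mu> where \<mu>: "\<mu> > 0" "\<And>x. x \<in> ?S \<Longrightarrow> \<mu> \<le> ?s x" by blast
  have "\<mu> * (norm x)\<^sup>2 \<le> ?s x" if "x \<in> gauged" for x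
  proof (cases "x = 0")
    case True
    then show ?thesis by (simp add: stress_form_laplacian linear_0[OF linear_place])
  next
    case False
    define y where "y = (1 / norm x) *\<^sub>R x"
    have "y \<in> ?S" using False that by (simp add: y_def subspace_scale[OF subspace_gauged])
    moreover have "x = norm x *\<^sub>R y" using False by (simp add: y_def)
    then have "?s x = (norm x)\<^sup>2 * ?s y"
      by (metis (no_types, lifting) linear_scale[OF linear_place] stress_form_linear_left(2) stress_form_linear_right(2)
          power2_eq_square mult.assoc)
    ultimately show ?thesis using mult_left_mono[OF \<mu>(2)[of y], of "(norm x)\<^sup>2"] by (simp add: mult.commute)
  qed
  then show ?thesis using that \<mu>(1) by blast
qed

text \<open>A square map needs as many forms as there are free entries. A basis of gradients starts
  with the Laplacian, is extended within the matrices of \<open>E\<close>, and is completed by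
  matrices on arbitrary pairs. The last ones only make the Jacobian invertible; the gradients coming
  from \<open>E\<close> span those of all edge lengths.\<close>

lemma quadratic_basis:
  assumes conn: "graph_connected E"
  obtains M k0 where "k0 \<in> idx" "M k0 = graph_laplacian E" "\<forall>k\<in>idx. M k \<in> edge_matrices UNIV"
    "\<forall>\<xi>\<in>gauged. (\<forall>k\<in>idx. covec (M k) \<bullet> \<xi> = 0) \<longrightarrow> \<xi> = 0"
    "\<forall>\<Omega>\<in>edge_matrices E. \<exists>\<Omega>'\<in>span (M ` idx \<inter> edge_matrices E). covec \<Omega> = covec \<Omega>'"
proof -
  let ?L = "graph_laplacian E"
  have EU: "edge_matrices E \<subseteq> edge_matrices UNIV" by (rule edge_matrices_mono) simp
  have "covec ?L \<noteq> 0"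
  proof
    assume "covec ?L = 0"
    then have "stress_form ?L (place base) (place base) = 0" using covec_inner[OF graph_laplacian_in, of E base] by simp
    then have b0: "base $ k = 0" if "k \<in> idx" for k using laplacian_zero[OF conn _ that] by blast
    obtain i where i: "i \<in> (UNIV :: 'd set)" by blast
    have "Suc (r i) \<le> n" using r_less[of i] n by linarith
    then have "(h (Suc (r i)), i) \<in> idx" by (simp add: idx_iff)
    then show False using b0 pos_base_diag[of i] by (simp add: pos_def)
  qed
  then have ind1: "independent {covec ?L}" by simp
  have sub1: "{covec ?L} \<subseteq> covec ` edge_matrices E" using imageI[OF graph_laplacian_in, of covec E] by simp
  obtain B1 where B1: "{covec ?L} \<subseteq> B1" "B1 \<subseteq> covec ` edge_matrices E" "independent B1"
    "covec ` edge_matrices E \<subseteq> span B1"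
    by (rule maximal_independent_subset_extend[OF sub1 ind1])
  have sub2: "B1 \<subseteq> gauged" using B1(2) covec_gauged by blast
  obtain B2 where B2: "B1 \<subseteq> B2" "B2 \<subseteq> gauged" "independent B2" "gauged \<subseteq> span B2"
    by (rule maximal_independent_subset_extend[OF sub2 B1(3)])
  have "card B2 = dim gauged" by (rule basis_card_eq_dim[OF B2(2,4,3)])
  also have "dim gauged = card idx" unfolding gauged_def dim_vec_eq[symmetric] by (rule dim_substandard_cart)
  finally have "card idx = card B2" by simp
  then obtain \<beta> where \<beta>: "bij_betw \<beta> idx B2"
    using finite_same_card_bij[of idx B2] independent_imp_finite[OF B2(3)] by auto
  have "\<forall>\<theta>\<in>B2. \<exists>\<Omega>. \<Omega> \<in> edge_matrices UNIV \<and> covec \<Omega> = \<theta> \<and> (\<theta> \<in> B1 \<longrightarrow> \<Omega> \<in> edge_matrices E) \<and> (\<theta> = covec ?L \<longrightarrow> \<Omega> = ?L)"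
  proof
    fix \<theta> assume \<theta>: "\<theta> \<in> B2"
    show "\<exists>\<Omega>. \<Omega> \<in> edge_matrices UNIV \<and> covec \<Omega> = \<theta> \<and> (\<theta> \<in> B1 \<longrightarrow> \<Omega> \<in> edge_matrices E) \<and> (\<theta> = covec ?L \<longrightarrow> \<Omega> = ?L)"
    proof (cases "\<theta> = covec ?L")
      case True
      then show ?thesis using graph_laplacian_in EU by blast
    next
      case F: False
      show ?thesis
      proof (cases "\<theta> \<in> B1")
        case True
        then obtain \<Omega> where "\<Omega> \<in> edge_matrices E" "covec \<Omega> = \<theta>" using B1(2) by blast
        then show ?thesis using F EU by blast
      next
        case False
        have "\<theta> \<in> covec ` edge_matrices UNIV" using \<theta> B2(2) covec_surj by blast
        then show ?thesis using F False by blast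
      qed
    qed
  qed
  then obtain G where G: "\<And>\<theta>. \<theta> \<in> B2 \<Longrightarrow> G \<theta> \<in> edge_matrices UNIV" "\<And>\<theta>. \<theta> \<in> B2 \<Longrightarrow> covec (G \<theta>) = \<theta>"
    "\<And>\<theta>. \<theta> \<in> B2 \<Longrightarrow> \<theta> \<in> B1 \<Longrightarrow> G \<theta> \<in> edge_matrices E" "\<And>\<theta>. \<theta> \<in> B2 \<Longrightarrow> \<theta> = covec ?L \<Longrightarrow> G \<theta> = ?L" by metis
  define M where "M k = G (\<beta> k)" for k
  have \<beta>2: "\<beta> k \<in> B2" if "k \<in> idx" for k using \<beta> that by (auto simp: bij_betw_def)
  have onto: "\<exists>k\<in>idx. \<beta> k = \<theta>" if "\<theta> \<in> B2" for \<theta> using \<beta> that by (metis bij_betw_imp_surj_on imageE)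
  obtain k0 where k0: "k0 \<in> idx" "\<beta> k0 = covec ?L" using onto B1(1) B2(1) by blast
  show ?thesis
  proof (rule that)
    show "k0 \<in> idx" by fact
    show "M k0 = ?L" using G(4)[OF \<beta>2[OF k0(1)] k0(2)] by (simp add: M_def)
    show "\<forall>k\<in>idx. M k \<in> edge_matrices UNIV" using G(1)[OF \<beta>2] by (simp add: M_def)
    show "\<forall>\<xi>\<in>gauged. (\<forall>k\<in>idx. covec (M k) \<bullet> \<xi> = 0) \<longrightarrow> \<xi> = 0"
    proof (intro ballI impI)
      fix \<xi> assume \<xi>: "\<xi> \<in> gauged" "\<forall>k\<in>idx. covec (M k) \<bullet> \<xi> = 0"
      have "\<theta> \<bullet> \<xi> = 0" if \<theta>: "\<theta> \<in> B2" for \<theta>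
      proof -
        obtain k where "k \<in> idx" "\<beta> k = \<theta>" using onto[OF \<theta>] by blast
        then show ?thesis using \<xi>(2) G(2)[OF \<theta>] by (auto simp: M_def)
      qed
      then have "B2 \<subseteq> {x. \<xi> \<bullet> x = 0}" by (auto simp: inner_commute)
      then have "span B2 \<subseteq> {x. \<xi> \<bullet> x = 0}" by (rule span_minimal[OF _ subspace_hyperplane])
      then have "\<xi> \<bullet> \<xi> = 0" using \<xi>(1) B2(4) by blast
      then show "\<xi> = 0" by simp
    qed
    show "\<forall>\<Omega>\<in>edge_matrices E. \<exists>\<Omega>'\<in>span (M ` idx \<inter> edge_matrices E). covec \<Omega> = covec \<Omega>'"
    proof
      fix \<Omega> assume "\<Omega> \<in> edge_matrices E"
      then have "covec \<Omega> \<in> span B1" using B1(4) by blast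
      also have "B1 = covec ` (G ` B1)" using G(2) B2(1) by (force simp: image_image)
      also have "span \<dots> = covec ` span (G ` B1)" by (rule linear_span_image[OF covec_linear])
      finally obtain \<Omega>' where \<Omega>': "\<Omega>' \<in> span (G ` B1)" "covec \<Omega> = covec \<Omega>'" by blast
      have "G ` B1 \<subseteq> M ` idx \<inter> edge_matrices E"
      proof
        fix A assume "A \<in> G ` B1"
        then obtain \<theta> where \<theta>: "\<theta> \<in> B1" "A = G \<theta>" by blast
        then have t2: "\<theta> \<in> B2" using B2(1) by blast
        then obtain k where "k \<in> idx" "\<beta> k = \<theta>" using onto by blast
        then show "A \<in> M ` idx \<inter> edge_matrices E" using \<theta> G(3)[OF t2 \<theta>(1)] by (auto simp: M_def)
      qed
      then show "\<exists>\<Omega>'\<in>span (M ` idx \<inter> edge_matrices E). covec \<Omega> = covec \<Omega>'"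
        using \<Omega>' span_mono by blast
    qed
  qed
qed

end

lemma continuous_on_stress_form: "continuous_on S (\<lambda>\<sigma>. stress_form A \<sigma> \<sigma>)"
  unfolding stress_form_def coord_vec_def matrix_vector_mult_def
  by (intro continuous_intros)

context kernel_gauge
begin

text \<open>The Laplacian of an edge differs from a combination of the chosen forms by a matrix with
  gradient zero at \<open>base\<close>, and \<open>gauge_flat\<close> makes such a matrix vanish on
  all kernel frameworks.\<close>

lemma same_lengths_of_forms:
  assumes M: "\<And>\<Omega>. \<Omega> \<in> edge_matrices E \<Longrightarrow> \<exists>\<Omega>'\<in>span (M ` idx \<inter> edge_matrices E). covec \<Omega> = covec \<Omega>'"
    and K: "\<sigma> \<in> kernel_frameworks E \<rho>" "\<tau> \<in> kernel_frameworks E \<rho>"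
    and eq: "\<And>k. k \<in> idx \<Longrightarrow> stress_form (M k) \<sigma> \<sigma> = stress_form (M k) \<tau> \<tau>"
  shows "same_edge_lengths E \<sigma> \<tau>"
  unfolding same_edge_lengths_def
proof (intro allI impI)
  fix u w assume uw: "{u, w} \<in> E"
  define V where "V = {A \<in> edge_matrices E. stress_form A \<sigma> \<sigma> = stress_form A \<tau> \<tau>}"
  have "subspace V"
    using subspace_edge_matrices[of E] by (auto simp: V_def subspace_def stress_form_linear)
  moreover have "M ` idx \<inter> edge_matrices E \<subseteq> V" using eq by (auto simp: V_def)
  ultimately have sub: "span (M ` idx \<inter> edge_matrices E) \<subseteq> V" by (intro span_minimal)
  let ?A = "pair_matrix u w"
  have A: "?A \<in> edge_matrices E" by (rule pair_matrix_in_edge_matrices[OF uw])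
  obtain B where B: "B \<in> V" "covec ?A = covec B" using M[OF A] sub by blast
  have BE: "B \<in> edge_matrices E" using B(1) by (simp add: V_def)
  have AB: "?A - B \<in> edge_matrices E" by (rule subspace_diff[OF subspace_edge_matrices A BE])
  have "stress_form (?A - B) (place base) (place \<xi>) = 0" for \<xi>
    using B(2) by (simp add: covec_inner[OF AB, symmetric] linear_diff[OF covec_linear])
  then have "stress_form (?A - B) p p = 0" if "p \<in> kernel_frameworks E \<rho>" for p
    using gauge_flat[OF AB _ that that] by blast
  then have "stress_form ?A \<sigma> \<sigma> = stress_form ?A \<tau> \<tau>" using K B(1) by (simp add: stress_form_linear V_def)
  then show "dist (\<tau> $ u) (\<tau> $ w) = dist (\<sigma> $ u) (\<sigma> $ w)"
    by (simp add: stress_form_pair dist_norm norm_eq)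
qed

lemma place_restrict: "place (\<chi> k. if k \<in> idx then x $ k else 0) = place x"
  by (rule framework_eqI) (auto simp: coord_place pos_def idx_iff intro!: sum.cong)

text \<open>The infinitesimal rotation in the plane of two consecutive axes. It would leave the
  triangular shape only at vertex \<open>h (Suc (r i))\<close> in axis \<open>l\<close>, by the very
  entry assumed to be zero.\<close>

lemma place_rotation:
  assumes il: "r l = Suc (r i)" and zero: "x $ (h (Suc (r i)), i) = 0"
  obtains \<xi> where "\<xi> \<in> gauged" "\<forall>j\<le>n. \<forall>m.
      pos \<xi> j m = (if m = i then - pos x j l else if m = l then pos x j i else 0)"
    "\<forall>\<Omega>\<in>edge_matrices UNIV. stress_form \<Omega> (place x) (place \<xi>) = 0"
proof -
  have li: "l \<noteq> i" using il by auto
  define f where "f j m = (if m = i then - pos x j l else if m = l then pos x j i else 0)" for j m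
  define \<xi> :: "real ^ ('v \<times> 'd)" where "\<xi> = (\<chi> k. if k \<in> idx then f (the_inv_into {..n} h (fst k)) (snd k) else 0)"
  have pos\<xi>: "pos \<xi> j m = f j m" if j: "j \<le> n" for j m
  proof (cases "r m < j")
    case True
    then show ?thesis using j h by (simp add: pos_def \<xi>_def idx_iff the_inv_into_f_f)
  next
    case False
    have "pos x j l = 0" if "m = i" using False that il by (simp add: pos_def)
    moreover have "pos x j i = 0" if "m = l"
    proof (cases "j = Suc (r i)")
      case True
      then show ?thesis using zero by (simp add: pos_def)
    next
      case F: False
      then show ?thesis using False that il by (simp add: pos_def)
    qed
    ultimately show ?thesis using False by (auto simp: pos_def f_def)
  qed
  have coord: "coord_vec (place \<xi>) m = (if m = i then - coord_vec (place x) l else if m = l then coord_vec (place x) i else 0)" for m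
    using li unfolding coord_place by (auto simp: pos\<xi> f_def sum_negf[symmetric] intro!: sum.cong sum.neutral)
  show ?thesis
  proof (rule that[of \<xi>])
    show "\<xi> \<in> gauged" by (simp add: gauged_def \<xi>_def)
    show "\<forall>j\<le>n. \<forall>m. pos \<xi> j m = (if m = i then - pos x j l else if m = l then pos x j i else 0)"
      using pos\<xi> by (simp add: f_def)
    show "\<forall>\<Omega>\<in>edge_matrices UNIV. stress_form \<Omega> (place x) (place \<xi>) = 0"
    proof
      fix \<Omega> :: "real ^ 'v ^ 'v" assume \<Omega>: "\<Omega> \<in> edge_matrices UNIV"
      let ?c = "coord_vec (place x)"
      have "stress_form \<Omega> (place x) (place \<xi>) = (\<Sum>m\<in>UNIV. (if m = i then - (?c i \<bullet> (\<Omega> *v ?c l)) else 0)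
          + (if m = l then ?c l \<bullet> (\<Omega> *v ?c i) else 0))"
        unfolding stress_form_def coord using li
        by (intro sum.cong) (auto simp: linear_neg[OF matrix_vector_mul_linear])
      also have "\<dots> = - (?c i \<bullet> (\<Omega> *v ?c l)) + ?c l \<bullet> (\<Omega> *v ?c i)" by (simp add: sum.distrib)
      also have "\<dots> = 0" using edge_matrices_inner_sym[OF \<Omega>, of "?c l" "?c i"] by (simp add: inner_commute)
      finally show "stress_form \<Omega> (place x) (place \<xi>) = 0" .
    qed
  qed
qed

lemma not_generically_globally_rigid:
  assumes conn: "graph_connected E"
    and rigid: "\<And>\<sigma> :: ('d, 'v) framework. generic_framework \<sigma> \<Longrightarrow> globally_rigid E \<sigma>"
  shows False
proof -
  let ?L = "graph_laplacian E"
  obtain M k0 where k0: "k0 \<in> idx" "M k0 = ?L" and M': "\<forall>k\<in>idx. M k \<in> edge_matrices UNIV"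
    and nondeg: "\<forall>\<xi>\<in>gauged. (\<forall>k\<in>idx. covec (M k) \<bullet> \<xi> = 0) \<longrightarrow> \<xi> = 0"
    and ME: "\<forall>\<Omega>\<in>edge_matrices E. \<exists>\<Omega>'\<in>span (M ` idx \<inter> edge_matrices E). covec \<Omega> = covec \<Omega>'"
    by (rule quadratic_basis[OF conn], rule that)
  note M = M'[rule_format]
  \<comment> \<open>Entries outside \<open>idx\<close> are mapped to themselves, which makes the map
    square and keeps it proper.\<close>
  define a where "a k = (if k \<in> idx then form (M k) else 0)" for k
  define b :: "'v \<times> 'd \<Rightarrow> real ^ ('v \<times> 'd)" where "b k = (if k \<in> idx then 0 else axis k 1)" for k
  let ?f = "quad_map a b" and ?J = "quad_jac a b"
  have sym: "transpose (a k) = a k" for k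
  proof (cases "k \<in> idx")
    case True
    then show ?thesis using form_sym[OF M] by (simp add: a_def)
  qed (simp add: a_def transpose_def vec_eq_iff)
  have fval: "?f x $ k = (if k \<in> idx then stress_form (M k) (place x) (place x) else x $ k)" for x k
    by (simp add: quad_map_def a_def b_def form_inner inner_axis')
  have jval: "(?J x *v \<xi>) $ k = (if k \<in> idx then 2 * stress_form (M k) (place x) (place \<xi>) else \<xi> $ k)" for x \<xi> k
  proof (cases "k \<in> idx")
    case True
    then show ?thesis using inner_symmetric_matrix[OF form_sym[OF M[OF True]], of x \<xi>]
      by (simp add: quad_jac_mult a_def b_def form_inner)
  qed (simp add: quad_jac_mult a_def b_def inner_axis')
  have det: "det (?J base) \<noteq> 0" unfolding det_nonzero_iff
  proof (intro allI impI)
    fix \<xi> assume 0: "?J base *v \<xi> = 0"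
    then have J0: "(?J base *v \<xi>) $ k = 0" for k by simp
    show "\<xi> = 0"
    proof (rule nondeg[rule_format])
      have "\<xi> $ k = 0" if "k \<notin> idx" for k using J0[of k] that unfolding jval by simp
      then show "\<xi> \<in> gauged" unfolding gauged_def by blast
      show "covec (M k) \<bullet> \<xi> = 0" if "k \<in> idx" for k
        using J0[of k] that unfolding jval covec_inner[OF M[OF that]] by simp
    qed
  qed
  obtain \<mu> where \<mu>: "\<mu> > 0" "\<And>x. x \<in> gauged \<Longrightarrow> \<mu> * (norm x)\<^sup>2 \<le> stress_form ?L (place x) (place x)"
    using laplacian_bound[OF conn] by blast
  have proper: "bounded {x. \<forall>k. if k = k0 then ?f x $ k \<le> c else \<bar>?f x $ k\<bar> \<le> c}" for c
  proof (rule boundedI)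
    fix x assume "x \<in> {x. \<forall>k. if k = k0 then ?f x $ k \<le> c else \<bar>?f x $ k\<bar> \<le> c}"
    then have x: "if k = k0 then ?f x $ k \<le> c else \<bar>?f x $ k\<bar> \<le> c" for k by blast
    define C where "C = 1 + \<bar>c / \<mu>\<bar> + \<bar>c\<bar>"
    define g where "g = (\<chi> k. if k \<in> idx then x $ k else 0)"
    have "g \<in> gauged" by (simp add: g_def gauged_def)
    then have "\<mu> * (norm g)\<^sup>2 \<le> stress_form ?L (place g) (place g)" by (rule \<mu>(2))
    also have "\<dots> \<le> c" using x[of k0] k0 unfolding g_def place_restrict by (simp add: fval)
    finally have "(norm g)\<^sup>2 \<le> c / \<mu>" using \<mu>(1) by (simp add: field_simps)
    moreover have "norm g \<le> 1 + (norm g)\<^sup>2"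
    proof -
      have "0 \<le> (norm g - 1)\<^sup>2 + norm g" by simp
      then show ?thesis using norm_ge_zero[of g] unfolding power2_diff by simp
    qed
    ultimately have gC: "norm g \<le> C" using abs_ge_self[of "c / \<mu>"] abs_ge_zero[of c] unfolding C_def by linarith
    have "\<bar>x $ k\<bar> \<le> C" for k
    proof (cases "k \<in> idx")
      case True
      then have "\<bar>x $ k\<bar> = \<bar>g $ k\<bar>" by (simp add: g_def)
      also have "\<dots> \<le> norm g" by (rule component_le_norm_cart)
      finally show ?thesis using gC by simp
    next
      case False
      moreover from this have "k \<noteq> k0" using k0(1) by blast
      ultimately have "\<bar>x $ k\<bar> \<le> c" using x[of k] by (simp add: fval)
      then show ?thesis using abs_ge_zero[of "c / \<mu>"] unfolding C_def by linarith
    qed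
    then have "(\<Sum>k\<in>UNIV. \<bar>x $ k\<bar>) \<le> (\<Sum>k\<in>(UNIV :: ('v \<times> 'd) set). C)" by (intro sum_mono)
    then show "norm x \<le> (\<Sum>k\<in>(UNIV :: ('v \<times> 'd) set). C)" using norm_le_l1_cart[of x] by linarith
  qed
  obtain xs where xs: "\<forall>k l. xs $ k = 0 \<longrightarrow> xs $ l = 0 \<longrightarrow> k = l"
    "\<forall>k \<xi>. xs $ k = 0 \<longrightarrow> \<xi> $ k = 0 \<longrightarrow> ?J xs *v \<xi> = 0 \<longrightarrow> \<xi> = 0"
    "\<forall>\<epsilon>>0. \<exists>x y. x \<noteq> y \<and> dist x xs < \<epsilon> \<and> dist y xs < \<epsilon> \<and> ?f x = ?f y \<and>
      det (?J x) \<noteq> 0 \<and> det (?J y) \<noteq> 0"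
    by (rule quadratic_map_fold[OF sym det proper], rule that)
  note one_zero = xs(1)[rule_format] and tangent = xs(2)[rule_format] and fold = xs(3)[rule_format]
  \<comment> \<open>A zero pivot would put the rotation of the axes \<open>i\<close> and
    \<open>l\<close> into the gauge. It lies in the kernel of the Jacobian and vanishes at the zero
    entry itself, so it is zero; this forces a second zero entry in axis \<open>i\<close>.\<close>
  have diag: "xs $ (h (Suc (r i)), i) \<noteq> 0" if ri: "Suc (r i) < CARD('d)" for i
  proof
    assume zero: "xs $ (h (Suc (r i)), i) = 0"
    obtain l where l: "r l = Suc (r i)" using r_surj[OF ri] by blast
    have li: "l \<noteq> i" using l by auto
    obtain \<xi> where \<xi>': "\<xi> \<in> gauged" "\<forall>j\<le>n. \<forall>m.
        pos \<xi> j m = (if m = i then - pos xs j l else if m = l then pos xs j i else 0)"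
      "\<forall>\<Omega>\<in>edge_matrices UNIV. stress_form \<Omega> (place xs) (place \<xi>) = 0"
      by (rule place_rotation[OF l zero], rule that)
    note \<xi> = \<xi>'(1) \<xi>'(2)[rule_format] \<xi>'(3)[rule_format]
    have "(?J xs *v \<xi>) $ k = 0" for k
    proof (cases "k \<in> idx")
      case True
      then show ?thesis using \<xi>(3)[OF M[OF True]] by (simp add: jval)
    next
      case False
      then have "\<xi> $ k = 0" using \<xi>(1) unfolding gauged_def by blast
      then show ?thesis using False by (simp add: jval)
    qed
    then have J0: "?J xs *v \<xi> = 0" by (simp add: vec_eq_iff)
    have s1: "Suc (r i) \<le> n" and s2: "Suc (Suc (r i)) \<le> n" using ri n by linarith+
    have "\<xi> $ (h (Suc (r i)), i) = 0" using \<xi>(2)[OF s1, of i] l by (simp add: pos_def)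
    then have "\<xi> = 0" using tangent[OF zero _ J0] by blast
    then have "pos xs (Suc (Suc (r i))) i = 0"
      using \<xi>(2)[OF s2, of l] li by (simp add: pos_def split: if_splits)
    then have "xs $ (h (Suc (Suc (r i))), i) = 0" by (simp add: pos_def)
    from one_zero[OF this zero] show False using s1 s2 by (simp add: h_eq)
  qed
  \<comment> \<open>The last axis has no later axis to rotate with. Since \<open>d < n\<close> it
    has free entries at both \<open>h d\<close> and \<open>h (d + 1)\<close>, and these are not both
    zero.\<close>
  have pivot: "\<exists>j\<le>n. r i < j \<and> xs $ (h j, i) \<noteq> 0 \<and> (\<forall>l. r i < r l \<longrightarrow> j \<le> r l)" for i
  proof (cases "Suc (r i) < CARD('d)")
    case True
    then show ?thesis using diag n by (intro exI[of _ "Suc (r i)"]) auto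
  next
    case False
    then have ri: "Suc (r i) = CARD('d)" using r_less[of i] by simp
    have "(h (Suc (r i)), i) \<noteq> (h (Suc (Suc (r i))), i)" using n ri by (simp add: h_eq)
    then obtain j where "j = Suc (r i) \<or> j = Suc (Suc (r i))" "xs $ (h j, i) \<noteq> 0" using one_zero by metis
    moreover have "\<not> r i < r l" for l using r_less[of l] ri by simp
    ultimately show ?thesis using n ri by (intro exI[of _ j]) auto
  qed
  \<comment> \<open>Points closer to \<open>xs\<close> than \<open>\<epsilon>\<close> keep the signs
    of its nonzero entries, which excludes mirror images; the inserted \<open>1\<close> keeps
    \<open>Z\<close> nonempty.\<close>
  define Z where "Z = insert 1 ((\<lambda>k. \<bar>xs $ k\<bar>) ` {k. xs $ k \<noteq> 0})"
  define \<epsilon> where "\<epsilon> = Min Z"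
  have finZ: "finite Z" "Z \<noteq> {}" by (simp_all add: Z_def)
  have \<epsilon>0: "\<epsilon> > 0" unfolding \<epsilon>_def using finZ by (subst Min_gr_iff) (auto simp: Z_def)
  have \<epsilon>: "\<epsilon> \<le> \<bar>xs $ k\<bar>" if "xs $ k \<noteq> 0" for k
    unfolding \<epsilon>_def using finZ that by (intro Min_le) (auto simp: Z_def)
  obtain x y where xy: "x \<noteq> y" "dist x xs < \<epsilon>" "dist y xs < \<epsilon>" "?f x = ?f y" "det (?J y) \<noteq> 0"
    using fold[OF \<epsilon>0] by blast
  have near: "\<bar>w $ k - xs $ k\<bar> < \<bar>xs $ k\<bar>" if "dist w xs < \<epsilon>" "xs $ k \<noteq> 0" for w k
    using component_le_norm_cart[of "w - xs" k] that \<epsilon>[OF that(2)] by (simp add: dist_norm)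
  have sign: "x $ k * y $ k > 0" if "xs $ k \<noteq> 0" for k
    using near[OF xy(2) that] near[OF xy(3) that] that
    by (cases "xs $ k > 0") (auto intro: mult_pos_pos mult_neg_neg)
  \<comment> \<open>If a distance differed, a generic kernel framework \<open>\<sigma>\<close> near
    \<open>place x\<close> would have a partner \<open>place y'\<close> near \<open>place y\<close>
    with the same edge lengths, because the map is open at the regular point \<open>y\<close>.
    Rigidity makes the two congruent, against the gap of \<open>2 \<delta>\<close>.\<close>
  have dist_eq: "dist (place x $ u) (place x $ w) = dist (place y $ u) (place y $ w)" for u w
  proof (rule ccontr)
    define g :: "('d, 'v) framework \<Rightarrow> real" where "g \<sigma> = dist (\<sigma> $ u) (\<sigma> $ w)" for \<sigma>
    assume ne: "dist (place x $ u) (place x $ w) \<noteq> dist (place y $ u) (place y $ w)"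
    define \<delta> where "\<delta> = dist (g (place x)) (g (place y)) / 2"
    have \<delta>: "\<delta> > 0" using ne by (simp add: \<delta>_def g_def)
    have contg: "continuous_on UNIV g" unfolding g_def by (intro continuous_intros)
    have contp: "continuous_on UNIV place"
      using linear_place by (intro linear_continuous_on) (simp add: linear_conv_bounded_linear)
    have "continuous_on UNIV (\<lambda>z. g (place z))"
      by (rule continuous_on_compose2[OF contg contp]) simp
    then obtain e1 where e1: "e1 > 0" "\<And>z. dist z y < e1 \<Longrightarrow> dist (g (place z)) (g (place y)) < \<delta>"
      using \<delta> unfolding continuous_on_iff by (metis UNIV_I)
    obtain r0 q0 where r0: "0 < r0" "r0 \<le> e1" "open (?f ` ball y r0)"
      using quad_map_local_homeomorphism[OF sym xy(5) e1(1)] by metis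
    \<comment> \<open>The generic framework need not lie in the gauge, so the forms are evaluated on
      frameworks directly; the padding entries are copied from \<open>y\<close>.\<close>
    define F where "F \<sigma> = (\<chi> k. if k \<in> idx then stress_form (M k) \<sigma> \<sigma> else y $ k)" for \<sigma> :: "('d, 'v) framework"
    have contF: "continuous_on UNIV F" unfolding F_def
    proof (rule continuous_on_vec_lambda)
      fix k show "continuous_on UNIV (\<lambda>\<sigma>. if k \<in> idx then stress_form (M k) \<sigma> \<sigma> else y $ k)"
        by (cases "k \<in> idx") (simp_all add: continuous_on_stress_form)
    qed
    have "F (place x) = ?f y"
    proof -
      have "F (place x) $ k = ?f y $ k" for k
        using arg_cong[OF xy(4), of "\<lambda>v. v $ k"] by (cases "k \<in> idx") (simp_all add: F_def fval)
      then show ?thesis by (simp add: vec_eq_iff)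
    qed
    then have "F (place x) \<in> ?f ` ball y r0" using r0(1) by simp
    moreover have "open (F -` (?f ` ball y r0))" using open_vimage[OF r0(3) contF] .
    ultimately obtain e2 where e2: "e2 > 0" "\<And>\<sigma>. dist \<sigma> (place x) < e2 \<Longrightarrow> F \<sigma> \<in> ?f ` ball y r0"
      unfolding open_dist by (metis vimage_eq)
    obtain e3 where e3: "e3 > 0" "\<And>\<sigma>. dist \<sigma> (place x) < e3 \<Longrightarrow> dist (g \<sigma>) (g (place x)) < \<delta>"
      using contg \<delta> unfolding continuous_on_iff by (metis UNIV_I)
    obtain t where t: "generic_framework (place x + t *\<^sub>R (\<rho> - place x))"
      "dist (place x + t *\<^sub>R (\<rho> - place x)) (place x) < min e2 e3"
      using generic_on_line_near[OF gen, of "min e2 e3" "place x"] e2(1) e3(1) by auto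
    define \<sigma> where "\<sigma> = place x + t *\<^sub>R (\<rho> - place x)"
    have \<sigma>K: "\<sigma> \<in> kernel_frameworks E \<rho>"
      using place_K[of x] coord_vec_in_kernel[of \<rho>] unfolding kernel_frameworks_def \<sigma>_def
      by (auto intro!: subspace_add subspace_scale subspace_diff subspace_shared_kernel)
    have "F \<sigma> \<in> ?f ` ball y r0" using e2(2) t(2) by (simp add: \<sigma>_def)
    then obtain y' where y': "dist y y' < r0" "F \<sigma> = ?f y'" by auto
    have "same_edge_lengths E \<sigma> (place y')"
    proof (rule same_lengths_of_forms[OF ME[rule_format] \<sigma>K place_K])
      show "stress_form (M k) \<sigma> \<sigma> = stress_form (M k) (place y') (place y')" if "k \<in> idx" for k
        using arg_cong[OF y'(2), of "\<lambda>v. v $ k"] that by (simp add: F_def fval)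
    qed
    then have "congruent_frameworks \<sigma> (place y')"
      using rigid[OF t(1)] unfolding globally_rigid_def \<sigma>_def by blast
    then have "g (place y') = g \<sigma>" unfolding g_def by (rule congruent_imp_same_dist)
    moreover have "dist (g \<sigma>) (g (place x)) < \<delta>" using e3(2) t(2) by (simp add: \<sigma>_def)
    moreover have "dist (g (place y')) (g (place y)) < \<delta>" using e1(2) y'(1) r0(2) by (simp add: dist_commute)
    ultimately show False using dist_triangle3[of "g (place x)" "g (place y)" "g \<sigma>"] by (simp add: \<delta>_def)
  qed
  have h0: "place z $ h 0 = 0" for z by (simp add: vec_eq_iff place_h)
  have gram: "place x $ h j \<bullet> place x $ h l = place y $ h j \<bullet> place y $ h l" for j l
    using dist_eq[of "h j" "h 0"] dist_eq[of "h l" "h 0"] dist_eq[of "h j" "h l"]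
    by (simp add: h0 dist_norm norm_eq inner_diff_left inner_diff_right inner_commute)
  \<comment> \<open>Uniqueness of triangular factors of a Gram matrix: the entries of an axis are
    determined up to a common sign, and the pivot entry has the same sign in \<open>x\<close> and
    \<open>y\<close>.\<close>
  have pos_eq: "pos x j i = pos y j i" if "j \<le> n" for i j
    using that
  proof (induction "r i" arbitrary: i j rule: less_induct)
    case less
    obtain s where s: "s \<le> n" "r i < s" "xs $ (h s, i) \<noteq> 0" "\<And>l. r i < r l \<Longrightarrow> s \<le> r l" using pivot[of i] by blast
    have eq: "pos x s i * pos x j i = pos y s i * pos y j i" if j: "j \<le> n" for j
    proof -
      have "(\<Sum>m\<in>UNIV. place x $ h s $ m * place x $ h j $ m - place y $ h s $ m * place y $ h j $ m)
          = (\<Sum>m\<in>UNIV. if m = i then pos x s i * pos x j i - pos y s i * pos y j i else 0)"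
      proof (rule sum.cong[OF refl])
        fix m
        show "place x $ h s $ m * place x $ h j $ m - place y $ h s $ m * place y $ h j $ m
            = (if m = i then pos x s i * pos x j i - pos y s i * pos y j i else 0)"
        proof (cases "r m" "r i" rule: linorder_cases)
          case less
          then show ?thesis using less.hyps[OF less s(1)] less.hyps[OF less j] s(1) j by (auto simp: place_h)
        next
          case equal
          then show ?thesis using r_inj s(1) j by (auto simp: place_h)
        next
          case greater
          then have "pos x s m = 0" "pos y s m = 0" using s(4)[of m] by (simp_all add: pos_def)
          then show ?thesis using greater s(1) j by (auto simp: place_h)
        qed
      qed
      moreover have "(\<Sum>m\<in>UNIV. place x $ h s $ m * place x $ h j $ m - place y $ h s $ m * place y $ h j $ m) = 0"
        using gram[of s j] by (simp add: inner_vec_def sum_subtractf)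
      ultimately show ?thesis by simp
    qed
    have prod: "pos x s i * pos y s i > 0" using sign[OF s(3)] s(2) by (simp add: pos_def)
    have "(pos x s i - pos y s i) * (pos x s i + pos y s i) = 0" using eq[OF s(1)] by (simp add: algebra_simps)
    moreover have "pos x s i + pos y s i \<noteq> 0"
    proof
      assume "pos x s i + pos y s i = 0"
      then have "pos y s i = - pos x s i" by simp
      then show False using prod by simp
    qed
    ultimately have "pos x s i = pos y s i" by simp
    moreover from this have "pos x s i \<noteq> 0" using prod by auto
    ultimately show ?case using eq[OF less.prems] by simp
  qed
  have "x $ k = y $ k" for k
  proof (cases "k \<in> idx")
    case True
    then obtain j i where "k = (h j, i)" "j \<le> n" "r i < j" by (rule idxE)
    then show ?thesis using pos_eq[of j i] by (simp add: pos_def)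
  next
    case False
    then show ?thesis using arg_cong[OF xy(4), of "\<lambda>v. v $ k"] by (simp add: fval)
  qed
  then have "x = y" by (simp add: vec_eq_iff)
  then show False using xy(1) by simp
qed

end

section \<open>Existence of a gauge, connectedness and the equivalence\<close>

lemma kernel_gauge_exists:
  fixes \<rho> :: "('d::finite, 'v::finite) framework"
  assumes gen: "generic_framework \<rho>" and dim: "dim (shared_stress_kernel E \<rho>) \<ge> CARD('d) + 2"
  shows "\<exists>c h n r Q. kernel_gauge E \<rho> c h n r Q"
proof -
  let ?K = "shared_stress_kernel E \<rho>"
  define n where "n = dim ?K - 1"
  have n: "dim ?K = Suc n" "CARD('d) < n" using dim by (simp_all add: n_def)
  obtain W c where W: "card W = dim ?K" "\<And>w. w \<in> W \<Longrightarrow> c w \<in> ?K"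
    "\<And>w w'. w \<in> W \<Longrightarrow> w' \<in> W \<Longrightarrow> c w $ w' = (if w = w' then 1 else 0)"
    "\<And>y. y \<in> ?K \<Longrightarrow> y = (\<Sum>w\<in>W. y $ w *\<^sub>R c w)"
    using subspace_coordinate_dual_basis[OF subspace_shared_kernel, of E \<rho>] by metis
  have "finite W" by simp
  then obtain h where "bij_betw h {0..<card W} W" using ex_bij_betw_nat_finite by blast
  moreover have "{0..<card W} = {..n}" using W(1) n by auto
  ultimately have h: "bij_betw h {..n} W" by simp
  then have hW: "h j \<in> W" if "j \<le> n" for j using that by (auto simp: bij_betw_def)
  have hinj: "inj_on h {..n}" using h by (simp add: bij_betw_def)
  obtain r :: "'d \<Rightarrow> nat" where "bij_betw r UNIV {0..<CARD('d)}" using ex_bij_betw_finite_nat[of "UNIV :: 'd set"] by auto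
  then have r: "bij_betw r UNIV {..<CARD('d)}" by (simp add: lessThan_atLeast0)
  have indep: "\<rho> $ h j - \<rho> $ h 0 \<notin> span ((\<lambda>j. \<rho> $ h j - \<rho> $ h 0) ` {0<..<j})" if "0 < j" "j \<le> CARD('d)" for j
    using that n(2) by (intro generic_vertices_independent[OF gen]) (auto intro: inj_on_subset[OF hinj])
  obtain Q :: "real ^ 'd ^ 'd" where Q: "orthogonal_matrix Q"
    "\<And>i j. 0 < j \<Longrightarrow> j \<le> r i \<Longrightarrow> (Q *v (\<rho> $ h j - \<rho> $ h 0)) $ i = 0"
    "\<And>i. (Q *v (\<rho> $ h (Suc (r i)) - \<rho> $ h 0)) $ i \<noteq> 0"
    using triangular_coordinates[OF r indep] by metis
  have "kernel_gauge E \<rho> (\<lambda>j. c (h j)) h n r Q"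
  proof
    show "c (h j) \<in> ?K" if "j \<le> n" for j using W(2) hW that by blast
    show "c (h j) $ h l = (if j = l then 1 else 0)" if "j \<le> n" "l \<le> n" for j l
      using W(3)[OF hW[OF that(1)] hW[OF that(2)]] inj_onD[OF hinj, of j l] that by auto
    show "y = (\<Sum>j\<le>n. y $ h j *\<^sub>R c (h j))" if "y \<in> ?K" for y
      using W(4)[OF that] sum.reindex_bij_betw[OF h, of "\<lambda>w. y $ w *\<^sub>R c w"] by simp
  qed (use gen hinj n r Q in auto)
  then show ?thesis by blast
qed

lemma generic_framework_exists: "\<exists>\<rho> :: ('d::finite, 'v::finite) framework. generic_framework \<rho>"
  using generic_framework_near[of 1] zero_less_one by blast

lemma generically_globally_rigid_connected:
  fixes E :: "'v::finite set set"
  assumes rigid: "\<And>\<rho> :: ('d::finite, 'v) framework. generic_framework \<rho> \<Longrightarrow> globally_rigid E \<rho>"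
  shows "graph_connected E"
  unfolding graph_connected_def
proof (intro allI impI, rule ccontr)
  fix U :: "'v set" assume "U \<noteq> {}" "U \<noteq> UNIV" and no: "\<not> (\<exists>u\<in>U. \<exists>w. w \<notin> U \<and> {u, w} \<in> E)"
  then obtain u w where uw: "u \<in> U" "w \<notin> U" by blast
  obtain \<rho> :: "('d, 'v) framework" where gen: "generic_framework \<rho>"
    using generic_framework_exists by blast
  define p where "p = \<rho> $ u - \<rho> $ w"
  \<comment> \<open>Translating one side of the cut by \<open>p\<close> doubles the distance between
    \<open>u\<close> and \<open>w\<close>; if they coincide, a unit vector separates them.\<close>
  define t where "t = (if p = 0 then axis undefined 1 else p)"
  have t: "norm (p + t) \<noteq> norm p"
  proof (cases "p = 0")
    case False
    then have "norm (p + t) = 2 * norm p" by (simp add: t_def scaleR_2[symmetric])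
    then show ?thesis using False by simp
  qed (simp add: t_def)
  define \<sigma> where "\<sigma> = (\<chi> v. if v \<in> U then \<rho> $ v + t else \<rho> $ v)"
  have "same_edge_lengths E \<rho> \<sigma>" unfolding same_edge_lengths_def
  proof (intro allI impI)
    fix x y assume e: "{x, y} \<in> E"
    then have "{y, x} \<in> E" by (simp add: insert_commute)
    with e no have "x \<in> U \<longleftrightarrow> y \<in> U" by blast
    then show "dist (\<sigma> $ x) (\<sigma> $ y) = dist (\<rho> $ x) (\<rho> $ y)" by (simp add: \<sigma>_def)
  qed
  then have "congruent_frameworks \<rho> \<sigma>" using rigid[OF gen] by (simp add: globally_rigid_def)
  from congruent_imp_same_dist[OF this, of u w] have "norm (p + t) = norm p"
    using uw by (simp add: \<sigma>_def dist_norm p_def algebra_simps)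
  then show False using t by simp
qed

theorem theorem4p4:
  fixes E :: "'v::finite set set"
  assumes "graph_edges E"
    and "CARD('v) \<ge> CARD('d::finite) + 2"
  shows "generically_globally_rigid TYPE('d) E \<longleftrightarrow>
         shared_stress_nullity TYPE('d) E = CARD('d) + 1"
proof -
  define \<rho> where "\<rho> = (SOME \<rho> :: ('d, 'v) framework. generic_framework \<rho>)"
  have gen: "generic_framework \<rho>" unfolding \<rho>_def by (rule someI_ex[OF generic_framework_exists])
  have nullity: "shared_stress_nullity TYPE('d) E = dim (shared_stress_kernel E \<rho>)"
    by (simp add: shared_stress_nullity_def \<rho>_def)
  show ?thesis
  proof
    assume "generically_globally_rigid TYPE('d) E"
    then have rigid: "\<And>\<sigma> :: ('d, 'v) framework. generic_framework \<sigma> \<Longrightarrow> globally_rigid E \<sigma>"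
      by (simp add: generically_globally_rigid_def)
    have "CARD('d) + 1 \<le> dim (shared_stress_kernel E \<rho>)"
      unfolding dim_range_affine_comb[OF gen assms(2), symmetric] by (rule dim_subset[OF affine_comb_in_kernel])
    moreover have "\<not> CARD('d) + 2 \<le> dim (shared_stress_kernel E \<rho>)"
    proof
      assume "CARD('d) + 2 \<le> dim (shared_stress_kernel E \<rho>)"
      from kernel_gauge_exists[OF gen this] obtain c h n r Q where "kernel_gauge E \<rho> c h n r Q" by blast
      then interpret kernel_gauge E \<rho> c h n r Q .
      show False
        by (rule not_generically_globally_rigid[OF generically_globally_rigid_connected[OF rigid] rigid])
    qed
    ultimately show "shared_stress_nullity TYPE('d) E = CARD('d) + 1" unfolding nullity by linarith
  next
    assume d: "shared_stress_nullity TYPE('d) E = CARD('d) + 1"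
    \<comment> \<open>The nullity speaks of one chosen generic framework; constancy of the dimension
      carries it to all of them.\<close>
    obtain m where m: "\<And>\<sigma> :: ('d, 'v) framework. generic_framework \<sigma> \<Longrightarrow> dim (shared_stress_kernel E \<sigma>) = m"
      using generic_dims[where 'd = 'd, of E] by blast
    show "generically_globally_rigid TYPE('d) E"
      unfolding generically_globally_rigid_def
    proof (intro allI impI)
      fix \<sigma> :: "('d, 'v) framework" assume \<sigma>: "generic_framework \<sigma>"
      show "globally_rigid E \<sigma>"
        by (rule generic_globally_rigid_of_kernel_dim[OF \<sigma> assms(2)])
           (use m[OF \<sigma>] m[OF gen] d nullity in simp)
    qed
  qed
qed

end
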